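(* Let $\vec\Phi:\Sigma\to\mathbb{R}^m$ be an immersion of a 4-dimensional manifold $\Sigma$. Then $\vec\Phi$ is a critical point of $$\mathcal{E}(\Sigma)=\int_{\Sigma}\left(|\pi_{\vec n}\nabla\vec H|^2-|\vec H\cdot\vec h|^2+7|\vec H|^4\right)d\mathrm{vol}_g$$ if and only if $\vec{\mathcal W}=\vec 0$, where $$\begin{aligned}\vec{\mathcal W}:={}&-\tfrac12\Delta_\perp^2\vec H-\tfrac12(\vec h_{ik}\cdot\Delta_\perp\vec H)\vec h^{ik}-4|\pi_{\vec n}\nabla\vec H|^2\vec H+2\pi_{\vec n}\nabla_j\big((\vec h^j_i\cdot\nabla^i\vec H)\vec H\big)\\&-2\pi_{\vec n}\nabla_j\big((\vec H\cdot\vec h^j_i)\pi_{\vec n}\nabla^i\vec H\big)+2(\pi_{\vec n}\nabla_i\vec H\cdot\pi_{\vec n}\nabla_j\vec H)\vec h^{ij}\\&-\tfrac12\Delta_\perp\big((\vec H\cdot\vec h^{ij})\vec h_{ij}\big)-2\pi_{\vec n}\nabla_i\nabla_k\big((\vec H\cdot\vec h^{ik})\vec H\big)-28|\vec H|^4\vec H\\&-\tfrac12(\vec H\cdot\vec h^{ij})(\vec h_{ij}\cdot\vec h_{pq})\vec h^{pq}-4(\vec H\cdot\vec h_{ij})(\vec H\cdot\vec h^i_k)\vec h^{jk}+4|\vec H\cdot\vec h|^2\vec H\\&+7\Delta_\perp(|\vec H|^2\vec H)+7|\vec H|^2(\vec H\cdot\vec h_{ij})\vec h^{ij}.\end{a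ligned}$$
   Context: $g_{ij}=\nabla_i\vec\Phi\cdot\nabla_j\vec\Phi$ is the induced metric, $\nabla$ its Levi-Civita connection (acting componentwise on $\mathbb{R}^m$-valued tensors), $d\mathrm{vol}_g$ its volume element. Indices are raised and lowered with $g$, and repeated indices are summed. $\vec h_{ij}=\nabla_i\nabla_j\vec\Phi$ is the second fundamental form and $\vec H=\frac14 g^{ij}\vec h_{ij}$ the mean curvature vector. $\pi_{\vec n}$ is the projection onto the normal bundle. $|\pi_{\vec n}\nabla\vec H|^2=\pi_{\vec n}\nabla_i\vec H\cdot\pi_{\vec n}\nabla^i\vec H$, $|\vec H\cdot\vec h|^2=(\vec H\cdot\vec h_{ij})(\vec H\cdot\vec h^{ij})$, $|\vec H|^4=(\vec H\cdot\vec H)^2$. $\Delta_\perp$ is the Laplacian of the Levi-Civita connection in the normal bundle: $\Delta_\perp\vec X=\pi_{\vec n}\nabla^j\pi_{\vec n}\nabla_j\vec X$ for normal $\vec X$. Immersions are assumed smooth, and critical points are understood with respect to smooth variations supported in small patches of $\Sigma$. *)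

theory Defs
  imports "HOL-Analysis.Analysis"
begin

section \<open>Smooth maps between open subsets of Euclidean spaces\<close>

text \<open>Only meaningful for open \<open>S\<close>, where \<^term>\<open>at x\<close> is the filter one wants.\<close>

fun Ck_on :: "nat \<Rightarrow> 'a::euclidean_space set \<Rightarrow> ('a \<Rightarrow> 'b::real_normed_vector) \<Rightarrow> bool" where
  "Ck_on 0 S f \<longleftrightarrow> continuous_on S f"
| "Ck_on (Suc n) S f \<longleftrightarrow>
     (\<forall>x\<in>S. f differentiable at x) \<and> (\<forall>v. Ck_on n S (\<lambda>x. frechet_derivative f (at x) v))"

definition smooth_on :: "'a::euclidean_space set \<Rightarrow> ('a \<Rightarrow> 'b::real_normed_vector) \<Rightarrow> bool" where
  "smooth_on S f \<longleftrightarrow> (\<forall>n. Ck_on n S f)"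


section \<open>Smooth 4-manifolds and immersions\<close>

text \<open>A chart is a pair \<open>(U, \<phi>)\<close>; the values of \<open>\<phi>\<close> outside \<open>U\<close> are irrelevant.\<close>

type_synonym 'a chart = "'a set \<times> ('a \<Rightarrow> real^4)"

definition cdom :: "'a chart \<Rightarrow> 'a set" where
  "cdom c = fst c"

definition cimg :: "'a chart \<Rightarrow> (real^4) set" where
  "cimg c = snd c ` fst c"

definition cpar :: "'a chart \<Rightarrow> real^4 \<Rightarrow> 'a" where
  "cpar c = inv_into (fst c) (snd c)"

definition smooth_manifold4 :: "'a topology \<Rightarrow> 'a chart set \<Rightarrow> bool" where
  "smooth_manifold4 \<Sigma> \<A> \<longleftrightarrow>
     Hausdorff_space \<Sigma> \<and> second_countable \<Sigma> \<and>
     (\<Union>c\<in>\<A>. cdom c) = topspace \<Sigma> \<and>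
     (\<forall>c\<in>\<A>. openin \<Sigma> (cdom c) \<and> open (cimg c) \<and>
        homeomorphic_map (subtopology \<Sigma> (cdom c)) (top_of_set (cimg c)) (snd c)) \<and>
     (\<forall>c\<in>\<A>. \<forall>d\<in>\<A>. smooth_on (snd c ` (cdom c \<inter> cdom d)) (snd d \<circ> cpar c))"

definition smooth_map :: "'a chart set \<Rightarrow> ('a \<Rightarrow> real^'m) \<Rightarrow> bool" where
  "smooth_map \<A> f \<longleftrightarrow> (\<forall>c\<in>\<A>. smooth_on (cimg c) (f \<circ> cpar c))"

definition immersion :: "'a chart set \<Rightarrow> ('a \<Rightarrow> real^'m) \<Rightarrow> bool" where
  "immersion \<A> f \<longleftrightarrow> smooth_map \<A> f \<and>
     (\<forall>c\<in>\<A>. \<forall>x\<in>cimg c. inj (frechet_derivative (f \<circ> cpar c) (at x)))"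


section \<open>Geometry of an immersion in local coordinates\<close>

definition pd :: "4 \<Rightarrow> (real^4 \<Rightarrow> 'v::real_normed_vector) \<Rightarrow> real^4 \<Rightarrow> 'v" where
  "pd i f x = frechet_derivative f (at x) (axis i 1)"

text \<open>
  \<open>F\<close> is the immersion read in a chart. All sums over indices are over the four coordinates.
  A tensor is given by its components, as functions of the coordinate point, and may take
  values in the ambient space. The covariant derivative \<open>\<nabla>\<close> acts on ambient components, so on
  index-free objects \<open>\<nabla>\<^sub>i\<close> is just \<^term>\<open>pd i\<close>.
\<close>

context
  fixes F :: "real^4 \<Rightarrow> real^'m"
begin

definition metric :: "real^4 \<Rightarrow> real^4^4" where
  "metric x = (\<chi> i j. pd i F x \<bullet> pd j F x)"

definition gl :: "4 \<Rightarrow> 4 \<Rightarrow> real^4 \<Rightarrow> real" where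
  "gl i j x = metric x $ i $ j"

definition gu :: "4 \<Rightarrow> 4 \<Rightarrow> real^4 \<Rightarrow> real" where
  "gu i j x = matrix_inv (metric x) $ i $ j"

definition vol_density :: "real^4 \<Rightarrow> real" where
  "vol_density x = sqrt (det (metric x))"

definition christoffel :: "4 \<Rightarrow> 4 \<Rightarrow> 4 \<Rightarrow> real^4 \<Rightarrow> real"  \<comment> \<open>\<open>\<Gamma>\<close> with upper index \<open>k\<close> and lower \<open>i\<close>, \<open>j\<close>\<close>
  where "christoffel k i j x =
    1/2 * (\<Sum>l\<in>UNIV. gu k l x * (pd i (gl j l) x + pd j (gl i l) x - pd l (gl i j) x))"

definition nproj :: "real^4 \<Rightarrow> real^'m \<Rightarrow> real^'m"  \<comment> \<open>orthogonal projection \<open>\<pi>\<^sub>n\<close> off the tangent space\<close>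
  where "nproj x v = v - (\<Sum>i\<in>UNIV. \<Sum>j\<in>UNIV. (gu i j x * (v \<bullet> pd i F x)) *\<^sub>R pd j F x)"

definition raise1 :: "(4 \<Rightarrow> real^4 \<Rightarrow> 'v::real_normed_vector) \<Rightarrow> 4 \<Rightarrow> real^4 \<Rightarrow> 'v" where
  "raise1 \<omega> i x = (\<Sum>k\<in>UNIV. gu i k x *\<^sub>R \<omega> k x)"

text \<open>\<open>\<nabla>\<^sub>i \<omega>\<^sub>j\<close> for a covector, \<open>\<nabla>\<^sub>i Y\<^sup>j\<close> for a vector and \<open>\<nabla>\<^sub>k T\<^sup>i\<^sup>j\<close> for a \<open>(2,0)\<close> tensor.\<close>

definition nabla_covec :: "(4 \<Rightarrow> real^4 \<Rightarrow> 'v::real_normed_vector) \<Rightarrow> 4 \<Rightarrow> 4 \<Rightarrow> real^4 \<Rightarrow> 'v" where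
  "nabla_covec \<omega> i j x = pd i (\<omega> j) x - (\<Sum>k\<in>UNIV. christoffel k i j x *\<^sub>R \<omega> k x)"

definition nabla_vec :: "(4 \<Rightarrow> real^4 \<Rightarrow> 'v::real_normed_vector) \<Rightarrow> 4 \<Rightarrow> 4 \<Rightarrow> real^4 \<Rightarrow> 'v" where
  "nabla_vec Y i j x = pd i (Y j) x + (\<Sum>k\<in>UNIV. christoffel j i k x *\<^sub>R Y k x)"

definition nabla_ten :: "(4 \<Rightarrow> 4 \<Rightarrow> real^4 \<Rightarrow> 'v::real_normed_vector) \<Rightarrow> 4 \<Rightarrow> 4 \<Rightarrow> 4 \<Rightarrow> real^4 \<Rightarrow> 'v" where
  "nabla_ten T k i j x = pd k (T i j) x
     + (\<Sum>l\<in>UNIV. christoffel i k l x *\<^sub>R T l j x)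
     + (\<Sum>l\<in>UNIV. christoffel j k l x *\<^sub>R T i l x)"

text \<open>\<open>\<nabla>\<^sub>j Y\<^sup>j\<close> and \<open>\<nabla>\<^sub>k T\<^sup>i\<^sup>k\<close>.\<close>

definition div_vec :: "(4 \<Rightarrow> real^4 \<Rightarrow> 'v::real_normed_vector) \<Rightarrow> real^4 \<Rightarrow> 'v" where
  "div_vec Y x = (\<Sum>j\<in>UNIV. nabla_vec Y j j x)"

definition div_ten :: "(4 \<Rightarrow> 4 \<Rightarrow> real^4 \<Rightarrow> 'v::real_normed_vector) \<Rightarrow> 4 \<Rightarrow> real^4 \<Rightarrow> 'v" where
  "div_ten T i x = (\<Sum>k\<in>UNIV. nabla_ten T k i k x)"

text \<open>The second fundamental form \<open>h\<^sub>i\<^sub>j = \<nabla>\<^sub>i \<nabla>\<^sub>j F\<close> with indices down, \<open>h\<^sup>j\<^sub>i\<close>, and indices up.\<close>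

definition hl :: "4 \<Rightarrow> 4 \<Rightarrow> real^4 \<Rightarrow> real^'m" where
  "hl i j = nabla_covec (\<lambda>j. pd j F) i j"

definition hm :: "4 \<Rightarrow> 4 \<Rightarrow> real^4 \<Rightarrow> real^'m" where
  "hm j i = raise1 (\<lambda>k. hl k i) j"

definition hu :: "4 \<Rightarrow> 4 \<Rightarrow> real^4 \<Rightarrow> real^'m" where
  "hu i j = raise1 (\<lambda>l. hm i l) j"

definition H :: "real^4 \<Rightarrow> real^'m" where
  "H x = (1/4) *\<^sub>R (\<Sum>i\<in>UNIV. \<Sum>j\<in>UNIV. gu i j x *\<^sub>R hl i j x)"

text \<open>\<open>\<nabla>\<^sup>i X\<close>, \<open>\<pi>\<^sub>n \<nabla>\<^sub>i X\<close> and \<open>\<pi>\<^sub>n \<nabla>\<^sup>i X\<close>.\<close>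

definition nabla_up :: "(real^4 \<Rightarrow> real^'m) \<Rightarrow> 4 \<Rightarrow> real^4 \<Rightarrow> real^'m" where
  "nabla_up X i = raise1 (\<lambda>k. pd k X) i"

definition pnabla :: "(real^4 \<Rightarrow> real^'m) \<Rightarrow> 4 \<Rightarrow> real^4 \<Rightarrow> real^'m" where
  "pnabla X i x = nproj x (pd i X x)"

definition pnabla_up :: "(real^4 \<Rightarrow> real^'m) \<Rightarrow> 4 \<Rightarrow> real^4 \<Rightarrow> real^'m" where
  "pnabla_up X i x = nproj x (nabla_up X i x)"

text \<open>\<open>\<pi>\<^sub>n \<nabla>\<^sup>j \<pi>\<^sub>n \<nabla>\<^sub>j X\<close>.\<close>

definition normal_laplacian :: "(real^4 \<Rightarrow> real^'m) \<Rightarrow> real^4 \<Rightarrow> real^'m" where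
  "normal_laplacian X x =
     (\<Sum>j\<in>UNIV. nproj x (\<Sum>k\<in>UNIV. gu j k x *\<^sub>R nabla_covec (pnabla X) k j x))"

definition pnablaH_sq :: "real^4 \<Rightarrow> real" where
  "pnablaH_sq x = (\<Sum>i\<in>UNIV. pnabla H i x \<bullet> pnabla_up H i x)"

definition Hh_sq :: "real^4 \<Rightarrow> real" where
  "Hh_sq x = (\<Sum>i\<in>UNIV. \<Sum>j\<in>UNIV. (H x \<bullet> hl i j x) * (H x \<bullet> hu i j x))"

definition energy_density :: "real^4 \<Rightarrow> real" where
  "energy_density x = pnablaH_sq x - Hh_sq x + 7 * (H x \<bullet> H x)^2"

text \<open>
  In the double divergence term only the outermost derivative is followed by a
  projection: \<open>\<nabla>\<^sub>k ((H \<bullet> h\<^sup>i\<^sup>k) H)\<close> has a tangential part, which contributes.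
\<close>

definition W :: "real^4 \<Rightarrow> real^'m" where
  "W x =
     - (1/2) *\<^sub>R normal_laplacian (normal_laplacian H) x
     - (1/2) *\<^sub>R (\<Sum>i\<in>UNIV. \<Sum>k\<in>UNIV. (hl i k x \<bullet> normal_laplacian H x) *\<^sub>R hu i k x)
     - (4 * pnablaH_sq x) *\<^sub>R H x
     + 2 *\<^sub>R nproj x (div_vec (\<lambda>j y. (\<Sum>i\<in>UNIV. hm j i y \<bullet> nabla_up H i y) *\<^sub>R H y) x)
     - 2 *\<^sub>R nproj x (div_vec (\<lambda>j y. \<Sum>i\<in>UNIV. (H y \<bullet> hm j i y) *\<^sub>R pnabla_up H i y) x)
     + 2 *\<^sub>R (\<Sum>i\<in>UNIV. \<Sum>j\<in>UNIV. (pnabla H i x \<bullet> pnabla H j x) *\<^sub>R hu i j x)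
     - (1/2) *\<^sub>R normal_laplacian
         (\<lambda>y. \<Sum>i\<in>UNIV. \<Sum>j\<in>UNIV. (H y \<bullet> hu i j y) *\<^sub>R hl i j y) x
     - 2 *\<^sub>R nproj x (div_vec (div_ten (\<lambda>i k y. (H y \<bullet> hu i k y) *\<^sub>R H y)) x)
     - (28 * (H x \<bullet> H x)^2) *\<^sub>R H x
     - (1/2) *\<^sub>R (\<Sum>i\<in>UNIV. \<Sum>j\<in>UNIV. \<Sum>p\<in>UNIV. \<Sum>q\<in>UNIV.
         ((H x \<bullet> hu i j x) * (hl i j x \<bullet> hl p q x)) *\<^sub>R hu p q x)
     - 4 *\<^sub>R (\<Sum>i\<in>UNIV. \<Sum>j\<in>UNIV. \<Sum>k\<in>UNIV.
         ((H x \<bullet> hl i j x) * (H x \<bullet> hm i k x)) *\<^sub>R hu j k x)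
     + (4 * Hh_sq x) *\<^sub>R H x
     + 7 *\<^sub>R normal_laplacian (\<lambda>y. (H y \<bullet> H y) *\<^sub>R H y) x
     + (7 * (H x \<bullet> H x)) *\<^sub>R (\<Sum>i\<in>UNIV. \<Sum>j\<in>UNIV. (H x \<bullet> hl i j x) *\<^sub>R hu i j x)"

end


section \<open>Energy, variations and critical points\<close>

text \<open>
  The energy of a piece \<open>A\<close> of the manifold contained in the domain of the chart \<open>c\<close>. The
  manifold need not be compact, so its total energy may be infinite; a variation supported in
  \<open>A\<close> changes only the contribution of \<open>A\<close>.
\<close>

definition energy :: "'a chart \<Rightarrow> 'a set \<Rightarrow> ('a \<Rightarrow> real^'m) \<Rightarrow> real" where
  "energy c A f =
     (LINT x:snd c ` A|lborel. energy_density (f \<circ> cpar c) x * vol_density (f \<circ> cpar c) x)"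

definition smooth_variation ::
  "'a topology \<Rightarrow> 'a chart set \<Rightarrow> ('a \<Rightarrow> real^'m) \<Rightarrow> real \<Rightarrow> 'a set \<Rightarrow> (real \<Rightarrow> 'a \<Rightarrow> real^'m) \<Rightarrow> bool" where
  "smooth_variation \<Sigma> \<A> f \<epsilon> K \<Psi> \<longleftrightarrow>
     (\<forall>d\<in>\<A>. smooth_on ({-\<epsilon><..<\<epsilon>} \<times> cimg d) (\<lambda>(t, x). \<Psi> t (cpar d x))) \<and>
     (\<forall>t\<in>{-\<epsilon><..<\<epsilon>}. immersion \<A> (\<Psi> t)) \<and>
     (\<forall>p\<in>topspace \<Sigma>. \<Psi> 0 p = f p) \<and>
     (\<forall>t\<in>{-\<epsilon><..<\<epsilon>}. \<forall>p\<in>topspace \<Sigma> - K. \<Psi> t p = f p)"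

definition critical_point :: "'a topology \<Rightarrow> 'a chart set \<Rightarrow> ('a \<Rightarrow> real^'m) \<Rightarrow> bool" where
  "critical_point \<Sigma> \<A> f \<longleftrightarrow>
     (\<forall>c\<in>\<A>. \<forall>K \<epsilon> \<Psi>. compactin \<Sigma> K \<and> K \<subseteq> cdom c \<and> \<epsilon> > 0 \<and> smooth_variation \<Sigma> \<A> f \<epsilon> K \<Psi> \<longrightarrow>
        ((\<lambda>t. energy c K (\<Psi> t)) has_real_derivative 0) (at 0))"

end

theory Submission
  imports Defs
begin

text \<open>
  The equivalence is the statement that \<open>W\<close> is the Euler--Lagrange operator of the energy. Let
  \<open>F\<close> be the immersion read in a chart, \<open>w\<close> the velocity of a variation supported in a compact set
  \<open>K\<close>, and write \<open>e\<close> for the energy density and \<open>\<mu>\<close> for the volume density. The heart of the matter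
  is that the time derivative of \<open>e \<mu>\<close> is \<open>\<mu> (w \<bullet> W F)\<close> up to the coordinate divergence of a field
  that vanishes off \<open>K\<close> (\<open>first_variation\<close>).

  The derivative of \<open>e \<mu>\<close> is first computed for an arbitrary velocity (\<open>dt_density\<close>). This is short
  because all vectors that \<open>e\<close> pairs with each other are normal, so that only the normal parts of the
  derivatives of \<open>h\<close>, \<open>H\<close> and \<open>\<pi> \<nabla> H\<close> matter. The result \<open>var_density F w\<close> is linear in \<open>w\<close>, hence
  the tangential and the normal part of \<open>w\<close> can be treated separately.

  A tangential velocity \<open>\<Sum> Y k \<partial>\<^sub>k F\<close> produces the divergence \<open>\<Sum> \<partial>\<^sub>k (Y k e \<mu>)\<close>: this is invariance
  under reparametrisation (\<open>var_density_tangent_field\<close>). For constant \<open>Y\<close> it is the chain rule,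
  because the variation is then a translation of the chart; the terms in the derivatives of \<open>Y\<close>
  cancel because \<open>e\<close> is a full contraction of tensors.

  For a normal velocity the formula involves \<open>w\<close> through \<open>\<Delta>\<^sub>\<bottom> w\<close>, \<open>\<nabla>\<nabla> w\<close>, \<open>\<nabla> w\<close> and \<open>w\<close>
  itself. Written with \<open>\<mu>\<close>, all divergences and the normal Laplacian become coordinate divergences
  (\<open>vol_times_div_vec\<close> and its companions), so that integration by parts is the product rule; it
  moves all derivatives from \<open>w\<close> to the coefficients, and these add up to \<open>W\<close>
  (\<open>var_density_normal\<close>).

  Divergences of fields vanishing off a compact set integrate to zero, by translation invariance of
  Lebesgue measure. So \<open>W = 0\<close> makes every derivative of the energy vanish. Conversely, if
  \<open>W \<noteq> 0\<close> at a point, then \<open>F + t b W\<^sub>0\<close> with \<open>W\<^sub>0\<close> the value of \<open>W\<close> there and \<open>b\<close> a bump function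
  with small support is, for short times, a variation along which the derivative of the energy at
  time zero is positive.
\<close>

text \<open>Index contractions run over a whole finite type, mostly the four coordinates; one binder for
  several indices keeps them legible.\<close>

abbreviation (input) sum_over_type :: "('i::finite \<Rightarrow> 'v::comm_monoid_add) \<Rightarrow> 'v"
    (binder "\<Sum>\<^sub>U" 10) where
  "sum_over_type f \<equiv> sum f UNIV"


section \<open>Calculus of smooth maps\<close>

lemma Ck_on_cong:
  assumes "open S" "\<And>x. x \<in> S \<Longrightarrow> f x = g x"
  shows "Ck_on n S f \<longleftrightarrow> Ck_on n S g"
  using assms(2)
proof (induction n arbitrary: f g)
  case 0
  then show ?case by (simp cong: continuous_on_cong)
next
  case (Suc n)
  have der: "(f has_derivative D) (at x) \<longleftrightarrow> (g has_derivative D) (at x)" if "x \<in> S" for x D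
    using has_derivative_transform_within_open[OF _ \<open>open S\<close> that, of f D UNIV g]
      has_derivative_transform_within_open[OF _ \<open>open S\<close> that, of g D UNIV f] Suc.prems by fastforce
  have "f differentiable at x \<longleftrightarrow> g differentiable at x" if "x \<in> S" for x
    using der[OF that] by (simp add: differentiable_def)
  moreover have "Ck_on n S (\<lambda>x. frechet_derivative f (at x) v) \<longleftrightarrow>
                 Ck_on n S (\<lambda>x. frechet_derivative g (at x) v)" for v
    by (rule Suc.IH) (simp add: frechet_derivative_def der)
  ultimately show ?case by simp
qed

text \<open>Any expression for the derivative will do; this frees the closure proofs below from
  \<^const>\<open>frechet_derivative\<close>.\<close>

lemma Ck_on_SucI:
  assumes "open S" "\<And>x. x \<in> S \<Longrightarrow> (f has_derivative f' x) (at x)" "\<And>v. Ck_on n S (\<lambda>x. f' x v)"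
  shows "Ck_on (Suc n) S f"
proof -
  have "Ck_on n S (\<lambda>x. frechet_derivative f (at x) v)" for v
    using assms(2) frechet_derivative_at
    by (subst Ck_on_cong[OF \<open>open S\<close>, where g = "\<lambda>x. f' x v"]) (fastforce intro: assms(3))+
  with assms(2) show ?thesis by (auto simp: differentiable_def)
qed

lemma Ck_on_SucD:
  assumes "Ck_on (Suc n) S f" "x \<in> S"
  shows "(f has_derivative frechet_derivative f (at x)) (at x)"
  using assms by (simp add: frechet_derivative_works)

lemma Ck_on_Suc_imp_Ck_on: "Ck_on (Suc n) S f \<Longrightarrow> Ck_on n S f"
proof (induction n arbitrary: f)
  case 0
  then have "\<forall>x\<in>S. f differentiable at x" by simp
  then show ?case unfolding Ck_on.simps(1)
    by (blast intro: continuous_at_imp_continuous_on differentiable_imp_continuous_within)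
next
  case (Suc n)
  note prems = Suc.prems[unfolded Ck_on.simps(2)[of "Suc n"]]
  show ?case unfolding Ck_on.simps(2)[of n] using prems by (blast intro: Suc.IH)
qed

lemma Ck_on_subset: "Ck_on n S f \<Longrightarrow> T \<subseteq> S \<Longrightarrow> Ck_on n T f"
  by (induction n arbitrary: f) (auto intro: continuous_on_subset)

lemma Ck_on_const: "Ck_on n S (\<lambda>x. c)"
  by (induction n arbitrary: c) auto

lemma Ck_on_bounded_linear:
  assumes "open S" "bounded_linear L" "Ck_on n S f"
  shows "Ck_on n S (\<lambda>x. L (f x))"
  using assms(3)
proof (induction n arbitrary: f)
  case 0
  then show ?case by (simp add: bounded_linear.continuous_on[OF assms(2)])
next
  case (Suc n)
  have "Ck_on n S (\<lambda>x. frechet_derivative f (at x) v)" for v using Suc.prems by simp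
  then show ?case
    by (intro Ck_on_SucI[OF \<open>open S\<close> bounded_linear.has_derivative[OF assms(2) Ck_on_SucD[OF Suc.prems]]] Suc.IH)
qed

lemma Ck_on_linear:
  assumes "open S" "bounded_linear L"
  shows "Ck_on n S L"
proof (cases n)
  case 0
  then show ?thesis
    using assms(2) linear_continuous_on by auto
next
  case (Suc m)
  show ?thesis unfolding Suc
    by (rule Ck_on_SucI[OF \<open>open S\<close> bounded_linear_imp_has_derivative[OF assms(2)] Ck_on_const])
qed

lemma Ck_on_add:
  assumes "open S" "Ck_on n S f" "Ck_on n S g"
  shows "Ck_on n S (\<lambda>x. f x + g x)"
  using assms(2,3)
proof (induction n arbitrary: f g)
  case 0
  then show ?case by (simp add: continuous_on_add)
next
  case (Suc n)
  have "Ck_on n S (\<lambda>x. frechet_derivative f (at x) v)" "Ck_on n S (\<lambda>x. frechet_derivative g (at x) v)" for v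
    using Suc.prems by simp_all
  then show ?case
    by (intro Ck_on_SucI[OF \<open>open S\<close> has_derivative_add[OF Ck_on_SucD[OF Suc.prems(1)] Ck_on_SucD[OF Suc.prems(2)]]] Suc.IH)
qed

lemma Ck_on_bilinear:
  assumes "open S" "bounded_bilinear B" "Ck_on n S f" "Ck_on n S g"
  shows "Ck_on n S (\<lambda>x. B (f x) (g x))"
  using assms(3,4)
proof (induction n arbitrary: f g)
  case 0
  then show ?case by (simp add: bounded_bilinear.continuous_on[OF assms(2)])
next
  case (Suc n)
  have *: "Ck_on n S f" "Ck_on n S g" using Suc.prems Ck_on_Suc_imp_Ck_on by blast+
  have "Ck_on n S (\<lambda>x. frechet_derivative f (at x) v)" "Ck_on n S (\<lambda>x. frechet_derivative g (at x) v)" for v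
    using Suc.prems by simp_all
  with * show ?case
    by (intro Ck_on_SucI[OF \<open>open S\<close> bounded_bilinear.FDERIV[OF assms(2) Ck_on_SucD[OF Suc.prems(1)] Ck_on_SucD[OF Suc.prems(2)]]]
        Ck_on_add[OF \<open>open S\<close>] Suc.IH)
qed

lemma Ck_on_sum:
  assumes "open S" "\<And>i. i \<in> A \<Longrightarrow> Ck_on n S (f i)"
  shows "Ck_on n S (\<lambda>x. \<Sum>i\<in>A. f i x)"
  using assms(2)
proof (induction A rule: infinite_finite_induct)
  case (insert a A)
  then show ?case using Ck_on_add[OF \<open>open S\<close>, of n "f a"] by simp
qed (simp_all add: Ck_on_const)

text \<open>The chain rule, written in coordinates, expresses a derivative of a composition through
  products of lower-order objects; this is what makes the induction on the order go through.\<close>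

lemma Ck_on_compose:
  fixes f :: "'a::euclidean_space \<Rightarrow> 'b::euclidean_space"
  assumes "open S" "open T" "\<And>x. x \<in> S \<Longrightarrow> f x \<in> T" "Ck_on n T g" "Ck_on n S f"
  shows "Ck_on n S (\<lambda>x. g (f x))"
  using assms(4,5)
proof (induction n arbitrary: g)
  case 0
  then show ?case using assms(3) continuous_on_compose2[of T g S f] by auto
next
  case (Suc n)
  have f: "Ck_on n S f" using Suc.prems Ck_on_Suc_imp_Ck_on by blast
  show ?case
  proof (rule Ck_on_SucI[OF \<open>open S\<close>])
    fix x assume x: "x \<in> S"
    have d: "((\<lambda>x. g (f x)) has_derivative
        (\<lambda>v. frechet_derivative g (at (f x)) (frechet_derivative f (at x) v))) (at x)"
      using has_derivative_compose[OF Ck_on_SucD[OF Suc.prems(2) x] Ck_on_SucD[OF Suc.prems(1) assms(3)[OF x]]] .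
    have rep: "frechet_derivative g (at (f x)) w = (\<Sum>b\<in>Basis. (w \<bullet> b) *\<^sub>R frechet_derivative g (at (f x)) b)" for w
    proof -
      have "linear (frechet_derivative g (at (f x)))"
        using Suc.prems(1) assms(3)[OF x] by (auto intro: linear_frechet_derivative)
      then show ?thesis
        by (subst euclidean_representation[symmetric, of w])
           (simp add: linear_sum linear_cmul del: euclidean_representation)
    qed
    show "((\<lambda>x. g (f x)) has_derivative
        (\<lambda>v. \<Sum>b\<in>Basis. (frechet_derivative f (at x) v \<bullet> b) *\<^sub>R frechet_derivative g (at (f x)) b)) (at x)"
      using d by (rule back_subst[where P = "\<lambda>D. (_ has_derivative D) _"]) (rule ext, rule rep)
  next
    fix v
    have "Ck_on n S (\<lambda>x. frechet_derivative f (at x) v)" "Ck_on n T (\<lambda>y. frechet_derivative g (at y) b)" for b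
      using Suc.prems by simp_all
    then show "Ck_on n S (\<lambda>x. \<Sum>b\<in>Basis. (frechet_derivative f (at x) v \<bullet> b) *\<^sub>R frechet_derivative g (at (f x)) b)"
      by (intro Ck_on_sum[OF \<open>open S\<close>] Ck_on_bilinear[OF \<open>open S\<close> bounded_bilinear_scaleR]
          Ck_on_bilinear[OF \<open>open S\<close> bounded_bilinear_inner] Ck_on_const Suc.IH f)
  qed
qed

lemma Ck_on_local:
  assumes "\<And>x. x \<in> S \<Longrightarrow> \<exists>T. open T \<and> x \<in> T \<and> Ck_on n T f"
  shows "Ck_on n S f"
  using assms
proof (induction n arbitrary: f)
  case 0
  have "continuous (at x) f" if xS: "x \<in> S" for x
  proof -
    obtain T where "open T" "x \<in> T" "continuous_on T f" using "0.prems"[OF xS] by auto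
    then show ?thesis by (simp add: continuous_on_eq_continuous_at)
  qed
  then show ?case by (simp add: continuous_at_imp_continuous_on)
next
  case (Suc n)
  have T: "\<exists>T. open T \<and> x \<in> T \<and> (\<forall>x\<in>T. f differentiable at x) \<and> (\<forall>v. Ck_on n T (\<lambda>x. frechet_derivative f (at x) v))"
    if "x \<in> S" for x
    using Suc.prems[OF that] by simp
  have "Ck_on n S (\<lambda>x. frechet_derivative f (at x) v)" for v
    by (rule Suc.IH) (use T in blast)
  moreover have "\<forall>x\<in>S. f differentiable at x" using T by blast
  ultimately show ?case by simp
qed

lemma smooth_on_cong:
  "open S \<Longrightarrow> (\<And>x. x \<in> S \<Longrightarrow> f x = g x) \<Longrightarrow> smooth_on S f \<longleftrightarrow> smooth_on S g"
  unfolding smooth_on_def using Ck_on_cong by blast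

lemma smooth_on_subset: "smooth_on S f \<Longrightarrow> T \<subseteq> S \<Longrightarrow> smooth_on T f"
  unfolding smooth_on_def using Ck_on_subset by blast

lemma smooth_on_local:
  "(\<And>x. x \<in> S \<Longrightarrow> \<exists>T. open T \<and> x \<in> T \<and> smooth_on T f) \<Longrightarrow> smooth_on S f"
  unfolding smooth_on_def by (meson Ck_on_local)

lemma smooth_on_const: "smooth_on S (\<lambda>x. c)"
  by (simp add: smooth_on_def Ck_on_const)

lemma smooth_on_bounded_linear: "open S \<Longrightarrow> bounded_linear L \<Longrightarrow> smooth_on S L"
  by (simp add: smooth_on_def Ck_on_linear)

lemma smooth_on_bounded_linear_compose:
  "open S \<Longrightarrow> bounded_linear L \<Longrightarrow> smooth_on S f \<Longrightarrow> smooth_on S (\<lambda>x. L (f x))"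
  by (simp add: smooth_on_def Ck_on_bounded_linear)

lemma smooth_on_add: "open S \<Longrightarrow> smooth_on S f \<Longrightarrow> smooth_on S g \<Longrightarrow> smooth_on S (\<lambda>x. f x + g x)"
  by (simp add: smooth_on_def Ck_on_add)

lemma smooth_on_sum:
  "open S \<Longrightarrow> (\<And>i. i \<in> A \<Longrightarrow> smooth_on S (f i)) \<Longrightarrow> smooth_on S (\<lambda>x. \<Sum>i\<in>A. f i x)"
  by (simp add: smooth_on_def Ck_on_sum)

lemma smooth_on_bilinear:
  "open S \<Longrightarrow> bounded_bilinear B \<Longrightarrow> smooth_on S f \<Longrightarrow> smooth_on S g \<Longrightarrow> smooth_on S (\<lambda>x. B (f x) (g x))"
  by (simp add: smooth_on_def Ck_on_bilinear)

lemmas smooth_on_mult = smooth_on_bilinear[OF _ bounded_bilinear_mult]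
lemmas smooth_on_scaleR = smooth_on_bilinear[OF _ bounded_bilinear_scaleR]
lemmas smooth_on_inner = smooth_on_bilinear[OF _ bounded_bilinear_inner]

lemma smooth_on_minus: "open S \<Longrightarrow> smooth_on S f \<Longrightarrow> smooth_on S (\<lambda>x. - f x)"
  using smooth_on_bounded_linear_compose[OF _ bounded_linear_minus[OF bounded_linear_ident]] by blast

lemma smooth_on_diff: "open S \<Longrightarrow> smooth_on S f \<Longrightarrow> smooth_on S g \<Longrightarrow> smooth_on S (\<lambda>x. f x - g x)"
  using smooth_on_add[of S f "\<lambda>x. - g x"] smooth_on_minus by fastforce

lemma smooth_on_power:
  fixes f :: "'a::euclidean_space \<Rightarrow> 'b::real_normed_algebra_1"
  shows "open S \<Longrightarrow> smooth_on S f \<Longrightarrow> smooth_on S (\<lambda>x. f x ^ n)"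
  by (induction n) (auto intro: smooth_on_const smooth_on_mult)

lemma smooth_on_prod:
  fixes f :: "'i \<Rightarrow> 'a::euclidean_space \<Rightarrow> real"
  shows "open S \<Longrightarrow> (\<And>i. i \<in> A \<Longrightarrow> smooth_on S (f i)) \<Longrightarrow> smooth_on S (\<lambda>x. \<Prod>i\<in>A. f i x)"
proof (induction A rule: infinite_finite_induct)
  case (insert a A)
  then show ?case using smooth_on_mult[of S "f a"] by simp
qed (simp_all add: smooth_on_const)

lemma smooth_on_compose:
  fixes f :: "'a::euclidean_space \<Rightarrow> 'b::euclidean_space"
  assumes "open S" "open T" "smooth_on T g" "smooth_on S f" "\<And>x. x \<in> S \<Longrightarrow> f x \<in> T"
  shows "smooth_on S (\<lambda>x. g (f x))"
  using assms by (simp add: smooth_on_def Ck_on_compose)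

lemma smooth_on_frechet_derivative:
  "smooth_on S f \<Longrightarrow> smooth_on S (\<lambda>x. frechet_derivative f (at x) v)"
  unfolding smooth_on_def using Ck_on.simps(2) by blast

lemma smooth_on_differentiable: "smooth_on S f \<Longrightarrow> x \<in> S \<Longrightarrow> f differentiable at x"
  unfolding smooth_on_def using Ck_on.simps(2) by blast

lemma smooth_on_has_derivative:
  "smooth_on S f \<Longrightarrow> x \<in> S \<Longrightarrow> (f has_derivative frechet_derivative f (at x)) (at x)"
  using smooth_on_differentiable frechet_derivative_works by blast

lemma smooth_on_continuous_on: "smooth_on S f \<Longrightarrow> continuous_on S f"
  unfolding smooth_on_def using Ck_on.simps(1) by blast

lemma smooth_on_inverse_real: "smooth_on (- {0::real}) inverse"
proof -
  have o: "open (- {0::real})" by (simp add: open_Compl)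
  have "Ck_on n (- {0::real}) inverse" for n
  proof (induction n)
    case 0
    then show ?case by (auto intro!: continuous_on_inverse continuous_on_id)
  next
    case (Suc n)
    show ?case
    proof (rule Ck_on_SucI[OF o])
      fix x :: real assume "x \<in> - {0}"
      then show "(inverse has_derivative (\<lambda>v. - (inverse x * v * inverse x))) (at x)"
        using has_derivative_inverse'[of x UNIV] by (simp add: ac_simps)
    next
      fix v :: real
      have "Ck_on n (- {0}) (\<lambda>x. (-v) * (inverse x * inverse x))"
        by (intro Ck_on_bilinear[OF o bounded_bilinear_mult] Ck_on_const Suc.IH)
      then show "Ck_on n (- {0}) (\<lambda>x. - (inverse x * v * inverse x))"
        by (simp add: ac_simps)
    qed
  qed
  then show ?thesis by (simp add: smooth_on_def)
qed

lemma smooth_on_sqrt_real: "smooth_on {0<..} sqrt"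
proof -
  have o: "open {0::real<..}" "open (- {0::real})" by (auto simp: open_Compl)
  have "Ck_on n {0<..} sqrt" for n
  proof (induction n)
    case 0
    then show ?case by (auto intro!: continuous_intros)
  next
    case (Suc n)
    show ?case
    proof (rule Ck_on_SucI[OF o(1)])
      fix x :: real assume "x \<in> {0<..}"
      then show "(sqrt has_derivative (\<lambda>v. (v * (1/2)) * inverse (sqrt x))) (at x)"
        by (auto intro!: derivative_eq_intros simp: field_simps)
    next
      fix v :: real
      have "Ck_on n {0<..} (\<lambda>x. inverse (sqrt x))"
        using smooth_on_inverse_real
        by (intro Ck_on_compose[OF o _ _ Suc.IH]) (auto simp: smooth_on_def)
      then show "Ck_on n {0<..} (\<lambda>x. (v * (1/2)) * inverse (sqrt x))"
        by (intro Ck_on_bilinear[OF o(1) bounded_bilinear_mult] Ck_on_const)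
    qed
  qed
  then show ?thesis by (simp add: smooth_on_def)
qed

lemma smooth_on_inverse:
  fixes f :: "'a::euclidean_space \<Rightarrow> real"
  shows "open S \<Longrightarrow> smooth_on S f \<Longrightarrow> (\<And>x. x \<in> S \<Longrightarrow> f x \<noteq> 0) \<Longrightarrow> smooth_on S (\<lambda>x. inverse (f x))"
  using smooth_on_compose[OF _ _ smooth_on_inverse_real, of S f] by (simp add: open_Compl)

lemma smooth_on_divide:
  fixes f :: "'a::euclidean_space \<Rightarrow> real"
  shows "open S \<Longrightarrow> smooth_on S f \<Longrightarrow> smooth_on S g \<Longrightarrow> (\<And>x. x \<in> S \<Longrightarrow> g x \<noteq> 0) \<Longrightarrow> smooth_on S (\<lambda>x. f x / g x)"
  unfolding divide_inverse by (intro smooth_on_mult smooth_on_inverse)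

lemma smooth_on_sqrt:
  "open S \<Longrightarrow> smooth_on S f \<Longrightarrow> (\<And>x. x \<in> S \<Longrightarrow> 0 < f x) \<Longrightarrow> smooth_on S (\<lambda>x. sqrt (f x))"
  using smooth_on_compose[OF _ _ smooth_on_sqrt_real, of S f] by simp

subsection \<open>Symmetry of second derivatives\<close>

text \<open>Two applications of the mean value theorem turn the second difference over a parallelogram into
  a second derivative at some point of it. The second difference is symmetric in the two
  directions, so continuity of the second derivatives forces them to be symmetric.\<close>

lemma second_difference_mean_value:
  fixes f :: "'a::euclidean_space \<Rightarrow> real"
  assumes f: "smooth_on S f" and h: "0 < h"
    and S: "\<And>s t. 0 \<le> s \<Longrightarrow> s \<le> h \<Longrightarrow> 0 \<le> t \<Longrightarrow> t \<le> h \<Longrightarrow> x + s *\<^sub>R u + t *\<^sub>R v \<in> S"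
  obtains s t where "0 < s" "s < h" "0 < t" "t < h"
    "f (x + h *\<^sub>R u + h *\<^sub>R v) - f (x + h *\<^sub>R u) - f (x + h *\<^sub>R v) + f x
      = h * (h * frechet_derivative (\<lambda>y. frechet_derivative f (at y) u) (at (x + s *\<^sub>R u + t *\<^sub>R v)) v)"
proof -
  let ?g = "\<lambda>s. f (x + s *\<^sub>R u + h *\<^sub>R v) - f (x + s *\<^sub>R u + 0 *\<^sub>R v)"
  let ?D = "\<lambda>y. frechet_derivative f (at y) u"
  have lin: "linear (frechet_derivative f (at y))" if "y \<in> S" for y
    using smooth_on_differentiable[OF f that] by (rule linear_frechet_derivative)
  have line: "((\<lambda>s. f (x + s *\<^sub>R u + t *\<^sub>R v)) has_real_derivative ?D (x + s *\<^sub>R u + t *\<^sub>R v)) (at s)"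
    if "0 \<le> s" "s \<le> h" "0 \<le> t" "t \<le> h" for s t
  proof -
    have "((\<lambda>s. x + s *\<^sub>R u + t *\<^sub>R v) has_derivative (\<lambda>r. r *\<^sub>R u)) (at s)"
      by (auto intro!: derivative_eq_intros)
    from has_derivative_compose[OF this smooth_on_has_derivative[OF f S[OF that]]]
    show ?thesis
      using lin[OF S[OF that]] by (simp add: has_field_derivative_def linear_cmul mult_commute_abs)
  qed
  have "\<exists>s>0. s < h \<and> ?g h - ?g 0 = (h - 0) * (?D (x + s *\<^sub>R u + h *\<^sub>R v) - ?D (x + s *\<^sub>R u + 0 *\<^sub>R v))"
    by (rule MVT2[OF h]) (intro DERIV_diff line; use h in auto)
  then obtain s where s: "0 < s" "s < h"
    "?g h - ?g 0 = h * (?D (x + s *\<^sub>R u + h *\<^sub>R v) - ?D (x + s *\<^sub>R u + 0 *\<^sub>R v))" by auto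
  let ?E = "\<lambda>t. frechet_derivative ?D (at (x + s *\<^sub>R u + t *\<^sub>R v)) v"
  have sD: "smooth_on S ?D" by (rule smooth_on_frechet_derivative[OF f])
  have line2: "((\<lambda>t. ?D (x + s *\<^sub>R u + t *\<^sub>R v)) has_real_derivative ?E t) (at t)"
    if "0 \<le> t" "t \<le> h" for t
  proof -
    have p: "x + s *\<^sub>R u + t *\<^sub>R v \<in> S" using S s that by auto
    have "((\<lambda>t. x + s *\<^sub>R u + t *\<^sub>R v) has_derivative (\<lambda>r. r *\<^sub>R v)) (at t)"
      by (auto intro!: derivative_eq_intros)
    from has_derivative_compose[OF this smooth_on_has_derivative[OF sD p]]
    show ?thesis
      using linear_frechet_derivative[OF smooth_on_differentiable[OF sD p]]
      by (simp add: has_field_derivative_def linear_cmul mult_commute_abs)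
  qed
  obtain t where t: "0 < t" "t < h"
    "?D (x + s *\<^sub>R u + h *\<^sub>R v) - ?D (x + s *\<^sub>R u + 0 *\<^sub>R v) = (h - 0) * ?E t"
    using MVT2[OF h line2] by blast
  show ?thesis
    by (rule that[OF s(1,2) t(1,2)]) (use s(3) t(3) in \<open>simp add: algebra_simps\<close>)
qed

lemma frechet_derivative_commute_real:
  fixes f :: "'a::euclidean_space \<Rightarrow> real"
  assumes f: "smooth_on S f" and "open S" "x \<in> S"
  shows "frechet_derivative (\<lambda>y. frechet_derivative f (at y) u) (at x) v
       = frechet_derivative (\<lambda>y. frechet_derivative f (at y) v) (at x) u" (is "?A x = ?B x")
proof (rule ccontr)
  assume ne: "?A x \<noteq> ?B x"
  define e where "e = \<bar>?A x - ?B x\<bar> / 2"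
  have e: "e > 0" using ne by (simp add: e_def)
  have "continuous (at x) ?A" "continuous (at x) ?B"
    using assms smooth_on_continuous_on[OF smooth_on_frechet_derivative[OF smooth_on_frechet_derivative[OF f]]]
    by (auto simp: continuous_on_eq_continuous_at)
  then obtain d1 d2 where d: "d1 > 0" "d2 > 0"
    "\<And>y. dist y x < d1 \<Longrightarrow> dist (?A y) (?A x) < e" "\<And>y. dist y x < d2 \<Longrightarrow> dist (?B y) (?B x) < e"
    using e unfolding continuous_at_eps_delta by metis
  obtain d3 where d3: "d3 > 0" "ball x d3 \<subseteq> S" using assms open_contains_ball by blast
  define d where "d = min d1 (min d2 d3)"
  have d0: "d > 0" using d d3 by (simp add: d_def)
  \<comment> \<open>a parallelogram with sides \<open>h u\<close> and \<open>h v\<close> stays within distance \<open>d\<close> of \<open>x\<close>; the summand 1 only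
    prevents division by zero\<close>
  define h where "h = d / (2 * (norm u + norm v + 1))"
  have nn: "norm u + norm v + 1 > 0" by (simp add: add_nonneg_pos)
  have h: "h > 0" using d0 nn by (simp add: h_def)
  have near: "dist (x + s *\<^sub>R u + t *\<^sub>R v) x < d" if "0 \<le> s" "s \<le> h" "0 \<le> t" "t \<le> h" for s t
  proof -
    have "dist (x + s *\<^sub>R u + t *\<^sub>R v) x = norm (s *\<^sub>R u + t *\<^sub>R v)" by (simp add: dist_norm)
    also have "\<dots> \<le> s * norm u + t * norm v"
      using norm_triangle_ineq[of "s *\<^sub>R u" "t *\<^sub>R v"] that by simp
    also have "\<dots> \<le> h * norm u + h * norm v"
      using that by (intro add_mono mult_right_mono) auto
    also have "\<dots> \<le> h * (norm u + norm v + 1)" using h by (simp add: algebra_simps)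
    also have "\<dots> = d / 2" using nn by (simp add: h_def field_simps)
    also have "\<dots> < d" using d0 by simp
    finally show ?thesis .
  qed
  have inS: "x + s *\<^sub>R u + t *\<^sub>R v \<in> S" "x + s *\<^sub>R v + t *\<^sub>R u \<in> S"
    if "0 \<le> s" "s \<le> h" "0 \<le> t" "t \<le> h" for s t
    using near[OF that] near[of t s] that d3 by (auto simp: d_def dist_commute subset_eq add.commute add.left_commute ac_simps)
  obtain s t where 1: "0 < s" "s < h" "0 < t" "t < h"
    "f (x + h *\<^sub>R u + h *\<^sub>R v) - f (x + h *\<^sub>R u) - f (x + h *\<^sub>R v) + f x
      = h * (h * ?A (x + s *\<^sub>R u + t *\<^sub>R v))"
    by (rule second_difference_mean_value[OF f h inS(1)])
  obtain s' t' where 2: "0 < s'" "s' < h" "0 < t'" "t' < h"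
    "f (x + h *\<^sub>R v + h *\<^sub>R u) - f (x + h *\<^sub>R v) - f (x + h *\<^sub>R u) + f x
      = h * (h * ?B (x + s' *\<^sub>R v + t' *\<^sub>R u))"
    by (rule second_difference_mean_value[OF f h inS(2)])
  have swap: "x + h *\<^sub>R v + h *\<^sub>R u = x + h *\<^sub>R u + h *\<^sub>R v" by (simp add: ac_simps)
  have "h * (h * ?A (x + s *\<^sub>R u + t *\<^sub>R v)) = h * (h * ?B (x + s' *\<^sub>R v + t' *\<^sub>R u))"
    using 1(5) 2(5)[unfolded swap] by linarith
  then have eq: "?A (x + s *\<^sub>R u + t *\<^sub>R v) = ?B (x + t' *\<^sub>R u + s' *\<^sub>R v)" using h by (simp add: ac_simps)
  have "dist (?A (x + s *\<^sub>R u + t *\<^sub>R v)) (?A x) < e" "dist (?B (x + t' *\<^sub>R u + s' *\<^sub>R v)) (?B x) < e"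
    using near[of s t] near[of t' s'] 1 2 by (auto intro!: d simp: d_def)
  then have "\<bar>?A x - ?B x\<bar> < 2 * e" using eq by (simp add: dist_real_def)
  then show False by (simp add: e_def)
qed

lemma frechet_derivative_bounded_linear:
  assumes "bounded_linear L" "f differentiable at x"
  shows "frechet_derivative (\<lambda>y. L (f y)) (at x) v = L (frechet_derivative f (at x) v)"
  using bounded_linear.has_derivative[OF assms(1) assms(2)[unfolded frechet_derivative_works]]
  by (metis frechet_derivative_at)

lemma frechet_derivative_commute:
  fixes f :: "'a::euclidean_space \<Rightarrow> 'b::euclidean_space"
  assumes f: "smooth_on S f" and "open S" "x \<in> S"
  shows "frechet_derivative (\<lambda>y. frechet_derivative f (at y) u) (at x) v
       = frechet_derivative (\<lambda>y. frechet_derivative f (at y) v) (at x) u"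
proof (rule euclidean_eqI)
  fix b :: 'b
  have L: "bounded_linear (\<lambda>z::'b. z \<bullet> b)" by (rule bounded_linear_inner_left)
  have sb: "smooth_on S (\<lambda>y. f y \<bullet> b)" by (rule smooth_on_bounded_linear_compose[OF \<open>open S\<close> L f])
  have *: "frechet_derivative (\<lambda>y. frechet_derivative f (at y) u) (at x) v \<bullet> b
     = frechet_derivative (\<lambda>y. frechet_derivative (\<lambda>z. f z \<bullet> b) (at y) u) (at x) v" for u v
  proof -
    have "frechet_derivative (\<lambda>y. frechet_derivative f (at y) u) (at x) v \<bullet> b
      = frechet_derivative (\<lambda>y. frechet_derivative f (at y) u \<bullet> b) (at x) v"
      using smooth_on_differentiable[OF smooth_on_frechet_derivative[OF f] \<open>x \<in> S\<close>]
      by (simp add: frechet_derivative_bounded_linear[OF L])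
    also have "\<dots> = frechet_derivative (\<lambda>y. frechet_derivative (\<lambda>z. f z \<bullet> b) (at y) u) (at x) v"
      by (rule arg_cong[where f = "\<lambda>D. D v"], rule frechet_derivative_transform_within_open[OF _ \<open>open S\<close> \<open>x \<in> S\<close>])
         (auto simp: frechet_derivative_bounded_linear[OF L] smooth_on_differentiable[OF f]
           intro!: smooth_on_differentiable[OF smooth_on_bounded_linear_compose[OF \<open>open S\<close> L smooth_on_frechet_derivative[OF f]] \<open>x \<in> S\<close>])
    finally show ?thesis .
  qed
  show "frechet_derivative (\<lambda>y. frechet_derivative f (at y) u) (at x) v \<bullet> b
       = frechet_derivative (\<lambda>y. frechet_derivative f (at y) v) (at x) u \<bullet> b"
    unfolding * by (rule frechet_derivative_commute_real[OF sb \<open>open S\<close> \<open>x \<in> S\<close>])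
qed

subsection \<open>Bump functions\<close>

text \<open>The derivative of a function of the form \<open>s\<^sup>-\<^sup>k exp (-1/s)\<close> is a combination of two such
  functions, so that one induction proves smoothness of all of its members.\<close>

definition flat :: "nat \<Rightarrow> real \<Rightarrow> real" where
  "flat k s = (if s > 0 then inverse s ^ k * exp (- inverse s) else 0)"

lemma flat_has_derivative: "(flat k has_real_derivative flat (k + 2) s - real k * flat (k + 1) s) (at s)"
proof -
  consider "s > 0" | "s < 0" | "s = 0" by linarith
  then show ?thesis
  proof cases
    case 1
    have "((\<lambda>s. inverse s ^ k * exp (- inverse s)) has_real_derivative flat (k + 2) s - real k * flat (k + 1) s) (at s)"
      using 1
      by (cases k) (auto intro!: derivative_eq_intros simp: flat_def field_simps power2_eq_square,
        metis One_nat_def power_eq_if)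
    then show ?thesis
      by (rule DERIV_cong_ev[THEN iffD1, rotated -1])
         (use 1 eventually_nhds_in_open[of "{0<..}" s] in \<open>auto simp: flat_def elim!: eventually_mono\<close>)
  next
    case 2
    have "((\<lambda>s. 0) has_real_derivative flat (k + 2) s - real k * flat (k + 1) s) (at s)"
      using 2 by (auto simp: flat_def)
    then show ?thesis
      by (rule DERIV_cong_ev[THEN iffD1, rotated -1])
         (use 2 eventually_nhds_in_open[of "{..<0}" s] in \<open>auto simp: flat_def elim!: eventually_mono\<close>)
  next
    case 3
    have "((\<lambda>h::real. inverse h ^ (k + 1) / exp (inverse h)) \<longlongrightarrow> 0) (at_right 0)"
      by (rule filterlim_compose[OF tendsto_power_div_exp_0 filterlim_inverse_at_top_right])
    then have "((\<lambda>h. flat k h / h) \<longlongrightarrow> 0) (at_right 0)"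
      by (rule Lim_transform_eventually)
         (auto simp: flat_def eventually_at_filter exp_minus field_simps)
    moreover have "((\<lambda>h. flat k h / h) \<longlongrightarrow> 0) (at_left 0)"
      by (rule tendsto_eventually) (auto simp: flat_def eventually_at_filter)
    ultimately have "((\<lambda>h. flat k h / h) \<longlongrightarrow> 0) (at 0)"
      by (simp add: filterlim_at_split)
    then show ?thesis using 3 by (simp add: DERIV_def flat_def)
  qed
qed

lemma smooth_on_flat: "smooth_on UNIV (flat k)"
proof -
  have "Ck_on n UNIV (flat k)" for n
  proof (induction n arbitrary: k)
    case 0
    show ?case
      by (simp add: continuous_on_eq_continuous_at DERIV_isCont[OF flat_has_derivative])
  next
    case (Suc n)
    show ?case
    proof (rule Ck_on_SucI)
      fix v :: real
      show "Ck_on n UNIV (\<lambda>s. (flat (k + 2) s + (- real k) * flat (k + 1) s) * v)"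
        by (intro Ck_on_bilinear[OF open_UNIV bounded_bilinear_mult] Ck_on_add Ck_on_const Suc.IH open_UNIV)
    qed (use flat_has_derivative in \<open>auto simp: has_field_derivative_def\<close>)
  qed
  then show ?thesis by (simp add: smooth_on_def)
qed

definition bump :: "'a::euclidean_space \<Rightarrow> real \<Rightarrow> 'a \<Rightarrow> real" where
  "bump a r x = flat 0 (r\<^sup>2 - (x - a) \<bullet> (x - a))"

lemma smooth_on_bump: "smooth_on UNIV (bump a r)"
  unfolding bump_def
  by (rule smooth_on_compose[OF open_UNIV open_UNIV smooth_on_flat])
     (intro smooth_on_diff smooth_on_inner smooth_on_const smooth_on_bounded_linear bounded_linear_ident open_UNIV UNIV_I)+

lemma bump_nonneg: "bump a r x \<ge> 0"
  by (simp add: bump_def flat_def)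

lemma bump_pos_iff: "r > 0 \<Longrightarrow> bump a r x > 0 \<longleftrightarrow> dist a x < r"
  by (simp add: bump_def flat_def dist_norm norm_minus_commute[of a] dot_square_norm)
     (metis abs_of_pos norm_ge_zero power2_less_imp_less power_strict_mono zero_less_numeral less_le)


section \<open>Linear algebra of the metric\<close>

text \<open>Differentiating the determinant replaces one row at a time by its derivative; writing that row
  as a combination of the rows of \<open>A\<close> (possible because \<open>A\<close> is invertible) leaves only the diagonal
  coefficient, by Cramer's rule.\<close>

lemma det_has_derivative:
  fixes A :: "real \<Rightarrow> real^'n^'n"
  assumes d: "\<And>i j. ((\<lambda>s. A s $ i $ j) has_real_derivative A' $ i $ j) (at s)"
    and inv: "B ** A s = mat 1"
  shows "((\<lambda>s. det (A s)) has_real_derivative det (A s) * (\<Sum>\<^sub>Ui j. B $ j $ i * A' $ i $ j)) (at s)"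
proof -
  let ?R = "\<lambda>k. (\<chi> i. if i = k then row k A' else row i (A s)) :: real^'n^'n"
  have "((\<lambda>s. det (A s)) has_real_derivative
     (\<Sum>p\<in>{p. p permutes UNIV}. of_int (sign p) *
        (\<Sum>\<^sub>Uk. A' $ k $ p k * (\<Prod>i\<in>UNIV - {k}. A s $ i $ p i)))) (at s)"
    unfolding det_def
    by (intro DERIV_sum DERIV_cmult) (rule has_field_derivative_prod, rule d)
  also have "(\<Sum>p\<in>{p. p permutes UNIV}. of_int (sign p) *
        (\<Sum>\<^sub>Uk. A' $ k $ p k * (\<Prod>i\<in>UNIV - {k}. A s $ i $ p i))) = (\<Sum>\<^sub>Uk. det (?R k))"
  proof -
    have "(\<Prod>i\<in>UNIV. ?R k $ i $ p i) = A' $ k $ p k * (\<Prod>i\<in>UNIV - {k}. A s $ i $ p i)" for k p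
      by (subst prod.remove[of UNIV k]) (auto simp: row_def intro!: prod.cong)
    then show ?thesis
      by (simp add: det_def sum_distrib_left sum.swap[of _ UNIV])
  qed
  also have "\<dots> = (\<Sum>\<^sub>Uk. (A' ** B) $ k $ k * det (A s))"
  proof (rule sum.cong[OF refl])
    fix k
    have "A' = (A' ** B) ** A s" by (simp add: matrix_mul_assoc[symmetric] inv)
    then have "row k A' = row k ((A' ** B) ** A s)" by simp
    also have "\<dots> = (\<Sum>\<^sub>Ui. ((A' ** B) $ k $ i) *s row i (A s))"
      by (simp add: vec_eq_iff row_def matrix_matrix_mult_def)
    finally have "?R k = (\<chi> i. if i = k then \<Sum>\<^sub>Ui. ((A' ** B) $ k $ i) *s row i (A s) else row i (A s))"
      by (simp add: vec_eq_iff)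
    then show "det (?R k) = (A' ** B) $ k $ k * det (A s)"
      using cramer_lemma_transpose[of k "(A' ** B) $ k" "A s"] by simp
  qed
  also have "\<dots> = det (A s) * (\<Sum>\<^sub>Ui j. B $ j $ i * A' $ i $ j)"
    by (simp add: matrix_matrix_mult_def sum_distrib_left sum_distrib_right ac_simps)
  finally show ?thesis .
qed

text \<open>The path to the identity matrix through positive definite matrices never meets
  determinant zero.\<close>

lemma det_pos_definite_pos:
  fixes A :: "real^'n^'n"
  assumes pd: "\<And>v. v \<noteq> 0 \<Longrightarrow> v \<bullet> (A *v v) > 0"
  shows "det A > 0"
proof (rule ccontr)
  assume neg: "\<not> det A > 0"
  let ?M = "\<lambda>t. t *\<^sub>R A + (1 - t) *\<^sub>R (mat 1 :: real^'n^'n)"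
  have "continuous_on {0..1} (\<lambda>t. det (?M t))"
    unfolding det_def by (intro continuous_intros)
  then obtain t where t: "0 \<le> t" "t \<le> 1" "det (?M t) = 0"
    using IVT2'[of "\<lambda>t. det (?M t)" 1 0 0] neg by force
  then have "\<not> invertible (?M t)" by (simp add: invertible_det_nz)
  then obtain v where v: "v \<noteq> 0" "?M t *v v = 0"
    unfolding invertible_left_inverse matrix_left_invertible_ker by auto
  have "v \<bullet> (?M t *v v) = t * (v \<bullet> (A *v v)) + (1 - t) * (v \<bullet> v)"
    by (simp add: matrix_vector_mult_add_rdistrib scaleR_matrix_vector_assoc[symmetric] inner_add_right)
  moreover have "\<dots> > 0"
  proof (cases "t = 0")
    case False
    then show ?thesis using t pd[OF v(1)] by (intro add_pos_nonneg) auto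
  qed (use v in simp)
  ultimately show False using v by simp
qed

lemma matrix_inv_mult_cancel:
  fixes A :: "real^'n^'n"
  assumes "det A \<noteq> 0"
  shows "A ** matrix_inv A = mat 1" "matrix_inv A ** A = mat 1"
proof -
  have "\<exists>B. A ** B = mat 1 \<and> B ** A = mat 1"
    using assms by (simp add: invertible_det_nz[symmetric] invertible_def)
  from someI_ex[OF this] show "A ** matrix_inv A = mat 1" "matrix_inv A ** A = mat 1"
    by (simp_all add: matrix_inv_def)
qed

lemma matrix_inv_entry:
  fixes A :: "real^'n^'n"
  assumes "det A \<noteq> 0"
  shows "matrix_inv A $ i $ j = det (\<chi> r c. if c = i then axis j 1 $ r else A $ r $ c) / det A"
proof -
  let ?x = "matrix_inv A *v axis j 1"
  have eq: "A *v ?x = axis j 1"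
    using assms by (simp add: matrix_vector_mul_assoc matrix_inv_mult_cancel)
  have "det (\<chi> r c. if c = i then axis j 1 $ r else A $ r $ c) = ?x $ i * det A"
    using cramer_lemma[of i A ?x] unfolding eq .
  moreover have "?x $ i = matrix_inv A $ i $ j"
    by (simp add: matrix_vector_mult_basis column_def)
  ultimately show ?thesis using assms by simp
qed

lemma smooth_on_det:
  fixes A :: "'a::euclidean_space \<Rightarrow> real^'n^'n"
  assumes "open S" "\<And>i j. smooth_on S (\<lambda>x. A x $ i $ j)"
  shows "smooth_on S (\<lambda>x. det (A x))"
  unfolding det_def by (intro smooth_on_sum smooth_on_mult smooth_on_const smooth_on_prod assms)

text \<open>Cramer's rule exhibits the entries of the inverse as quotients of determinants.\<close>

lemma smooth_on_matrix_inv: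
  fixes A :: "'a::euclidean_space \<Rightarrow> real^'n^'n"
  assumes "open S" "\<And>i j. smooth_on S (\<lambda>x. A x $ i $ j)" "\<And>x. x \<in> S \<Longrightarrow> det (A x) \<noteq> 0"
  shows "smooth_on S (\<lambda>x. matrix_inv (A x) $ i $ j)"
proof (subst smooth_on_cong[OF \<open>open S\<close> matrix_inv_entry[OF assms(3)]])
  show "smooth_on S (\<lambda>x. det (\<chi> r c. if c = i then axis j 1 $ r else A x $ r $ c) / det (A x))"
  proof (intro smooth_on_divide smooth_on_det assms)
    fix r c
    show "smooth_on S (\<lambda>x. (\<chi> r c. if c = i then axis j 1 $ r else A x $ r $ c) $ r $ c)"
      by (cases "c = i") (simp_all add: smooth_on_const assms)
  qed
qed


section \<open>Partial derivatives in the chart and along a variation\<close>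

lemma pd_eqI: "(f has_derivative D) (at x) \<Longrightarrow> pd i f x = D (axis i 1)"
  using frechet_derivative_at by (metis pd_def)

lemma frechet_derivative_eq_sum_pd:
  assumes "f differentiable at x"
  shows "frechet_derivative f (at x) v = (\<Sum>\<^sub>Ui. v $ i *\<^sub>R pd i f x)"
proof -
  let ?D = "frechet_derivative f (at x)"
  have lin: "linear ?D" using assms by (rule linear_frechet_derivative)
  have "?D v = ?D (\<Sum>\<^sub>Ui. v $ i *\<^sub>R axis i 1)"
    by (rule arg_cong[where f = ?D]) (simp add: vec_eq_iff axis_def if_distrib cong: if_cong)
  then show ?thesis
    by (simp only: linear_sum[OF lin] linear_cmul[OF lin] pd_def)
qed

locale chart_domain =
  fixes U :: "(real^4) set"
  assumes open_U [simp]: "open U"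
begin

lemma pd_cong:
  assumes "\<And>y. y \<in> U \<Longrightarrow> f y = g y" "x \<in> U"
  shows "pd i f x = pd i g x"
proof -
  have "(f has_derivative D) (at x) \<longleftrightarrow> (g has_derivative D) (at x)" for D
    using has_derivative_transform_within_open[OF _ open_U \<open>x \<in> U\<close>, of f D UNIV g]
      has_derivative_transform_within_open[OF _ open_U \<open>x \<in> U\<close>, of g D UNIV f] assms by fastforce
  then show ?thesis by (simp add: pd_def frechet_derivative_def)
qed

lemma smooth_pd [simp]: "smooth_on U f \<Longrightarrow> smooth_on U (pd i f)"
  unfolding pd_def by (rule smooth_on_frechet_derivative)

lemmas smooth_intros =
  smooth_on_const smooth_on_add[OF open_U] smooth_on_diff[OF open_U] smooth_on_minus[OF open_U]
  smooth_on_mult[OF open_U] smooth_on_scaleR[OF open_U] smooth_on_inner[OF open_U]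
  smooth_on_sum[OF open_U] smooth_on_power[OF open_U] smooth_pd

lemma pd_const [simp]: "pd i (\<lambda>y. c) x = 0"
  by (simp add: pd_def)

context
  fixes x assumes x: "x \<in> U"
begin

lemma pd_add:
  "smooth_on U f \<Longrightarrow> smooth_on U g \<Longrightarrow> pd i (\<lambda>y. f y + g y) x = pd i f x + pd i g x"
  using pd_eqI[OF has_derivative_add[OF smooth_on_has_derivative[OF _ x] smooth_on_has_derivative[OF _ x]]]
  by (simp add: pd_def)

lemma pd_diff:
  "smooth_on U f \<Longrightarrow> smooth_on U g \<Longrightarrow> pd i (\<lambda>y. f y - g y) x = pd i f x - pd i g x"
  using pd_eqI[OF has_derivative_diff[OF smooth_on_has_derivative[OF _ x] smooth_on_has_derivative[OF _ x]]]
  by (simp add: pd_def)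

lemma pd_minus: "smooth_on U f \<Longrightarrow> pd i (\<lambda>y. - f y) x = - pd i f x"
  using pd_eqI[OF has_derivative_minus[OF smooth_on_has_derivative[OF _ x]]]
  by (simp add: pd_def)

lemma pd_mult:
  fixes f g :: "real^4 \<Rightarrow> real"
  shows "smooth_on U f \<Longrightarrow> smooth_on U g \<Longrightarrow> pd i (\<lambda>y. f y * g y) x = pd i f x * g x + f x * pd i g x"
  using pd_eqI[OF has_derivative_mult[OF smooth_on_has_derivative[OF _ x] smooth_on_has_derivative[OF _ x]]]
  by (simp add: pd_def add.commute)

lemma pd_scaleR:
  "smooth_on U f \<Longrightarrow> smooth_on U g \<Longrightarrow> pd i (\<lambda>y. f y *\<^sub>R g y) x = pd i f x *\<^sub>R g x + f x *\<^sub>R pd i g x"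
  using pd_eqI[OF has_derivative_scaleR[OF smooth_on_has_derivative[OF _ x] smooth_on_has_derivative[OF _ x]]]
  by (simp add: pd_def add.commute)

lemma pd_inner:
  "smooth_on U f \<Longrightarrow> smooth_on U g \<Longrightarrow> pd i (\<lambda>y. f y \<bullet> g y) x = pd i f x \<bullet> g x + f x \<bullet> pd i g x"
  using pd_eqI[OF has_derivative_inner[OF smooth_on_has_derivative[OF _ x] smooth_on_has_derivative[OF _ x]]]
  by (simp add: pd_def add.commute)

lemma pd_sum:
  assumes "\<And>k. k \<in> A \<Longrightarrow> smooth_on U (f k)"
  shows "pd i (\<lambda>y. \<Sum>k\<in>A. f k y) x = (\<Sum>k\<in>A. pd i (f k) x)"
  using pd_eqI[OF has_derivative_sum[of A f, OF smooth_on_has_derivative[OF assms x]]]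
  by (simp add: pd_def)

lemma pd_commute:
  fixes f :: "real^4 \<Rightarrow> 'v::euclidean_space"
  shows "smooth_on U f \<Longrightarrow> pd i (pd j f) x = pd j (pd i f) x"
  unfolding pd_def[abs_def] by (rule frechet_derivative_commute[OF _ open_U x])

end

lemmas pd_simps = pd_add pd_diff pd_minus pd_mult pd_scaleR pd_inner pd_sum

end

text \<open>Taken as a directional derivative of the joint map in time and space, so that symmetry of second
  derivatives yields the commutation with \<^const>\<open>pd\<close>.\<close>

definition dt :: "(real \<Rightarrow> real^4 \<Rightarrow> 'v::real_normed_vector) \<Rightarrow> real^4 \<Rightarrow> 'v" where
  "dt f x = frechet_derivative (\<lambda>p. f (fst p) (snd p)) (at (0, x)) (1, 0)"

text \<open>Families are smooth jointly in time and space; spatial smoothness is the special case of a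
  constant family (\<open>jsmooth_slice_const\<close>, \<open>smooth_slice\<close>).\<close>

locale time_domain = chart_domain U for U +
  fixes \<epsilon> :: real
  assumes eps_pos [simp]: "\<epsilon> > 0"
begin

definition jsmooth :: "(real \<Rightarrow> real^4 \<Rightarrow> 'v::real_normed_vector) \<Rightarrow> bool" where
  "jsmooth f \<longleftrightarrow> smooth_on ({-\<epsilon><..<\<epsilon>} \<times> U) (\<lambda>p. f (fst p) (snd p))"

lemma open_cylinder [simp]: "open ({-\<epsilon><..<\<epsilon>} \<times> U)"
  by (simp add: open_Times)

lemma jsmooth_const: "jsmooth (\<lambda>t x. c)"
  by (simp add: jsmooth_def smooth_on_const)
lemma jsmooth_add: "jsmooth f \<Longrightarrow> jsmooth g \<Longrightarrow> jsmooth (\<lambda>t x. f t x + g t x)"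
  unfolding jsmooth_def by (rule smooth_on_add[OF open_cylinder])
lemma jsmooth_diff: "jsmooth f \<Longrightarrow> jsmooth g \<Longrightarrow> jsmooth (\<lambda>t x. f t x - g t x)"
  unfolding jsmooth_def by (rule smooth_on_diff[OF open_cylinder])
lemma jsmooth_minus: "jsmooth f \<Longrightarrow> jsmooth (\<lambda>t x. - f t x)"
  unfolding jsmooth_def by (rule smooth_on_minus[OF open_cylinder])
lemma jsmooth_mult: "jsmooth f \<Longrightarrow> jsmooth g \<Longrightarrow> jsmooth (\<lambda>t x. f t x * g t x :: real)"
  unfolding jsmooth_def by (rule smooth_on_mult[OF open_cylinder])
lemma jsmooth_scaleR: "jsmooth f \<Longrightarrow> jsmooth g \<Longrightarrow> jsmooth (\<lambda>t x. f t x *\<^sub>R g t x)"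
  unfolding jsmooth_def by (rule smooth_on_scaleR[OF open_cylinder])
lemma jsmooth_inner: "jsmooth f \<Longrightarrow> jsmooth g \<Longrightarrow> jsmooth (\<lambda>t x. f t x \<bullet> g t x)"
  unfolding jsmooth_def by (rule smooth_on_inner[OF open_cylinder])
lemma jsmooth_sum: "(\<And>k. k \<in> A \<Longrightarrow> jsmooth (f k)) \<Longrightarrow> jsmooth (\<lambda>t x. \<Sum>k\<in>A. f k t x)"
  unfolding jsmooth_def by (rule smooth_on_sum[OF open_cylinder])
lemma jsmooth_power: "jsmooth f \<Longrightarrow> jsmooth (\<lambda>t x. f t x ^ n :: real)"
  unfolding jsmooth_def by (rule smooth_on_power[OF open_cylinder])

lemma has_derivative_slice:
  assumes "jsmooth f" "t \<in> {-\<epsilon><..<\<epsilon>}" "x \<in> U"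
  shows "(f t has_derivative (\<lambda>v. frechet_derivative (\<lambda>p. f (fst p) (snd p)) (at (t, x)) (0, v))) (at x)"
proof -
  have 1: "((\<lambda>y. (t, y)) has_derivative (\<lambda>v. (0, v))) (at x)"
    by (auto intro!: derivative_eq_intros)
  have 2: "((\<lambda>p. f (fst p) (snd p)) has_derivative frechet_derivative (\<lambda>p. f (fst p) (snd p)) (at (t, x))) (at (t, x))"
    by (rule smooth_on_has_derivative[OF assms(1)[unfolded jsmooth_def]]) (use assms in simp)
  show ?thesis using has_derivative_compose[OF 1 2] by simp
qed

lemma pd_slice:
  "jsmooth f \<Longrightarrow> t \<in> {-\<epsilon><..<\<epsilon>} \<Longrightarrow> x \<in> U \<Longrightarrow>
    pd i (f t) x = frechet_derivative (\<lambda>p. f (fst p) (snd p)) (at (t, x)) (0, axis i 1)"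
  by (rule pd_eqI[OF has_derivative_slice])

lemma jsmooth_pd: "jsmooth f \<Longrightarrow> jsmooth (\<lambda>t. pd i (f t))"
  unfolding jsmooth_def
  by (subst smooth_on_cong[OF open_cylinder, where g = "\<lambda>p. frechet_derivative (\<lambda>p. f (fst p) (snd p)) (at p) (0, axis i 1)"])
     (auto simp: pd_slice[unfolded jsmooth_def] intro: smooth_on_frechet_derivative)

lemmas jsmooth_intros = jsmooth_const jsmooth_add jsmooth_diff jsmooth_minus jsmooth_mult
  jsmooth_scaleR jsmooth_inner jsmooth_sum jsmooth_power jsmooth_pd

lemma smooth_slice:
  assumes "jsmooth f" "t \<in> {-\<epsilon><..<\<epsilon>}"
  shows "smooth_on U (f t)"
proof -
  have "smooth_on U (\<lambda>x. (t, x))"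
  proof -
    have "smooth_on U (\<lambda>x. (t, 0) + (0, x))"
      by (intro smooth_on_add[OF open_U] smooth_on_const smooth_on_bounded_linear[OF open_U]
          bounded_linear_Pair bounded_linear_zero bounded_linear_ident)
    then show ?thesis by simp
  qed
  from smooth_on_compose[OF open_U open_cylinder assms(1)[unfolded jsmooth_def] this] assms(2)
  show ?thesis by simp
qed

lemma jsmooth_slice_const: "smooth_on U f \<Longrightarrow> jsmooth (\<lambda>t. f)"
  unfolding jsmooth_def
  by (rule smooth_on_compose[OF open_cylinder open_U])
     (auto intro!: smooth_on_bounded_linear bounded_linear_snd open_Times)

lemma zero_mem [simp]: "0 \<in> {-\<epsilon><..<\<epsilon>}"
  by simp

lemma dt_at:
  assumes f: "jsmooth f" and t: "t \<in> {-\<epsilon><..<\<epsilon>}" and x: "x \<in> U"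
  shows "((\<lambda>s. f s x) has_vector_derivative frechet_derivative (\<lambda>p. f (fst p) (snd p)) (at (t, x)) (1, 0)) (at t)"
proof -
  let ?D = "frechet_derivative (\<lambda>p. f (fst p) (snd p)) (at (t, x))"
  have D: "((\<lambda>p. f (fst p) (snd p)) has_derivative ?D) (at (t, x))"
    by (rule smooth_on_has_derivative[OF f[unfolded jsmooth_def]]) (use t x in simp)
  have "((\<lambda>s. (s, x)) has_derivative (\<lambda>s. (s, 0))) (at t)"
    by (auto intro!: derivative_eq_intros)
  from has_derivative_compose[OF this D]
  have "((\<lambda>s. f s x) has_derivative (\<lambda>s. ?D (s, 0))) (at t)" by simp
  also have "(\<lambda>s. ?D (s, 0)) = (\<lambda>s. s *\<^sub>R ?D (1, 0))"
  proof
    fix s show "?D (s, 0) = s *\<^sub>R ?D (1, 0)"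
      using linear_cmul[OF has_derivative_linear[OF D], of s "(1, 0)"] by simp
  qed
  finally show ?thesis unfolding has_vector_derivative_def .
qed

context
  fixes x assumes x: "x \<in> U"
begin

lemma jhas: "jsmooth f \<Longrightarrow> ((\<lambda>p. f (fst p) (snd p)) has_derivative
     frechet_derivative (\<lambda>p. f (fst p) (snd p)) (at (0, x))) (at (0, x))"
  unfolding jsmooth_def by (rule smooth_on_has_derivative, assumption) (simp add: x)

lemma dt_eqI: "((\<lambda>p. f (fst p) (snd p)) has_derivative D) (at (0, x)) \<Longrightarrow> dt f x = D (1, 0)"
  unfolding dt_def by (drule frechet_derivative_at) simp

lemma dt_has_vector_derivative:
  "jsmooth f \<Longrightarrow> ((\<lambda>t. f t x) has_vector_derivative dt f x) (at 0)"
  using dt_at[OF _ zero_mem x] by (simp add: dt_def)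

lemma dt_eqI_vector: "jsmooth f \<Longrightarrow> ((\<lambda>t. f t x) has_vector_derivative d) (at 0) \<Longrightarrow> dt f x = d"
  using dt_has_vector_derivative vector_derivative_unique_at by blast

lemma dt_const [simp]: "dt (\<lambda>t y. f y) x = 0" if "smooth_on U f"
  using dt_eqI_vector[OF jsmooth_slice_const[OF that] has_vector_derivative_const] by simp

lemma dt_add: "jsmooth f \<Longrightarrow> jsmooth g \<Longrightarrow> dt (\<lambda>t y. f t y + g t y) x = dt f x + dt g x"
  using dt_eqI[of "\<lambda>t y. f t y + g t y", OF has_derivative_add[OF jhas[of f] jhas[of g]]]
  by (simp add: dt_def)

lemma dt_diff: "jsmooth f \<Longrightarrow> jsmooth g \<Longrightarrow> dt (\<lambda>t y. f t y - g t y) x = dt f x - dt g x"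
  using dt_eqI[of "\<lambda>t y. f t y - g t y", OF has_derivative_diff[OF jhas[of f] jhas[of g]]]
  by (simp add: dt_def)

lemma dt_mult: "jsmooth f \<Longrightarrow> jsmooth g \<Longrightarrow> dt (\<lambda>t y. f t y * g t y :: real) x = dt f x * g 0 x + f 0 x * dt g x"
  using dt_eqI[of "\<lambda>t y. f t y * g t y", OF has_derivative_mult[OF jhas[of f] jhas[of g]]]
  by (simp add: dt_def add.commute)

lemma dt_scaleR: "jsmooth f \<Longrightarrow> jsmooth g \<Longrightarrow> dt (\<lambda>t y. f t y *\<^sub>R g t y) x = dt f x *\<^sub>R g 0 x + f 0 x *\<^sub>R dt g x"
  using dt_eqI[of "\<lambda>t y. f t y *\<^sub>R g t y", OF has_derivative_scaleR[OF jhas[of f] jhas[of g]]]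
  by (simp add: dt_def add.commute)

lemma dt_inner: "jsmooth f \<Longrightarrow> jsmooth g \<Longrightarrow> dt (\<lambda>t y. f t y \<bullet> g t y) x = dt f x \<bullet> g 0 x + f 0 x \<bullet> dt g x"
  using dt_eqI[of "\<lambda>t y. f t y \<bullet> g t y", OF has_derivative_inner[OF jhas[of f] jhas[of g]]]
  by (simp add: dt_def add.commute)

lemma dt_sum:
  assumes "\<And>k. k \<in> A \<Longrightarrow> jsmooth (f k)"
  shows "dt (\<lambda>t y. \<Sum>k\<in>A. f k t y) x = (\<Sum>k\<in>A. dt (f k) x)"
  using dt_eqI[of "\<lambda>t y. \<Sum>k\<in>A. f k t y", OF has_derivative_sum[of A "\<lambda>k p. f k (fst p) (snd p)", OF jhas[OF assms]]]
  by (simp add: dt_def)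

lemma dt_cong:
  assumes f: "\<And>t y. t \<in> {-\<epsilon><..<\<epsilon>} \<Longrightarrow> y \<in> U \<Longrightarrow> f t y = g t y"
  shows "dt f x = dt g x"
proof -
  have m: "(0, x) \<in> {-\<epsilon><..<\<epsilon>} \<times> U" using x by simp
  have "((\<lambda>p. f (fst p) (snd p)) has_derivative D) (at (0, x)) \<longleftrightarrow> ((\<lambda>p. g (fst p) (snd p)) has_derivative D) (at (0, x))" for D
    using has_derivative_transform_within_open[OF _ open_cylinder m, of "\<lambda>p. f (fst p) (snd p)" D UNIV "\<lambda>p. g (fst p) (snd p)"]
      has_derivative_transform_within_open[OF _ open_cylinder m, of "\<lambda>p. g (fst p) (snd p)" D UNIV "\<lambda>p. f (fst p) (snd p)"] f
    by auto
  then show ?thesis by (simp add: dt_def frechet_derivative_def)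
qed

end

lemma smooth_dt:
  assumes "jsmooth f"
  shows "smooth_on U (dt f)"
proof -
  have "jsmooth (\<lambda>t x. frechet_derivative (\<lambda>p. f (fst p) (snd p)) (at (t, x)) (1, 0))"
    using smooth_on_frechet_derivative[OF assms[unfolded jsmooth_def]] by (simp add: jsmooth_def)
  from smooth_slice[OF this zero_mem] show ?thesis by (simp add: dt_def[abs_def])
qed

lemma dt_pd:
  fixes f :: "real \<Rightarrow> real^4 \<Rightarrow> 'v::euclidean_space"
  assumes f: "jsmooth f" and x: "x \<in> U"
  shows "dt (\<lambda>t. pd i (f t)) x = pd i (dt f) x"
proof -
  let ?f = "\<lambda>p. f (fst p) (snd p)"
  let ?g = "\<lambda>t y. frechet_derivative ?f (at (t, y)) (1, 0)"
  have g: "jsmooth ?g"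
    using smooth_on_frechet_derivative[OF f[unfolded jsmooth_def]] by (simp add: jsmooth_def)
  have "dt (\<lambda>t. pd i (f t)) x = dt (\<lambda>t y. frechet_derivative ?f (at (t, y)) (0, axis i 1)) x"
    by (rule dt_cong[OF x]) (rule pd_slice[OF f])
  also have "\<dots> = frechet_derivative (\<lambda>p. frechet_derivative ?f (at p) (0, axis i 1)) (at (0, x)) (1, 0)"
    by (simp add: dt_def)
  also have "\<dots> = frechet_derivative (\<lambda>p. frechet_derivative ?f (at p) (1, 0)) (at (0, x)) (0, axis i 1)"
    using x by (intro frechet_derivative_commute[OF f[unfolded jsmooth_def] open_cylinder]) simp
  also have "\<dots> = pd i (?g 0) x"
    by (subst pd_slice[OF g zero_mem x]) simp
  finally show ?thesis by (simp add: dt_def[abs_def])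
qed

lemmas dt_simps = dt_add dt_diff dt_mult dt_scaleR dt_inner dt_sum dt_pd

end


section \<open>Tangent and normal directions of an immersed patch\<close>

text \<open>The tangent frame dual to the coordinate frame: \<open>dual_frame F k \<bullet> pd j F\<close> is the Kronecker
  symbol. It hides the inverse metric in projections and Christoffel symbols.\<close>

definition dual_frame :: "(real^4 \<Rightarrow> real^'m) \<Rightarrow> 4 \<Rightarrow> real^4 \<Rightarrow> real^'m" where
  "dual_frame F k x = (\<Sum>\<^sub>Ul. gu F k l x *\<^sub>R pd l F x)"

definition normal_at :: "(real^4 \<Rightarrow> real^'m) \<Rightarrow> real^4 \<Rightarrow> real^'m \<Rightarrow> bool" where
  "normal_at F x v \<longleftrightarrow> (\<forall>k. v \<bullet> pd k F x = 0)"

lemma gl_eq: "gl F i j x = pd i F x \<bullet> pd j F x"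
  by (simp add: gl_def metric_def)

lemma gl_commute: "gl F i j x = gl F j i x"
  by (simp add: gl_eq inner_commute)

locale patch = chart_domain U for U +
  fixes F :: "real^4 \<Rightarrow> real^'m"
  assumes smooth_F: "smooth_on U F"
    and inj_F: "x \<in> U \<Longrightarrow> inj (frechet_derivative F (at x))"
begin

lemma metric_positive_definite:
  assumes "x \<in> U" "v \<noteq> 0"
  shows "v \<bullet> (metric F x *v v) > 0"
proof -
  let ?D = "frechet_derivative F (at x)"
  have lin: "linear ?D"
    using smooth_on_differentiable[OF smooth_F \<open>x \<in> U\<close>] by (rule linear_frechet_derivative)
  have Dv: "?D v = (\<Sum>\<^sub>Ui. v $ i *\<^sub>R pd i F x)"
    by (rule frechet_derivative_eq_sum_pd[OF smooth_on_differentiable[OF smooth_F \<open>x \<in> U\<close>]])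
  have "?D v \<noteq> 0"
    using linear_injective_0[OF lin] inj_F[OF \<open>x \<in> U\<close>] \<open>v \<noteq> 0\<close> by blast
  then have "0 < ?D v \<bullet> ?D v" by simp
  also have "?D v \<bullet> ?D v = v \<bullet> (metric F x *v v)"
  proof -
    have "v \<bullet> (metric F x *v v) = (\<Sum>\<^sub>Ui j. v $ i * (v $ j * (pd i F x \<bullet> pd j F x)))"
      unfolding inner_vec_def[of v] by (simp add: matrix_vector_mult_def metric_def sum_distrib_left ac_simps)
    also have "\<dots> = ?D v \<bullet> ?D v"
      unfolding Dv by (simp add: inner_sum_left inner_sum_right sum_distrib_left)
        (subst sum.swap, simp add: ac_simps)
    finally show ?thesis ..
  qed
  finally show ?thesis .
qed

lemma det_metric_pos: "x \<in> U \<Longrightarrow> det (metric F x) > 0"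
  by (rule det_pos_definite_pos) (rule metric_positive_definite)

lemma vol_density_pos: "x \<in> U \<Longrightarrow> vol_density F x > 0"
  by (simp add: vol_density_def det_metric_pos)

context
  fixes x assumes x: "x \<in> U"
begin

lemma gu_gl: "(\<Sum>\<^sub>Uk. gu F i k x * gl F k j x) = (if i = j then 1 else 0)"
proof -
  have "(matrix_inv (metric F x) ** metric F x) $ i $ j = mat 1 $ i $ j"
    using matrix_inv_mult_cancel(2)[of "metric F x"] det_metric_pos[OF x] by simp
  then show ?thesis by (simp add: matrix_matrix_mult_def mat_def gu_def gl_def)
qed

lemma gu_commute: "gu F i j x = gu F j i x"
proof -
  let ?A = "metric F x" and ?B = "matrix_inv (metric F x)"
  have inv: "?A ** ?B = mat 1" "?B ** ?A = mat 1"
    using matrix_inv_mult_cancel[of ?A] det_metric_pos[OF x] by auto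
  have sym: "transpose ?A = ?A" by (simp add: vec_eq_iff transpose_def metric_def inner_commute)
  have "transpose ?B ** ?A = transpose (transpose ?A ** ?B)"
    by (simp add: matrix_transpose_mul)
  also have "\<dots> = mat 1" by (simp add: sym inv transpose_mat)
  finally have "transpose ?B ** ?A ** ?B = ?B" by simp
  then have "transpose ?B = ?B" by (simp add: matrix_mul_assoc[symmetric] inv)
  then have "transpose ?B $ j $ i = ?B $ j $ i" by simp
  then show ?thesis by (simp add: gu_def transpose_def)
qed

lemma dual_frame_pd: "dual_frame F k x \<bullet> pd j F x = (if k = j then 1 else 0)"
  using gu_gl[of k j] by (simp add: dual_frame_def inner_sum_left gl_eq)

lemma pd_dual_frame: "pd j F x \<bullet> dual_frame F k x = (if k = j then 1 else 0)"
  by (subst inner_commute) (rule dual_frame_pd)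

lemma nproj_eq: "nproj F x v = v - (\<Sum>\<^sub>Uk. (v \<bullet> dual_frame F k x) *\<^sub>R pd k F x)"
proof -
  have "(\<Sum>\<^sub>Ui j. (gu F i j x * (v \<bullet> pd i F x)) *\<^sub>R pd j F x)
      = (\<Sum>\<^sub>Uj i. (gu F j i x * (v \<bullet> pd i F x)) *\<^sub>R pd j F x)"
    by (subst sum.swap) (simp add: gu_commute)
  then show ?thesis
    by (simp add: nproj_def dual_frame_def inner_sum_right scaleR_sum_left)
qed

lemma nproj_eq': "nproj F x v = v - (\<Sum>\<^sub>Uk. (v \<bullet> pd k F x) *\<^sub>R dual_frame F k x)"
proof -
  have "(\<Sum>\<^sub>Ui j. (gu F i j x * (v \<bullet> pd i F x)) *\<^sub>R pd j F x)
     = (\<Sum>\<^sub>Ui. (v \<bullet> pd i F x) *\<^sub>R dual_frame F i x)"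
    by (simp add: dual_frame_def scaleR_sum_right ac_simps)
  then show ?thesis by (simp add: nproj_def)
qed

lemma nproj_orth: "nproj F x v \<bullet> pd j F x = 0"
  by (simp add: nproj_eq' inner_diff_left inner_sum_left dual_frame_pd if_distrib cong: if_cong)

lemma nproj_pd [simp]: "nproj F x (pd j F x) = 0"
  by (simp add: nproj_eq pd_dual_frame if_distrib if_distribR cong: if_cong)

end

lemma nproj_normal_at: "x \<in> U \<Longrightarrow> normal_at F x (nproj F x v)"
  by (simp add: normal_at_def nproj_orth)

lemma nproj_id: "normal_at F x v \<Longrightarrow> nproj F x v = v"
  by (simp add: normal_at_def nproj_def)

lemma nproj_zero [simp]: "nproj F x 0 = 0"
  by (simp add: nproj_def)

lemma nproj_add: "nproj F x (u + v) = nproj F x u + nproj F x v"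
  by (simp add: nproj_def inner_add_left algebra_simps sum.distrib)

lemma nproj_scaleR: "nproj F x (c *\<^sub>R v) = c *\<^sub>R nproj F x v"
  by (simp add: nproj_def scaleR_sum_right algebra_simps)

lemma linear_nproj: "linear (nproj F x)"
  by (rule linearI) (simp_all add: nproj_add nproj_scaleR)

lemma nproj_minus: "nproj F x (- v) = - nproj F x v"
  by (rule linear_neg[OF linear_nproj])

lemma nproj_diff: "nproj F x (u - v) = nproj F x u - nproj F x v"
  by (rule linear_diff[OF linear_nproj])

lemma nproj_sum: "nproj F x (\<Sum>i\<in>A. f i) = (\<Sum>i\<in>A. nproj F x (f i))"
  by (rule linear_sum[OF linear_nproj])

lemmas nproj_linear = nproj_add nproj_diff nproj_scaleR nproj_minus nproj_sum

lemma nproj_inner_normal: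
  assumes "normal_at F x n"
  shows "nproj F x v \<bullet> n = v \<bullet> n" "n \<bullet> nproj F x v = n \<bullet> v"
proof -
  have "pd j F x \<bullet> n = 0" for j
    using assms by (simp add: normal_at_def inner_commute)
  then show "nproj F x v \<bullet> n = v \<bullet> n"
    by (simp add: nproj_def inner_diff_left inner_sum_left)
  then show "n \<bullet> nproj F x v = n \<bullet> v" by (simp add: inner_commute)
qed

lemma normal_at_pd: "normal_at F x n \<Longrightarrow> n \<bullet> pd k F x = 0" "normal_at F x n \<Longrightarrow> pd k F x \<bullet> n = 0"
  by (simp_all add: normal_at_def inner_commute)

lemma normal_at_add: "normal_at F x u \<Longrightarrow> normal_at F x v \<Longrightarrow> normal_at F x (u + v)"
  and normal_at_diff: "normal_at F x u \<Longrightarrow> normal_at F x v \<Longrightarrow> normal_at F x (u - v)"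
  and normal_at_scaleR: "normal_at F x u \<Longrightarrow> normal_at F x (c *\<^sub>R u)"
  by (simp_all add: normal_at_def inner_add_left inner_diff_left)

lemma normal_at_sum: "(\<And>i. i \<in> A \<Longrightarrow> normal_at F x (f i)) \<Longrightarrow> normal_at F x (\<Sum>i\<in>A. f i)"
  by (simp add: normal_at_def inner_sum_left)

lemmas normal_at_intros = normal_at_add normal_at_diff normal_at_scaleR normal_at_sum

lemma nproj_dual_frame [simp]: "x \<in> U \<Longrightarrow> nproj F x (dual_frame F k x) = 0"
  by (simp add: dual_frame_def nproj_sum nproj_scaleR)

end

section \<open>Smoothness of the geometric quantities\<close>

text \<open>Every geometric quantity is built from \<open>\<Phi>\<close> by partial derivatives, algebra, the inverse metric
  and the square root of its determinant, so joint smoothness is inherited. The static case is read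
  off from the constant family afterwards.\<close>

locale immersion_family = time_domain U \<epsilon> for U \<epsilon> +
  fixes \<Phi> :: "real \<Rightarrow> real^4 \<Rightarrow> real^'m"
  assumes jsmooth_\<Phi>: "jsmooth \<Phi>"
    and inj_\<Phi>: "t \<in> {-\<epsilon><..<\<epsilon>} \<Longrightarrow> x \<in> U \<Longrightarrow> inj (frechet_derivative (\<Phi> t) (at x))"
begin

lemma patch_at: "t \<in> {-\<epsilon><..<\<epsilon>} \<Longrightarrow> patch U (\<Phi> t)"
  by unfold_locales (auto intro: smooth_slice[OF jsmooth_\<Phi>] inj_\<Phi>)

lemma patch_at_zero: "patch U (\<Phi> 0)"
  by (rule patch_at[OF zero_mem])

lemma jsmooth_gl: "jsmooth (\<lambda>t. gl (\<Phi> t) i j)"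
  unfolding gl_eq[abs_def] by (intro jsmooth_intros jsmooth_\<Phi>)

lemma smooth_metric: "smooth_on ({-\<epsilon><..<\<epsilon>} \<times> U) (\<lambda>p. metric (\<Phi> (fst p)) (snd p) $ i $ j)"
  using jsmooth_gl[of i j] by (simp add: jsmooth_def gl_def)

lemma det_metric_family_pos:
  "p \<in> {-\<epsilon><..<\<epsilon>} \<times> U \<Longrightarrow> det (metric (\<Phi> (fst p)) (snd p)) > 0"
  using patch.det_metric_pos[OF patch_at] by auto

lemma jsmooth_gu: "jsmooth (\<lambda>t. gu (\<Phi> t) i j)"
  unfolding jsmooth_def gu_def
  by (rule smooth_on_matrix_inv[OF open_cylinder smooth_metric]) (use det_metric_family_pos in force)

lemma jsmooth_vol_density: "jsmooth (\<lambda>t. vol_density (\<Phi> t))"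
  unfolding jsmooth_def vol_density_def
  by (intro smooth_on_sqrt smooth_on_det smooth_metric open_cylinder det_metric_family_pos)

lemma jsmooth_inverse_vol_density: "jsmooth (\<lambda>t x. inverse (vol_density (\<Phi> t) x))"
  unfolding jsmooth_def
  by (intro smooth_on_inverse jsmooth_vol_density[unfolded jsmooth_def] open_cylinder)
     (use patch.vol_density_pos[OF patch_at] in force)

lemma jsmooth_christoffel: "jsmooth (\<lambda>t. christoffel (\<Phi> t) k i j)"
  unfolding christoffel_def[abs_def] by (intro jsmooth_intros jsmooth_gl jsmooth_gu)

lemma jsmooth_nproj: "jsmooth X \<Longrightarrow> jsmooth (\<lambda>t x. nproj (\<Phi> t) x (X t x))"
  unfolding nproj_def by (intro jsmooth_intros jsmooth_gu jsmooth_\<Phi>)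

lemma jsmooth_raise1:
  "(\<And>i. jsmooth (\<lambda>t. \<omega> t i)) \<Longrightarrow> jsmooth (\<lambda>t. raise1 (\<Phi> t) (\<omega> t) i)"
  unfolding raise1_def[abs_def] by (intro jsmooth_intros jsmooth_gu)

lemma jsmooth_nabla_covec:
  "(\<And>i. jsmooth (\<lambda>t. \<omega> t i)) \<Longrightarrow> jsmooth (\<lambda>t. nabla_covec (\<Phi> t) (\<omega> t) i j)"
  unfolding nabla_covec_def[abs_def] by (intro jsmooth_intros jsmooth_christoffel)

lemma jsmooth_nabla_vec:
  "(\<And>i. jsmooth (\<lambda>t. Y t i)) \<Longrightarrow> jsmooth (\<lambda>t. nabla_vec (\<Phi> t) (Y t) i j)"
  unfolding nabla_vec_def[abs_def] by (intro jsmooth_intros jsmooth_christoffel)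

lemma jsmooth_nabla_ten:
  "(\<And>i j. jsmooth (\<lambda>t. T t i j)) \<Longrightarrow> jsmooth (\<lambda>t. nabla_ten (\<Phi> t) (T t) k i j)"
  unfolding nabla_ten_def[abs_def] by (intro jsmooth_intros jsmooth_christoffel)

lemma jsmooth_div_vec: "(\<And>i. jsmooth (\<lambda>t. Y t i)) \<Longrightarrow> jsmooth (\<lambda>t. div_vec (\<Phi> t) (Y t))"
  unfolding div_vec_def[abs_def] by (intro jsmooth_intros jsmooth_nabla_vec)

lemma jsmooth_div_ten: "(\<And>i j. jsmooth (\<lambda>t. T t i j)) \<Longrightarrow> jsmooth (\<lambda>t. div_ten (\<Phi> t) (T t) i)"
  unfolding div_ten_def[abs_def] by (intro jsmooth_intros jsmooth_nabla_ten)

lemma jsmooth_hl: "jsmooth (\<lambda>t. hl (\<Phi> t) i j)"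
  unfolding hl_def by (intro jsmooth_nabla_covec jsmooth_intros jsmooth_\<Phi>)

lemma jsmooth_hm: "jsmooth (\<lambda>t. hm (\<Phi> t) i j)"
  unfolding hm_def by (intro jsmooth_raise1 jsmooth_hl)

lemma jsmooth_hu: "jsmooth (\<lambda>t. hu (\<Phi> t) i j)"
  unfolding hu_def by (intro jsmooth_raise1 jsmooth_hm)

lemma jsmooth_H: "jsmooth (\<lambda>t. H (\<Phi> t))"
  unfolding H_def[abs_def] by (intro jsmooth_intros jsmooth_gu jsmooth_hl)

lemma jsmooth_pnabla: "jsmooth X \<Longrightarrow> jsmooth (\<lambda>t. pnabla (\<Phi> t) (X t) i)"
  unfolding pnabla_def[abs_def] by (intro jsmooth_nproj jsmooth_intros)

lemma jsmooth_nabla_up: "jsmooth X \<Longrightarrow> jsmooth (\<lambda>t. nabla_up (\<Phi> t) (X t) i)"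
  unfolding nabla_up_def[abs_def] by (intro jsmooth_raise1 jsmooth_intros)

lemma jsmooth_pnabla_up: "jsmooth X \<Longrightarrow> jsmooth (\<lambda>t. pnabla_up (\<Phi> t) (X t) i)"
  unfolding pnabla_up_def[abs_def] by (intro jsmooth_nproj jsmooth_nabla_up)

lemma jsmooth_normal_laplacian: "jsmooth X \<Longrightarrow> jsmooth (\<lambda>t. normal_laplacian (\<Phi> t) (X t))"
  unfolding normal_laplacian_def[abs_def]
  by (intro jsmooth_nproj jsmooth_intros jsmooth_gu jsmooth_nabla_covec jsmooth_pnabla)

lemma jsmooth_dual_frame: "jsmooth (\<lambda>t. dual_frame (\<Phi> t) k)"
  unfolding dual_frame_def[abs_def] by (intro jsmooth_intros jsmooth_gu jsmooth_\<Phi>)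

lemmas jsmooth_geometry =
  jsmooth_gl jsmooth_gu jsmooth_vol_density jsmooth_inverse_vol_density jsmooth_christoffel
  jsmooth_nproj jsmooth_div_vec jsmooth_div_ten jsmooth_hl jsmooth_hm jsmooth_hu jsmooth_H
  jsmooth_pnabla jsmooth_nabla_up jsmooth_pnabla_up jsmooth_normal_laplacian jsmooth_dual_frame
  jsmooth_nabla_covec jsmooth_\<Phi>

lemma jsmooth_energy_density: "jsmooth (\<lambda>t. energy_density (\<Phi> t))"
  unfolding energy_density_def[abs_def] pnablaH_sq_def Hh_sq_def
  by (intro jsmooth_intros jsmooth_geometry)

lemma jsmooth_W: "jsmooth (\<lambda>t. W (\<Phi> t))"
  unfolding W_def[abs_def] pnablaH_sq_def Hh_sq_def
  by (intro jsmooth_intros jsmooth_geometry)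

end

sublocale patch \<subseteq> fixed: immersion_family U 1 "\<lambda>t. F"
proof -
  interpret time_domain U 1 by unfold_locales simp
  show "immersion_family U 1 (\<lambda>t. F)"
    by unfold_locales (auto intro: jsmooth_slice_const smooth_F inj_F)
qed

context patch
begin

lemmas smooth_at_zero = fixed.smooth_slice[OF _ fixed.zero_mem]

lemma smooth_gl: "smooth_on U (gl F i j)"
  by (rule smooth_at_zero[OF fixed.jsmooth_gl])
lemma smooth_gu: "smooth_on U (gu F i j)"
  by (rule smooth_at_zero[OF fixed.jsmooth_gu])
lemma smooth_vol_density: "smooth_on U (vol_density F)"
  by (rule smooth_at_zero[OF fixed.jsmooth_vol_density])
lemma smooth_inverse_vol_density: "smooth_on U (\<lambda>x. inverse (vol_density F x))"
  by (rule smooth_at_zero[OF fixed.jsmooth_inverse_vol_density])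
lemma smooth_christoffel: "smooth_on U (christoffel F k i j)"
  by (rule smooth_at_zero[OF fixed.jsmooth_christoffel])
lemma smooth_nproj: "smooth_on U X \<Longrightarrow> smooth_on U (\<lambda>x. nproj F x (X x))"
  by (rule smooth_at_zero[OF fixed.jsmooth_nproj[OF fixed.jsmooth_slice_const]])
lemma smooth_nabla_covec: "(\<And>i. smooth_on U (\<omega> i)) \<Longrightarrow> smooth_on U (nabla_covec F \<omega> i j)"
  by (rule smooth_at_zero[OF fixed.jsmooth_nabla_covec[OF fixed.jsmooth_slice_const]])
lemma smooth_div_vec: "(\<And>i. smooth_on U (Y i)) \<Longrightarrow> smooth_on U (div_vec F Y)"
  by (rule smooth_at_zero[OF fixed.jsmooth_div_vec[OF fixed.jsmooth_slice_const]])
lemma smooth_div_ten: "(\<And>i j. smooth_on U (T i j)) \<Longrightarrow> smooth_on U (div_ten F T i)"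
  by (rule smooth_at_zero[OF fixed.jsmooth_div_ten[OF fixed.jsmooth_slice_const]])
lemma smooth_hl: "smooth_on U (hl F i j)"
  by (rule smooth_at_zero[OF fixed.jsmooth_hl])
lemma smooth_hm: "smooth_on U (hm F i j)"
  by (rule smooth_at_zero[OF fixed.jsmooth_hm])
lemma smooth_hu: "smooth_on U (hu F i j)"
  by (rule smooth_at_zero[OF fixed.jsmooth_hu])
lemma smooth_H: "smooth_on U (H F)"
  by (rule smooth_at_zero[OF fixed.jsmooth_H])
lemma smooth_pnabla: "smooth_on U X \<Longrightarrow> smooth_on U (pnabla F X i)"
  by (rule smooth_at_zero[OF fixed.jsmooth_pnabla[OF fixed.jsmooth_slice_const]])
lemma smooth_nabla_up: "smooth_on U X \<Longrightarrow> smooth_on U (nabla_up F X i)"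
  by (rule smooth_at_zero[OF fixed.jsmooth_nabla_up[OF fixed.jsmooth_slice_const]])
lemma smooth_pnabla_up: "smooth_on U X \<Longrightarrow> smooth_on U (pnabla_up F X i)"
  by (rule smooth_at_zero[OF fixed.jsmooth_pnabla_up[OF fixed.jsmooth_slice_const]])
lemma smooth_normal_laplacian: "smooth_on U X \<Longrightarrow> smooth_on U (normal_laplacian F X)"
  by (rule smooth_at_zero[OF fixed.jsmooth_normal_laplacian[OF fixed.jsmooth_slice_const]])
lemma smooth_dual_frame: "smooth_on U (dual_frame F k)"
  by (rule smooth_at_zero[OF fixed.jsmooth_dual_frame])
lemma smooth_energy_density: "smooth_on U (energy_density F)"
  by (rule smooth_at_zero[OF fixed.jsmooth_energy_density])
lemma smooth_W: "smooth_on U (W F)"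
  by (rule smooth_at_zero[OF fixed.jsmooth_W])

lemmas smooth_geometry =
  smooth_F smooth_gl smooth_gu smooth_vol_density smooth_inverse_vol_density smooth_christoffel
  smooth_nproj smooth_nabla_covec smooth_div_vec smooth_div_ten smooth_hl smooth_hm smooth_hu
  smooth_H smooth_pnabla smooth_nabla_up smooth_pnabla_up smooth_normal_laplacian smooth_dual_frame
  smooth_energy_density

end


section \<open>The second fundamental form and derivatives of normal fields\<close>

context patch
begin

lemma pd_gl: "x \<in> U \<Longrightarrow> pd k (gl F i j) x = pd k (pd i F) x \<bullet> pd j F x + pd i F x \<bullet> pd k (pd j F) x"
  unfolding gl_eq[abs_def] by (simp add: pd_inner smooth_F)

text \<open>Because the metric is induced, its three derivatives are six products, all but two of which
  cancel by symmetry of second derivatives.\<close>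

lemma christoffel_eq:
  assumes x: "x \<in> U"
  shows "christoffel F k i j x = dual_frame F k x \<bullet> pd i (pd j F) x"
proof -
  have "pd i (gl F j l) x + pd j (gl F i l) x - pd l (gl F i j) x = 2 * (pd l F x \<bullet> pd i (pd j F) x)" for l
    using pd_commute[OF x smooth_F, of j i] pd_commute[OF x smooth_F, of l i] pd_commute[OF x smooth_F, of l j]
    by (simp add: pd_gl[OF x] inner_commute)
  then show ?thesis
    by (simp add: christoffel_def dual_frame_def inner_sum_left sum_distrib_left)
qed

lemma christoffel_commute: "x \<in> U \<Longrightarrow> christoffel F k i j x = christoffel F k j i x"
  by (simp add: christoffel_eq pd_commute[OF _ smooth_F])

text \<open>The Christoffel term removes exactly the tangential part of the second derivative.\<close>

lemma hl_eq: "x \<in> U \<Longrightarrow> hl F i j x = nproj F x (pd i (pd j F) x)"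
  by (simp add: hl_def nabla_covec_def christoffel_eq nproj_eq inner_commute)

lemma hl_commute: "x \<in> U \<Longrightarrow> hl F i j x = hl F j i x"
  by (simp add: hl_eq pd_commute[OF _ smooth_F])

lemma hm_eq: "hm F k i x = (\<Sum>\<^sub>Ul. gu F k l x *\<^sub>R hl F l i x)"
  by (simp add: hm_def raise1_def)

lemma hu_eq: "hu F i j x = (\<Sum>\<^sub>Uk l. (gu F i k x * gu F j l x) *\<^sub>R hl F k l x)"
  by (simp add: hu_def raise1_def hm_eq scaleR_sum_right ac_simps) (rule sum.swap)

lemma hu_eq_hm: "hu F i j x = (\<Sum>\<^sub>Ul. gu F j l x *\<^sub>R hm F i l x)"
  by (simp add: hu_def raise1_def)

lemma hu_commute: "x \<in> U \<Longrightarrow> hu F i j x = hu F j i x"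
  unfolding hu_eq by (subst sum.swap) (simp add: hl_commute[of x] ac_simps)

lemma normal_hl: "x \<in> U \<Longrightarrow> normal_at F x (hl F i j x)"
  by (simp add: hl_eq nproj_normal_at)

lemma normal_hm: "x \<in> U \<Longrightarrow> normal_at F x (hm F i j x)"
  unfolding hm_eq by (intro normal_at_intros normal_hl)

lemma normal_hu: "x \<in> U \<Longrightarrow> normal_at F x (hu F i j x)"
  unfolding hu_eq by (intro normal_at_intros normal_hl)

lemma normal_H: "x \<in> U \<Longrightarrow> normal_at F x (H F x)"
  unfolding H_def by (intro normal_at_intros normal_hl)

lemma normal_pnabla: "x \<in> U \<Longrightarrow> normal_at F x (pnabla F X i x)"
  by (simp add: pnabla_def nproj_normal_at)

lemma normal_normal_laplacian: "x \<in> U \<Longrightarrow> normal_at F x (normal_laplacian F X x)"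
  unfolding normal_laplacian_def by (intro normal_at_intros nproj_normal_at)

lemma pd_normal_inner_pd:
  assumes x: "x \<in> U" and X: "smooth_on U X" "\<And>y. y \<in> U \<Longrightarrow> normal_at F y (X y)"
  shows "pd i X x \<bullet> pd j F x = - (X x \<bullet> hl F i j x)"
proof -
  have "pd i (\<lambda>y. X y \<bullet> pd j F y) x = pd i (\<lambda>y. 0) x"
    by (rule pd_cong[OF _ x]) (simp add: normal_at_pd X)
  then have "pd i X x \<bullet> pd j F x + X x \<bullet> pd i (pd j F) x = 0"
    by (simp add: pd_inner x X smooth_F)
  moreover have "X x \<bullet> hl F i j x = X x \<bullet> pd i (pd j F) x"
    by (simp add: hl_eq x nproj_inner_normal X)
  ultimately show ?thesis by simp
qed

text \<open>Weingarten's formula: the tangential part of the derivative is algebraic in the field, because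
  differentiating \<open>X \<bullet> pd j F = 0\<close> shifts the derivative to \<open>pd j F\<close>.\<close>

lemma pd_normal_field:
  assumes x: "x \<in> U" and X: "smooth_on U X" "\<And>y. y \<in> U \<Longrightarrow> normal_at F y (X y)"
  shows "pd i X x = pnabla F X i x - (\<Sum>\<^sub>Uk. (X x \<bullet> hm F k i x) *\<^sub>R pd k F x)"
proof -
  have "pd i X x \<bullet> dual_frame F k x = - (X x \<bullet> hm F k i x)" for k
    by (simp add: dual_frame_def inner_sum_right pd_normal_inner_pd[OF x X] hm_eq hl_commute[OF x, of i] sum_negf)
  then show ?thesis by (simp add: pnabla_def nproj_eq[OF x] sum_negf)
qed

lemma nproj_pd_dual_frame:
  assumes x: "x \<in> U"
  shows "nproj F x (pd i (dual_frame F k) x) = hm F k i x"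
  unfolding dual_frame_def[abs_def]
  by (simp add: pd_simps x smooth_geometry smooth_intros nproj_linear sum.distrib hm_eq hl_eq
      pd_commute[OF x smooth_F, of i])

end

section \<open>First variation of the geometric quantities\<close>

text \<open>
  Derivatives of the geometric quantities along a variation with velocity \<open>w\<close>. For the vector-valued
  ones, \<open>var_H\<close> and \<open>var_pnablaH\<close>, these are only the normal parts: the energy density pairs
  normal vectors, so tangential parts of derivatives never enter it. \<open>hess F w i j\<close> is
  \<open>\<nabla>\<^sub>i \<nabla>\<^sub>j w\<close>; its normal part is that of the derivative of \<open>h\<^sub>i\<^sub>j\<close>.
\<close>

definition var_gl :: "(real^4 \<Rightarrow> real^'m) \<Rightarrow> (real^4 \<Rightarrow> real^'m) \<Rightarrow> 4 \<Rightarrow> 4 \<Rightarrow> real^4 \<Rightarrow> real" where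
  "var_gl F w i j x = pd i w x \<bullet> pd j F x + pd i F x \<bullet> pd j w x"

definition var_gu :: "(real^4 \<Rightarrow> real^'m) \<Rightarrow> (real^4 \<Rightarrow> real^'m) \<Rightarrow> 4 \<Rightarrow> 4 \<Rightarrow> real^4 \<Rightarrow> real" where
  "var_gu F w i j x = - (\<Sum>\<^sub>Up q. gu F i p x * var_gl F w p q x * gu F q j x)"

definition var_vol :: "(real^4 \<Rightarrow> real^'m) \<Rightarrow> (real^4 \<Rightarrow> real^'m) \<Rightarrow> real^4 \<Rightarrow> real" where
  "var_vol F w x = vol_density F x * (1/2 * (\<Sum>\<^sub>Ui j. gu F i j x * var_gl F w i j x))"

definition hess :: "(real^4 \<Rightarrow> real^'m) \<Rightarrow> (real^4 \<Rightarrow> real^'m) \<Rightarrow> 4 \<Rightarrow> 4 \<Rightarrow> real^4 \<Rightarrow> real^'m" where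
  "hess F w i j x = pd i (pd j w) x - (\<Sum>\<^sub>Uk. christoffel F k i j x *\<^sub>R pd k w x)"

definition var_H :: "(real^4 \<Rightarrow> real^'m) \<Rightarrow> (real^4 \<Rightarrow> real^'m) \<Rightarrow> real^4 \<Rightarrow> real^'m" where
  "var_H F w x = (1/4) *\<^sub>R (\<Sum>\<^sub>Ui. \<Sum>j\<in>UNIV.
     var_gu F w i j x *\<^sub>R hl F i j x + gu F i j x *\<^sub>R nproj F x (hess F w i j x))"

definition var_pnablaH :: "(real^4 \<Rightarrow> real^'m) \<Rightarrow> (real^4 \<Rightarrow> real^'m) \<Rightarrow> 4 \<Rightarrow> real^4 \<Rightarrow> real^'m" where
  "var_pnablaH F w i x = nproj F x (pd i (var_H F w) x)
     - (\<Sum>\<^sub>Uk. (H F x \<bullet> pd k w x) *\<^sub>R hm F k i x)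
     + (\<Sum>\<^sub>Uk. (H F x \<bullet> hm F k i x) *\<^sub>R nproj F x (pd k w x))"

definition var_energy_density :: "(real^4 \<Rightarrow> real^'m) \<Rightarrow> (real^4 \<Rightarrow> real^'m) \<Rightarrow> real^4 \<Rightarrow> real" where
  "var_energy_density F w x =
     (\<Sum>\<^sub>Ui j. var_gu F w i j x * (pnabla F (H F) i x \<bullet> pnabla F (H F) j x
        - 2 * (\<Sum>\<^sub>Uk l. gu F k l x * (H F x \<bullet> hl F i k x) * (H F x \<bullet> hl F j l x))))
     + 2 * (\<Sum>\<^sub>Ui j. gu F i j x * (pnabla F (H F) j x \<bullet> var_pnablaH F w i x))
     - 2 * (\<Sum>\<^sub>Ui j. (H F x \<bullet> hu F i j x) * (var_H F w x \<bullet> hl F i j x + H F x \<bullet> hess F w i j x))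
     + 28 * (H F x \<bullet> H F x) * (H F x \<bullet> var_H F w x)"

definition var_density :: "(real^4 \<Rightarrow> real^'m) \<Rightarrow> (real^4 \<Rightarrow> real^'m) \<Rightarrow> real^4 \<Rightarrow> real" where
  "var_density F w x = var_energy_density F w x * vol_density F x + energy_density F x * var_vol F w x"

context patch
begin

lemma smooth_var_H:
  assumes w: "smooth_on U w"
  shows "smooth_on U (var_H F w)"
  unfolding var_H_def[abs_def] var_gu_def var_gl_def hess_def
  by (intro smooth_intros smooth_geometry w)

lemma energy_density_eq:
  assumes x: "x \<in> U"
  shows "energy_density F x =
    (\<Sum>\<^sub>Ui j. gu F i j x * (pnabla F (H F) i x \<bullet> pnabla F (H F) j x))
    - (\<Sum>\<^sub>Ui j k. \<Sum>l\<in>UNIV.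
        gu F i k x * gu F j l x * (H F x \<bullet> hl F i j x) * (H F x \<bullet> hl F k l x))
    + 7 * ((H F x \<bullet> H F x) * (H F x \<bullet> H F x))"
proof -
  have "pnabla_up F (H F) i x = (\<Sum>\<^sub>Uj. gu F i j x *\<^sub>R pnabla F (H F) j x)" for i
    by (simp add: pnabla_up_def nabla_up_def raise1_def pnabla_def nproj_linear)
  then have "pnablaH_sq F x = (\<Sum>\<^sub>Ui j. gu F i j x * (pnabla F (H F) i x \<bullet> pnabla F (H F) j x))"
    by (simp add: pnablaH_sq_def inner_sum_right)
  moreover have "Hh_sq F x = (\<Sum>\<^sub>Ui j k. \<Sum>l\<in>UNIV.
        gu F i k x * gu F j l x * (H F x \<bullet> hl F i j x) * (H F x \<bullet> hl F k l x))"
    by (simp add: Hh_sq_def hu_eq inner_sum_right sum_distrib_left ac_simps)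
  ultimately show ?thesis by (simp add: energy_density_def power2_eq_square)
qed

end

context immersion_family
begin

interpretation initial: patch U "\<Phi> 0" by (rule patch_at_zero)

abbreviation "F \<equiv> \<Phi> 0"
abbreviation "w \<equiv> dt \<Phi>"

lemma smooth_w: "smooth_on U w"
  by (rule smooth_dt[OF jsmooth_\<Phi>])

context
  fixes x assumes x: "x \<in> U"
begin

lemma dt_gl: "dt (\<lambda>t. gl (\<Phi> t) i j) x = var_gl F w i j x"
  unfolding gl_eq[abs_def] var_gl_def
  by (simp add: dt_simps x jsmooth_intros jsmooth_\<Phi>)

text \<open>Differentiate the relation between the metric and its inverse and solve for the derivative of
  the inverse.\<close>

lemma dt_gu: "dt (\<lambda>t. gu (\<Phi> t) i j) x = var_gu F w i j x"
proof -
  let ?d = "\<lambda>k. dt (\<lambda>t. gu (\<Phi> t) i k) x"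
  have z: "(\<Sum>\<^sub>Uk. ?d k * gl F k j x) = - (\<Sum>\<^sub>Uk. gu F i k x * var_gl F w k j x)" for j
  proof -
    have "dt (\<lambda>t y. \<Sum>\<^sub>Uk. gu (\<Phi> t) i k y * gl (\<Phi> t) k j y) x = dt (\<lambda>t y. if i = j then 1 else 0) x"
      by (rule dt_cong[OF x]) (simp add: patch.gu_gl[OF patch_at])
    then have "(\<Sum>\<^sub>Uk. ?d k * gl F k j x + gu F i k x * var_gl F w k j x) = 0"
      by (simp add: dt_simps x jsmooth_intros jsmooth_geometry dt_gl smooth_on_const)
    then show ?thesis by (simp add: sum.distrib)
  qed
  have "(\<Sum>\<^sub>Uq. (\<Sum>\<^sub>Uk. ?d k * gl F k q x) * gu F q j x)
      = (\<Sum>\<^sub>Uq k. ?d k * (gu F j q x * gl F q k x))"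
    unfolding sum_distrib_right
    by (intro sum.cong refl) (simp add: initial.gu_commute[OF x, of j] gl_commute[of F _ _ x])
  also have "\<dots> = (\<Sum>\<^sub>Uk q. ?d k * (gu F j q x * gl F q k x))"
    by (rule sum.swap)
  also have "\<dots> = ?d j"
    by (simp add: sum_distrib_left[symmetric] initial.gu_gl[OF x] if_distrib cong: if_cong)
  finally have "?d j = (\<Sum>\<^sub>Uq k. - (gu F i k x * var_gl F w k q x * gu F q j x))"
    by (simp add: z sum_distrib_right sum_negf)
  then show ?thesis
    by (subst (asm) sum.swap) (simp add: var_gu_def sum_negf)
qed

lemma dt_vol_density: "dt (\<lambda>t. vol_density (\<Phi> t)) x = var_vol F w x"
proof -
  let ?A' = "(\<chi> i j. var_gl F w i j x) :: real^4^4"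
  have pos: "det (metric F x) > 0" by (rule initial.det_metric_pos[OF x])
  have A: "((\<lambda>t. metric (\<Phi> t) x $ i $ j) has_real_derivative ?A' $ i $ j) (at 0)" for i j
    using dt_has_vector_derivative[OF x jsmooth_gl, of i j]
    by (simp add: dt_gl gl_def has_real_derivative_iff_has_vector_derivative)
  have "((\<lambda>t. det (metric (\<Phi> t) x)) has_real_derivative
      det (metric F x) * (\<Sum>\<^sub>Ui j. matrix_inv (metric F x) $ j $ i * ?A' $ i $ j)) (at 0)"
    by (rule det_has_derivative[OF A]) (use pos in \<open>simp add: matrix_inv_mult_cancel\<close>)
  then have "((\<lambda>t. sqrt (det (metric (\<Phi> t) x))) has_real_derivative
      inverse (sqrt (det (metric F x))) / 2 *
      (det (metric F x) * (\<Sum>\<^sub>Ui j. matrix_inv (metric F x) $ j $ i * ?A' $ i $ j))) (at 0)"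
    by (rule DERIV_chain2[where g = "\<lambda>t. det (metric (\<Phi> t) x)" and x = 0, OF DERIV_real_sqrt[OF pos]])
  moreover have "inverse (sqrt d) / 2 * (d * s) = sqrt d * (1/2 * s)" if "d > 0" for d s :: real
    using real_div_sqrt[of d] that by (simp add: field_simps)
  note this[OF pos]
  moreover have "matrix_inv (metric F x) $ j $ i = gu F i j x" for i j
    unfolding initial.gu_commute[OF x, of i] by (simp add: gu_def)
  ultimately have "((\<lambda>t. sqrt (det (metric (\<Phi> t) x))) has_real_derivative var_vol F w x) (at 0)"
    by (simp only: var_vol_def vol_density_def vec_lambda_beta)
  then show ?thesis
    by (intro dt_eqI_vector[OF x jsmooth_vol_density])
       (simp add: vol_density_def has_real_derivative_iff_has_vector_derivative)
qed

text \<open>The derivative of the Christoffel symbols, which would be unpleasant, multiplies tangent vectors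
  and is projected away.\<close>

lemma nproj_dt_hl: "nproj F x (dt (\<lambda>t. hl (\<Phi> t) i j) x) = nproj F x (hess F w i j x)"
proof -
  have "pd i (dt (\<lambda>t. pd j (\<Phi> t))) x = pd i (pd j w) x"
    by (rule pd_cong[OF dt_pd[OF jsmooth_\<Phi>] x])
  then show ?thesis
    unfolding hl_def nabla_covec_def[abs_def] hess_def
    by (simp add: dt_simps x jsmooth_intros jsmooth_geometry initial.nproj_linear sum.distrib)
qed

lemma nproj_dt_H: "nproj F x (dt (\<lambda>t. H (\<Phi> t)) x) = var_H F w x"
  unfolding H_def[abs_def] var_H_def
  by (simp add: dt_simps x jsmooth_intros jsmooth_geometry initial.nproj_linear sum.distrib dt_gu nproj_dt_hl
      initial.nproj_id[OF initial.normal_hl[OF x]] smooth_on_const)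

text \<open>The tangential part is found from \<open>H \<bullet> pd k F = 0\<close>; it is needed because \<open>\<pi> \<nabla>\<close> turns it into
  a normal contribution.\<close>

lemma dt_H: "dt (\<lambda>t. H (\<Phi> t)) x = var_H F w x - (\<Sum>\<^sub>Uk. (H F x \<bullet> pd k w x) *\<^sub>R dual_frame F k x)"
proof -
  have "dt (\<lambda>t. H (\<Phi> t)) x \<bullet> pd k F x = - (H F x \<bullet> pd k w x)" for k
  proof -
    have "dt (\<lambda>t y. H (\<Phi> t) y \<bullet> pd k (\<Phi> t) y) x = dt (\<lambda>t y. 0) x"
      using patch.normal_H[OF patch_at] patch.normal_at_pd[OF patch_at] by (intro dt_cong[OF x]) blast
    then show ?thesis
      by (simp add: dt_simps x jsmooth_intros jsmooth_geometry smooth_on_const)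
  qed
  then show ?thesis
    using nproj_dt_H by (simp add: initial.nproj_eq'[OF x] sum_negf algebra_simps)
qed

end

context
  fixes x assumes x: "x \<in> U"
begin

text \<open>By Weingarten, \<open>\<pi> \<nabla>\<^sub>i H\<close> is \<open>\<partial>\<^sub>i H\<close> plus an explicit tangential correction, so only the tangent
  vectors in the correction have to be differentiated.\<close>

lemma nproj_dt_pnablaH: "nproj F x (dt (\<lambda>t. pnabla (\<Phi> t) (H (\<Phi> t)) i) x) = var_pnablaH F w i x"
proof -
  have "dt (\<lambda>t. pnabla (\<Phi> t) (H (\<Phi> t)) i) x
    = dt (\<lambda>t y. pd i (H (\<Phi> t)) y + (\<Sum>\<^sub>Uk. (H (\<Phi> t) y \<bullet> hm (\<Phi> t) k i y) *\<^sub>R pd k (\<Phi> t) y)) x"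
    using patch.pd_normal_field[OF patch_at _ patch.smooth_H[OF patch_at] patch.normal_H[OF patch_at]]
    by (intro dt_cong[OF x]) simp
  moreover have "pd i (dt (\<lambda>t. H (\<Phi> t))) x
    = pd i (\<lambda>y. var_H F w y - (\<Sum>\<^sub>Uk. (H F y \<bullet> pd k w y) *\<^sub>R dual_frame F k y)) x"
    by (rule pd_cong[OF dt_H x])
  ultimately show ?thesis
    by (simp add: dt_simps x jsmooth_intros jsmooth_geometry initial.nproj_linear sum.distrib
        pd_simps smooth_intros initial.smooth_geometry smooth_w
        initial.smooth_var_H[OF smooth_w]
        initial.nproj_pd_dual_frame var_pnablaH_def)
qed

end

end


lemma sum4_swap_middle:
  "(\<Sum>i\<in>A. \<Sum>j\<in>B. \<Sum>k\<in>C. \<Sum>l\<in>D. f i j k l) = (\<Sum>i\<in>A. \<Sum>k\<in>C. \<Sum>j\<in>B. \<Sum>l\<in>D. f i j k l)"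
  by (rule sum.cong[OF refl]) (rule sum.swap)

lemma sum4_swap_pairs:
  "(\<Sum>i\<in>A. \<Sum>j\<in>B. \<Sum>k\<in>C. \<Sum>l\<in>D. f i j k l) = (\<Sum>k\<in>C. \<Sum>l\<in>D. \<Sum>i\<in>A. \<Sum>j\<in>B. f i j k l)"
proof -
  have "(\<Sum>i\<in>A. \<Sum>j\<in>B. \<Sum>k\<in>C. \<Sum>l\<in>D. f i j k l) = (\<Sum>i\<in>A. \<Sum>k\<in>C. \<Sum>j\<in>B. \<Sum>l\<in>D. f i j k l)"
    by (rule sum4_swap_middle)
  also have "\<dots> = (\<Sum>k\<in>C. \<Sum>i\<in>A. \<Sum>l\<in>D. \<Sum>j\<in>B. f i j k l)"
    by (subst sum.swap) (intro sum.cong refl sum.swap)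
  also have "\<dots> = (\<Sum>k\<in>C. \<Sum>l\<in>D. \<Sum>i\<in>A. \<Sum>j\<in>B. f i j k l)"
    by (intro sum.cong refl sum.swap)
  finally show ?thesis .
qed

lemma sum4_swap_inside_pairs:
  "(\<Sum>i\<in>A. \<Sum>j\<in>B. \<Sum>k\<in>C. \<Sum>l\<in>D. f i j k l) = (\<Sum>j\<in>B. \<Sum>i\<in>A. \<Sum>l\<in>D. \<Sum>k\<in>C. f i j k l)"
  by (subst sum.swap) (intro sum.cong refl sum.swap)

text \<open>The Leibniz rule for the contraction \<open>g g a a\<close>: symmetry makes its four terms equal in pairs.
  Here \<open>v\<close> and \<open>b\<close> are the derivatives of \<open>g\<close> and \<open>a\<close>.\<close>

lemma variation_of_square:
  fixes g v a b :: "'i::finite \<Rightarrow> 'i \<Rightarrow> real"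
  assumes a: "\<And>i j. a i j = a j i"
  shows "(\<Sum>\<^sub>Ui j k. \<Sum>l\<in>UNIV.
       v i k * g j l * a i j * a k l + g i k * v j l * a i j * a k l
       + g i k * g j l * b i j * a k l + g k i * g l j * a i j * b k l)
   = 2 * (\<Sum>\<^sub>Ui j. v i j * (\<Sum>\<^sub>Uk l. g k l * a i k * a j l))
     + 2 * (\<Sum>\<^sub>Ui j. (\<Sum>\<^sub>Uk l. g i k * g j l * a k l) * b i j)"
proof -
  have 1: "(\<Sum>\<^sub>Ui j k l. v i k * g j l * a i j * a k l)
     = (\<Sum>\<^sub>Ui j. v i j * (\<Sum>\<^sub>Uk l. g k l * a i k * a j l))"
    by (subst sum4_swap_middle) (simp add: sum_distrib_left mult.assoc)
  have "(\<Sum>\<^sub>Ui j k l. g i k * v j l * a i j * a k l)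
     = (\<Sum>\<^sub>Ui j k l. v i k * g j l * a i j * a k l)"
    by (subst sum4_swap_inside_pairs) (intro sum.cong refl, simp add: a ac_simps)
  note 2 = this[unfolded 1]
  have 3: "(\<Sum>\<^sub>Ui j k l. g i k * g j l * b i j * a k l)
     = (\<Sum>\<^sub>Ui j. (\<Sum>\<^sub>Uk l. g i k * g j l * a k l) * b i j)"
    by (simp add: sum_distrib_left sum_distrib_right ac_simps)
  have "(\<Sum>\<^sub>Ui j k l. g k i * g l j * a i j * b k l)
     = (\<Sum>\<^sub>Ui j k l. g i k * g j l * b i j * a k l)"
    by (subst sum4_swap_pairs) (simp add: ac_simps)
  note 4 = this[unfolded 3]
  show ?thesis unfolding sum.distrib 1 2 3 4 by simp
qed

context immersion_family
begin

interpretation initial: patch U "\<Phi> 0" by (rule patch_at_zero)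

context
  fixes x assumes x: "x \<in> U"
begin

text \<open>Pairing with a normal vector sees only the normal part of a derivative.\<close>

lemma dt_inner_normal:
  assumes f: "jsmooth f" and n: "jsmooth n"
    and fn: "normal_at F x (f 0 x)" and nn: "normal_at F x (n 0 x)"
  shows "dt (\<lambda>t y. f t y \<bullet> n t y) x = nproj F x (dt f x) \<bullet> n 0 x + f 0 x \<bullet> nproj F x (dt n x)"
  by (simp add: dt_simps x f n initial.nproj_inner_normal fn nn)

lemma dt_H_inner_hl:
  "dt (\<lambda>t y. H (\<Phi> t) y \<bullet> hl (\<Phi> t) i j y) x = var_H F w x \<bullet> hl F i j x + H F x \<bullet> hess F w i j x"
  using initial.normal_H[OF x] initial.normal_hl[OF x]
  by (simp add: dt_inner_normal jsmooth_geometry nproj_dt_H[OF x] nproj_dt_hl[OF x] initial.nproj_inner_normal)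

lemma dt_H_inner_H: "dt (\<lambda>t y. H (\<Phi> t) y \<bullet> H (\<Phi> t) y) x = 2 * (H F x \<bullet> var_H F w x)"
  using initial.normal_H[OF x]
  by (simp add: dt_inner_normal jsmooth_geometry nproj_dt_H[OF x] inner_commute)

lemma dt_pnablaH_inner:
  "dt (\<lambda>t y. pnabla (\<Phi> t) (H (\<Phi> t)) i y \<bullet> pnabla (\<Phi> t) (H (\<Phi> t)) j y) x
   = var_pnablaH F w i x \<bullet> pnabla F (H F) j x + pnabla F (H F) i x \<bullet> var_pnablaH F w j x"
  using initial.normal_pnabla[OF x]
  by (simp add: dt_inner_normal jsmooth_geometry nproj_dt_pnablaH[OF x])

lemma dt_energy_density: "dt (\<lambda>t. energy_density (\<Phi> t)) x = var_energy_density F w x"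
proof -
  let ?P = "\<lambda>i. pnabla F (H F) i x" and ?M = "\<lambda>i. var_pnablaH F w i x"
  let ?a = "\<lambda>i j. H F x \<bullet> hl F i j x" and ?g = "\<lambda>i j. gu F i j x" and ?v = "\<lambda>i j. var_gu F w i j x"
  let ?b = "\<lambda>i j. var_H F w x \<bullet> hl F i j x + H F x \<bullet> hess F w i j x"
  note js = jsmooth_intros jsmooth_geometry
  have g: "?g i j = ?g j i" for i j by (rule initial.gu_commute[OF x])
  have A: "dt (\<lambda>t y. \<Sum>\<^sub>Ui j. gu (\<Phi> t) i j y * (pnabla (\<Phi> t) (H (\<Phi> t)) i y \<bullet> pnabla (\<Phi> t) (H (\<Phi> t)) j y)) x
     = (\<Sum>\<^sub>Ui j. ?v i j * (?P i \<bullet> ?P j)) + 2 * (\<Sum>\<^sub>Ui j. ?g i j * (?P j \<bullet> ?M i))"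
  proof -
    have "(\<Sum>\<^sub>Ui j. ?g i j * (?P i \<bullet> ?M j)) = (\<Sum>\<^sub>Ui j. ?g i j * (?P j \<bullet> ?M i))"
      by (subst sum.swap) (simp add: g)
    then show ?thesis
      by (simp add: dt_sum dt_mult x js dt_gu dt_pnablaH_inner distrib_left sum.distrib inner_commute)
  qed
  have B: "dt (\<lambda>t y. \<Sum>\<^sub>Ui j k. \<Sum>l\<in>UNIV.
        gu (\<Phi> t) i k y * gu (\<Phi> t) j l y * (H (\<Phi> t) y \<bullet> hl (\<Phi> t) i j y) * (H (\<Phi> t) y \<bullet> hl (\<Phi> t) k l y)) x
     = 2 * (\<Sum>\<^sub>Ui j. ?v i j * (\<Sum>\<^sub>Uk l. ?g k l * ?a i k * ?a j l))
     + 2 * (\<Sum>\<^sub>Ui j. (\<Sum>\<^sub>Uk l. ?g i k * ?g j l * ?a k l) * ?b i j)"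
  proof -
    have "?a i j = ?a j i" for i j by (simp add: initial.hl_commute[OF x, of i])
    note variation_of_square[of ?a ?v ?g ?b, OF this, symmetric]
    moreover have "gu F k i x * gu F l j x = gu F i k x * gu F j l x" for i j k l by (simp add: g)
    ultimately show ?thesis
      by (simp add: dt_sum dt_mult x js dt_gu dt_H_inner_hl algebra_simps)
  qed
  have "(\<Sum>\<^sub>Uk l. ?g i k * ?g j l * ?a k l) = H F x \<bullet> hu F i j x" for i j
    by (simp add: initial.hu_eq inner_sum_right)
  note B = B[unfolded this]
  have "dt (\<lambda>t. energy_density (\<Phi> t)) x = dt (\<lambda>t y.
    (\<Sum>\<^sub>Ui j. gu (\<Phi> t) i j y * (pnabla (\<Phi> t) (H (\<Phi> t)) i y \<bullet> pnabla (\<Phi> t) (H (\<Phi> t)) j y))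
    - (\<Sum>\<^sub>Ui j k. \<Sum>l\<in>UNIV.
        gu (\<Phi> t) i k y * gu (\<Phi> t) j l y * (H (\<Phi> t) y \<bullet> hl (\<Phi> t) i j y) * (H (\<Phi> t) y \<bullet> hl (\<Phi> t) k l y))
    + 7 * ((H (\<Phi> t) y \<bullet> H (\<Phi> t) y) * (H (\<Phi> t) y \<bullet> H (\<Phi> t) y))) x"
    by (rule dt_cong[OF x]) (rule patch.energy_density_eq[OF patch_at])
  also have "\<dots> = (\<Sum>\<^sub>Ui j. ?v i j * (?P i \<bullet> ?P j)) + 2 * (\<Sum>\<^sub>Ui j. ?g i j * (?P j \<bullet> ?M i))
     - (2 * (\<Sum>\<^sub>Ui j. ?v i j * (\<Sum>\<^sub>Uk l. ?g k l * ?a i k * ?a j l))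
     + 2 * (\<Sum>\<^sub>Ui j. (H F x \<bullet> hu F i j x) * ?b i j))
     + 28 * (H F x \<bullet> H F x) * (H F x \<bullet> var_H F w x)"
  proof -
    define A where "A = (\<lambda>t y. \<Sum>\<^sub>Ui j. gu (\<Phi> t) i j y * (pnabla (\<Phi> t) (H (\<Phi> t)) i y \<bullet> pnabla (\<Phi> t) (H (\<Phi> t)) j y))"
    define B where "B = (\<lambda>t y. \<Sum>\<^sub>Ui j k. \<Sum>l\<in>UNIV.
        gu (\<Phi> t) i k y * gu (\<Phi> t) j l y * (H (\<Phi> t) y \<bullet> hl (\<Phi> t) i j y) * (H (\<Phi> t) y \<bullet> hl (\<Phi> t) k l y))"
    define C where "C = (\<lambda>t y. H (\<Phi> t) y \<bullet> H (\<Phi> t) y)"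
    have ABC: "jsmooth A" "jsmooth B" "jsmooth C"
      unfolding A_def B_def C_def by (intro js)+
    have "dt (\<lambda>t y. A t y - B t y + 7 * (C t y * C t y)) x = dt A x - dt B x + 14 * C 0 x * dt C x"
      by (simp add: dt_add dt_diff dt_mult x ABC jsmooth_intros smooth_on_const)
    then show ?thesis
      using A B dt_H_inner_H by (simp add: A_def B_def C_def)
  qed
  also have "\<dots> = var_energy_density F w x"
    by (simp add: var_energy_density_def right_diff_distrib sum_subtractf sum_distrib_left ac_simps)
  finally show ?thesis .
qed

lemma dt_density:
  "dt (\<lambda>t y. energy_density (\<Phi> t) y * vol_density (\<Phi> t) y) x = var_density F w x"
  by (simp add: dt_mult x jsmooth_energy_density jsmooth_vol_density dt_energy_density dt_vol_density
      var_density_def)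

end

end

section \<open>Tangential variations\<close>

text \<open>A velocity is often known only on an open set; the following congruences make this sufficient.\<close>

context chart_domain
begin

context
  fixes v w :: "real^4 \<Rightarrow> real^'m"
  assumes vw: "\<And>y. y \<in> U \<Longrightarrow> v y = w y"
begin

lemma var_gl_cong: "x \<in> U \<Longrightarrow> var_gl F v i j x = var_gl F w i j x"
  using pd_cong[where f = v and g = w, OF vw] by (simp add: var_gl_def)

lemma var_gu_cong: "x \<in> U \<Longrightarrow> var_gu F v i j x = var_gu F w i j x"
  by (simp add: var_gu_def var_gl_cong)

lemma hess_cong:
  assumes "x \<in> U"
  shows "hess F v i j x = hess F w i j x"
proof -
  have "pd k v y = pd k w y" if "y \<in> U" for k y by (rule pd_cong[OF vw that])
  then show ?thesis
    using pd_cong[of "pd j v" "pd j w" x i] assms by (simp add: hess_def)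
qed

lemma var_H_cong: "x \<in> U \<Longrightarrow> var_H F v x = var_H F w x"
  by (simp add: var_H_def var_gu_cong hess_cong)

lemma var_pnablaH_cong: "x \<in> U \<Longrightarrow> var_pnablaH F v i x = var_pnablaH F w i x"
  using pd_cong[OF var_H_cong] pd_cong[where f = v and g = w, OF vw] by (simp add: var_pnablaH_def)

lemma var_vol_cong: "x \<in> U \<Longrightarrow> var_vol F v x = var_vol F w x"
  by (simp add: var_vol_def var_gl_cong)

lemma var_density_cong: "x \<in> U \<Longrightarrow> var_density F v x = var_density F w x"
  by (simp add: var_density_def var_energy_density_def var_vol_cong var_gu_cong hess_cong
      var_H_cong var_pnablaH_cong)

end

end

lemma has_derivative_shift:
  fixes f :: "'a::real_normed_vector \<Rightarrow> 'b::real_normed_vector"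
  shows "((\<lambda>y. f (y + c)) has_derivative D) (at x) \<longleftrightarrow> (f has_derivative D) (at (x + c))"
proof
  assume *: "(f has_derivative D) (at (x + c))"
  have "((\<lambda>y. y + c) has_derivative (\<lambda>v. v)) (at x)" by (auto intro!: derivative_eq_intros)
  from has_derivative_compose[OF this *] show "((\<lambda>y. f (y + c)) has_derivative D) (at x)" .
next
  assume *: "((\<lambda>y. f (y + c)) has_derivative D) (at x)"
  have "((\<lambda>y. y - c) has_derivative (\<lambda>v. v)) (at (x + c))" by (auto intro!: derivative_eq_intros)
  from has_derivative_compose[OF this, of "\<lambda>y. f (y + c)" D] *
  show "(f has_derivative D) (at (x + c))" by simp
qed

lemma frechet_derivative_shift:
  fixes f :: "'a::real_normed_vector \<Rightarrow> 'b::real_normed_vector"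
  shows "frechet_derivative (\<lambda>y. f (y + c)) (at x) = frechet_derivative f (at (x + c))"
  by (simp add: frechet_derivative_def has_derivative_shift)

lemma pd_shift: "pd i (\<lambda>y. f (y + c)) = (\<lambda>x. pd i f (x + c))"
  by (simp add: pd_def[abs_def] frechet_derivative_shift)

lemma gl_shift: "gl (\<lambda>y. F (y + c)) i j = (\<lambda>x. gl F i j (x + c))"
  by (simp add: gl_eq[abs_def] pd_shift)

lemma metric_shift: "metric (\<lambda>y. F (y + c)) = (\<lambda>x. metric F (x + c))"
  by (simp add: metric_def[abs_def] pd_shift)

lemma gu_shift: "gu (\<lambda>y. F (y + c)) i j = (\<lambda>x. gu F i j (x + c))"
  by (simp add: gu_def[abs_def] metric_shift)

lemma vol_density_shift: "vol_density (\<lambda>y. F (y + c)) = (\<lambda>x. vol_density F (x + c))"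
  by (simp add: vol_density_def[abs_def] metric_shift)

lemma christoffel_shift: "christoffel (\<lambda>y. F (y + c)) k i j = (\<lambda>x. christoffel F k i j (x + c))"
  by (simp add: christoffel_def[abs_def] gl_shift gu_shift pd_shift)

lemma hl_shift: "hl (\<lambda>y. F (y + c)) i j = (\<lambda>x. hl F i j (x + c))"
  by (simp add: hl_def nabla_covec_def[abs_def] christoffel_shift pd_shift)

lemma hu_shift: "hu (\<lambda>y. F (y + c)) i j = (\<lambda>x. hu F i j (x + c))"
  by (simp add: hu_def hm_def raise1_def[abs_def] gu_shift hl_shift)

lemma H_shift: "H (\<lambda>y. F (y + c)) = (\<lambda>x. H F (x + c))"
  by (simp add: H_def[abs_def] gu_shift hl_shift)

lemma nproj_shift: "nproj (\<lambda>y. F (y + c)) x v = nproj F (x + c) v"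
  by (simp add: nproj_def pd_shift gu_shift)

lemma energy_density_shift: "energy_density (\<lambda>y. F (y + c)) = (\<lambda>x. energy_density F (x + c))"
  by (simp add: energy_density_def[abs_def] pnablaH_sq_def Hh_sq_def pnabla_def pnabla_up_def
      nabla_up_def raise1_def nproj_shift H_shift hl_shift hu_shift pd_shift gu_shift)

lemma (in chart_domain) jsmooth_translate:
  assumes F: "smooth_on U F" and V: "open V" and sub: "\<And>t y. \<bar>t\<bar> < r \<Longrightarrow> y \<in> V \<Longrightarrow> y + t *\<^sub>R e \<in> U" and r: "r > 0"
  shows "time_domain.jsmooth V r (\<lambda>t y. F (y + t *\<^sub>R e))"
proof -
  interpret T: time_domain V r by unfold_locales (use V r in auto)
  have "smooth_on ({-r<..<r} \<times> V) (\<lambda>p. snd p + fst p *\<^sub>R e)"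
    by (intro smooth_on_add smooth_on_scaleR smooth_on_const smooth_on_bounded_linear
        bounded_linear_fst bounded_linear_snd T.open_cylinder)
  then show ?thesis
    unfolding T.jsmooth_def
    by (intro smooth_on_compose[OF T.open_cylinder open_U F]) (auto intro!: sub simp: abs_less_iff)
qed

context patch
begin

text \<open>Moving the chart parameter along a coordinate axis is a particular variation of the immersion.
  For it the first variation is an ordinary partial derivative.\<close>

lemma translation_variation:
  assumes x: "x \<in> U"
  shows "var_density F (pd k F) x = pd k (\<lambda>y. energy_density F y * vol_density F y) x"
    and "var_H F (pd k F) x = pnabla F (H F) k x"
    and "var_vol F (pd k F) x = pd k (vol_density F) x"
    and "var_gu F (pd k F) i j x = pd k (gu F i j) x"
proof -
  obtain r0 where r0: "r0 > 0" "ball x r0 \<subseteq> U" using open_contains_ball[of U] x by auto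
  \<comment> \<open>half of the radius for the points, half for the translation\<close>
  define r where "r = r0 / 2"
  define V where "V = ball x r"
  let ?e = "axis k 1 :: real^4"
  let ?\<Phi> = "\<lambda>t y. F (y + t *\<^sub>R ?e)"
  have r: "r > 0" "open V" "x \<in> V" using r0 by (auto simp: r_def V_def)
  have sub: "y + t *\<^sub>R ?e \<in> U" if "\<bar>t\<bar> < r" "y \<in> V" for t y
  proof -
    have "dist x (y + t *\<^sub>R ?e) \<le> dist x y + norm (t *\<^sub>R ?e)"
      using norm_triangle_ineq4[of "x - y" "t *\<^sub>R ?e"] by (simp add: dist_norm algebra_simps)
    also have "\<dots> < r0" using that by (simp add: V_def r_def norm_axis_1)
    finally show ?thesis using r0 by (auto simp: subset_eq)
  qed
  interpret T: time_domain V r by unfold_locales (use r in auto)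
  have js: "T.jsmooth (\<lambda>t y. f (y + t *\<^sub>R ?e))" if "smooth_on U f" for f :: "real^4 \<Rightarrow> 'v::real_normed_vector"
    by (rule jsmooth_translate[OF that r(2) sub r(1)])
  have dts: "dt (\<lambda>t y. f (y + t *\<^sub>R ?e)) y = pd k f y" if f: "smooth_on U f" and y: "y \<in> V"
    for f :: "real^4 \<Rightarrow> 'v::real_normed_vector" and y
  proof -
    have "y \<in> U" using sub[of 0 y] y r by simp
    have "((\<lambda>t. y + t *\<^sub>R ?e) has_derivative (\<lambda>t. t *\<^sub>R ?e)) (at 0)" by (auto intro!: derivative_eq_intros)
    from has_derivative_compose[OF this, of f "frechet_derivative f (at y)"]
    have "((\<lambda>t. f (y + t *\<^sub>R ?e)) has_derivative (\<lambda>t. frechet_derivative f (at y) (t *\<^sub>R ?e))) (at 0)"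
      using smooth_on_has_derivative[OF f \<open>y \<in> U\<close>] by simp
    moreover have "frechet_derivative f (at y) (t *\<^sub>R ?e) = t *\<^sub>R pd k f y" for t
      unfolding pd_def
      by (rule linear_cmul[OF linear_frechet_derivative[OF smooth_on_differentiable[OF f \<open>y \<in> U\<close>]]])
    ultimately show ?thesis
      by (intro T.dt_eqI_vector[OF y js[OF f]]) (simp add: has_vector_derivative_def)
  qed
  interpret T: immersion_family V r ?\<Phi>
    by unfold_locales (auto simp: frechet_derivative_shift intro!: js smooth_F inj_F sub)
  have F0: "?\<Phi> 0 = F" by simp
  have w: "dt ?\<Phi> y = pd k F y" if "y \<in> V" for y by (rule dts[OF smooth_F that])
  have "var_density F (pd k F) x = var_density F (dt ?\<Phi>) x"
    by (rule T.var_density_cong[OF _ r(3), symmetric]) (rule w)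
  also have "\<dots> = dt (\<lambda>t y. energy_density F (y + t *\<^sub>R ?e) * vol_density F (y + t *\<^sub>R ?e)) x"
    using T.dt_density[OF r(3)] by (simp add: energy_density_shift vol_density_shift)
  also have "\<dots> = pd k (\<lambda>y. energy_density F y * vol_density F y) x"
    by (rule dts[OF _ r(3)]) (intro smooth_intros smooth_geometry)
  finally show "var_density F (pd k F) x = pd k (\<lambda>y. energy_density F y * vol_density F y) x" .
  have "var_H F (pd k F) x = var_H F (dt ?\<Phi>) x"
    by (rule T.var_H_cong[OF _ r(3), symmetric]) (rule w)
  also have "\<dots> = nproj F x (dt (\<lambda>t y. H F (y + t *\<^sub>R ?e)) x)"
    using T.nproj_dt_H[OF r(3)] by (simp add: H_shift)
  also have "\<dots> = pnabla F (H F) k x"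
    by (simp add: dts[OF smooth_H r(3)] pnabla_def)
  finally show "var_H F (pd k F) x = pnabla F (H F) k x" .
  have "var_vol F (pd k F) x = var_vol F (dt ?\<Phi>) x"
    by (rule T.var_vol_cong[OF _ r(3), symmetric]) (rule w)
  also have "\<dots> = pd k (vol_density F) x"
    using T.dt_vol_density[OF r(3)] by (simp add: vol_density_shift dts[OF smooth_vol_density r(3)])
  finally show "var_vol F (pd k F) x = pd k (vol_density F) x" .
  have "var_gu F (pd k F) i j x = var_gu F (dt ?\<Phi>) i j x"
    by (rule T.var_gu_cong[OF _ r(3), symmetric]) (rule w)
  also have "\<dots> = pd k (gu F i j) x"
    using T.dt_gu[OF r(3)] by (simp add: gu_shift dts[OF smooth_gu r(3)])
  finally show "var_gu F (pd k F) i j x = pd k (gu F i j) x" .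
qed

end


context patch
begin

text \<open>Treating \<open>a u + v\<close> at once covers sums, multiples and, with \<open>u = v = 0\<close>, the zero velocity.\<close>

context
  fixes w u v :: "real^4 \<Rightarrow> real^'m" and a :: real
  assumes w: "w = (\<lambda>y. a *\<^sub>R u y + v y)" and uv: "smooth_on U u" "smooth_on U v"
begin

lemma pd_lincomb: "x \<in> U \<Longrightarrow> pd i w x = a *\<^sub>R pd i u x + pd i v x"
  by (simp add: w pd_simps uv smooth_intros)

lemma var_gl_lincomb: "x \<in> U \<Longrightarrow> var_gl F w i j x = a * var_gl F u i j x + var_gl F v i j x"
  by (simp add: var_gl_def pd_lincomb inner_add_left inner_add_right algebra_simps)

lemma var_gu_lincomb: "x \<in> U \<Longrightarrow> var_gu F w i j x = a * var_gu F u i j x + var_gu F v i j x"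
  by (simp add: var_gu_def var_gl_lincomb algebra_simps sum.distrib sum_distrib_left sum_negf)

lemma var_vol_lincomb: "x \<in> U \<Longrightarrow> var_vol F w x = a * var_vol F u x + var_vol F v x"
  by (simp add: var_vol_def var_gl_lincomb algebra_simps sum.distrib sum_distrib_left)

lemma hess_lincomb:
  assumes x: "x \<in> U"
  shows "hess F w i j x = a *\<^sub>R hess F u i j x + hess F v i j x"
proof -
  have "pd i (pd j w) x = pd i (\<lambda>y. a *\<^sub>R pd j u y + pd j v y) x"
    by (rule pd_cong[OF pd_lincomb x])
  also have "\<dots> = a *\<^sub>R pd i (pd j u) x + pd i (pd j v) x"
    by (simp add: pd_simps x uv smooth_intros)
  finally show ?thesis
    by (simp add: hess_def pd_lincomb[OF x] algebra_simps sum.distrib scaleR_sum_right)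
qed

lemma var_H_lincomb: "x \<in> U \<Longrightarrow> var_H F w x = a *\<^sub>R var_H F u x + var_H F v x"
  by (simp add: var_H_def var_gu_lincomb hess_lincomb nproj_linear algebra_simps
      sum.distrib scaleR_sum_right)

lemma var_pnablaH_lincomb:
  assumes x: "x \<in> U"
  shows "var_pnablaH F w i x = a *\<^sub>R var_pnablaH F u i x + var_pnablaH F v i x"
proof -
  have "pd i (var_H F w) x = pd i (\<lambda>y. a *\<^sub>R var_H F u y + var_H F v y) x"
    by (rule pd_cong[OF var_H_lincomb x])
  also have "\<dots> = a *\<^sub>R pd i (var_H F u) x + pd i (var_H F v) x"
    by (simp add: pd_simps x uv smooth_intros smooth_var_H)
  finally show ?thesis
    by (simp add: var_pnablaH_def pd_lincomb[OF x] nproj_linear inner_add_right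
        algebra_simps sum.distrib scaleR_sum_right)
qed

lemma var_energy_density_lincomb:
  assumes x: "x \<in> U"
  shows "var_energy_density F w x = a * var_energy_density F u x + var_energy_density F v x"
proof -
  have 1: "(\<Sum>\<^sub>Ui j. (a * p i j + q i j) * r i j) = a * (\<Sum>\<^sub>Ui j. p i j * r i j) + (\<Sum>\<^sub>Ui j. q i j * r i j)"
    for p q r :: "4 \<Rightarrow> 4 \<Rightarrow> real"
    by (simp add: distrib_right sum.distrib sum_distrib_left mult.assoc)
  have 2: "(\<Sum>\<^sub>Ui j. r i j * (a * p i j + q i j)) = a * (\<Sum>\<^sub>Ui j. r i j * p i j) + (\<Sum>\<^sub>Ui j. r i j * q i j)"
    for p q r :: "4 \<Rightarrow> 4 \<Rightarrow> real"
    using 1[of p q r] by (simp add: mult.commute)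
  have 3: "var_H F w x \<bullet> h + H F x \<bullet> hess F w i j x
     = a * (var_H F u x \<bullet> h + H F x \<bullet> hess F u i j x) + (var_H F v x \<bullet> h + H F x \<bullet> hess F v i j x)" for h i j
    by (simp add: var_H_lincomb[OF x] hess_lincomb[OF x] inner_add_left inner_add_right algebra_simps)
  have 4: "p \<bullet> var_pnablaH F w i x = a * (p \<bullet> var_pnablaH F u i x) + p \<bullet> var_pnablaH F v i x" for p i
    by (simp add: var_pnablaH_lincomb[OF x] inner_add_right)
  have 5: "p \<bullet> var_H F w x = a * (p \<bullet> var_H F u x) + p \<bullet> var_H F v x" for p
    by (simp add: var_H_lincomb[OF x] inner_add_right)
  show ?thesis
    unfolding var_energy_density_def var_gu_lincomb[OF x] 3 4 5 1 2 by (simp add: algebra_simps)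
qed

lemma var_density_lincomb: "x \<in> U \<Longrightarrow> var_density F w x = a * var_density F u x + var_density F v x"
  by (simp add: var_density_def var_energy_density_lincomb var_vol_lincomb algebra_simps)

end

lemma var_density_zero: "x \<in> U \<Longrightarrow> var_density F (\<lambda>y. 0) x = 0"
  using var_density_lincomb[of "\<lambda>y. 0" 1 "\<lambda>y. 0" "\<lambda>y. 0" x] by (simp add: smooth_on_const)

lemma var_H_zero: "x \<in> U \<Longrightarrow> var_H F (\<lambda>y. 0) x = 0"
  using var_H_lincomb[of "\<lambda>y. 0" 1 "\<lambda>y. 0" "\<lambda>y. 0" x] by (simp add: smooth_on_const)

lemma var_density_add:
  "x \<in> U \<Longrightarrow> smooth_on U u \<Longrightarrow> smooth_on U v \<Longrightarrow>
    var_density F (\<lambda>y. u y + v y) x = var_density F u x + var_density F v x"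
  using var_density_lincomb[of "\<lambda>y. u y + v y" 1 u v x] by simp

lemma var_density_sum:
  assumes x: "x \<in> U" and u: "\<And>k. smooth_on U (u k)" and "finite A"
  shows "var_density F (\<lambda>y. \<Sum>k\<in>A. c k *\<^sub>R u k y) x = (\<Sum>k\<in>A. c k * var_density F (u k) x)"
  using \<open>finite A\<close>
proof induction
  case (insert a A)
  then show ?case
    using var_density_lincomb[OF refl u smooth_on_sum[OF open_U] x, of A "\<lambda>k y. c k *\<^sub>R u k y"]
    by (simp add: smooth_intros u)
qed (simp add: var_density_zero x)

lemma var_H_sum:
  assumes x: "x \<in> U" and u: "\<And>k. smooth_on U (u k)" and "finite A"
  shows "var_H F (\<lambda>y. \<Sum>k\<in>A. c k *\<^sub>R u k y) x = (\<Sum>k\<in>A. c k *\<^sub>R var_H F (u k) x)"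
  using \<open>finite A\<close>
proof induction
  case (insert a A)
  then show ?case
    using var_H_lincomb[OF refl u smooth_on_sum[OF open_U] x, of A "\<lambda>k y. c k *\<^sub>R u k y"]
    by (simp add: smooth_intros u)
qed (simp add: var_H_zero x)

end

text \<open>Let \<open>\<xi> k i\<close> stand for \<open>\<partial>\<^sub>i Y\<^sup>k\<close>. The derivatives of \<open>Y\<close> enter the variations of different tensors
  through different contractions; the next three lemmas bring all of them to the common form
  \<open>\<Sum>\<^sub>k g i k \<xi> j k\<close>, after which they visibly cancel.\<close>

lemma contract_left:
  fixes h :: "'i::finite \<Rightarrow> 'i \<Rightarrow> 'v::real_vector"
  assumes g: "\<And>i j. g i j = g j i"
  shows "(\<Sum>\<^sub>Ui j. g i j *\<^sub>R (\<Sum>\<^sub>Uk. \<xi> k i *\<^sub>R h j k))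
       = (\<Sum>\<^sub>Ui j. (\<Sum>\<^sub>Uk. g i k * \<xi> j k) *\<^sub>R h i j)"
proof -
  have "(\<Sum>\<^sub>Ui j. g i j *\<^sub>R (\<Sum>\<^sub>Uk. \<xi> k i *\<^sub>R h j k))
      = (\<Sum>\<^sub>Ui k j. (g i k * \<xi> j k) *\<^sub>R h i j)"
    by (subst sum.swap) (simp add: scaleR_sum_right g)
  also have "\<dots> = (\<Sum>\<^sub>Ui j k. (g i k * \<xi> j k) *\<^sub>R h i j)"
    by (rule sum.cong[OF refl]) (rule sum.swap)
  finally show ?thesis by (simp add: scaleR_sum_left)
qed

lemma contract_right:
  fixes h :: "'i::finite \<Rightarrow> 'i \<Rightarrow> 'v::real_vector"
  shows "(\<Sum>\<^sub>Ui j. g i j *\<^sub>R (\<Sum>\<^sub>Uk. \<xi> k j *\<^sub>R h i k))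
       = (\<Sum>\<^sub>Ui j. (\<Sum>\<^sub>Uk. g i k * \<xi> j k) *\<^sub>R h i j)"
proof -
  have "(\<Sum>\<^sub>Ui j. g i j *\<^sub>R (\<Sum>\<^sub>Uk. \<xi> k j *\<^sub>R h i k))
      = (\<Sum>\<^sub>Ui k j. (g i k * \<xi> j k) *\<^sub>R h i j)"
    by (simp add: scaleR_sum_right)
  also have "\<dots> = (\<Sum>\<^sub>Ui j k. (g i k * \<xi> j k) *\<^sub>R h i j)"
    by (rule sum.cong[OF refl]) (rule sum.swap)
  finally show ?thesis by (simp add: scaleR_sum_left)
qed

lemma contract_raised:
  fixes g a \<xi> :: "'i::finite \<Rightarrow> 'i \<Rightarrow> real"
  assumes g: "\<And>i j. g i j = g j i" and a: "\<And>i j. a i j = a j i"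
  shows "(\<Sum>\<^sub>Ui j. (\<Sum>\<^sub>Uk. (\<Sum>\<^sub>Um l. g i m * g k l * a m l) * \<xi> j k) * a i j)
       = (\<Sum>\<^sub>Ui j. (\<Sum>\<^sub>Uk. g i k * \<xi> j k) * (\<Sum>\<^sub>Uk l. g k l * a i k * a j l))"
proof -
  have "(\<Sum>\<^sub>Ui j. (\<Sum>\<^sub>Uk. (\<Sum>\<^sub>Um l. g i m * g k l * a m l) * \<xi> j k) * a i j)
     = (\<Sum>(i,j,k,m,l)\<in>UNIV. g i m * g k l * a m l * \<xi> j k * a i j)"
    unfolding sum_distrib_right by (simp only: sum.cartesian_product UNIV_Times_UNIV)
  also have "\<dots> = (\<Sum>(i,j,k,l,m)\<in>UNIV. g i k * \<xi> j k * (g m l * a i m * a j l))"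
    by (rule sum.reindex_bij_witness[of _ "\<lambda>(i,j,k,l,m). (l,j,k,m,i)" "\<lambda>(i,j,k,m,l). (l,j,k,i,m)"])
       (auto simp: g a ac_simps)
  also have "\<dots> = (\<Sum>(i,j,k,m,l)\<in>UNIV. g i k * \<xi> j k * (g m l * a i m * a j l))"
    by (rule sum.reindex_bij_witness[of _ "\<lambda>(i,j,k,l,m). (i,j,k,m,l)" "\<lambda>(i,j,k,l,m). (i,j,k,m,l)"]) auto
  also have "\<dots> = (\<Sum>\<^sub>Ui j. (\<Sum>\<^sub>Uk. g i k * \<xi> j k) * (\<Sum>\<^sub>Uk l. g k l * a i k * a j l))"
    unfolding sum_distrib_right unfolding sum_distrib_left
    by (simp only: sum.cartesian_product UNIV_Times_UNIV)
  finally show ?thesis .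
qed

context patch
begin

abbreviation tangent_field :: "(4 \<Rightarrow> real^4 \<Rightarrow> real) \<Rightarrow> real^4 \<Rightarrow> real^'m" where
  "tangent_field Y \<equiv> (\<lambda>y. \<Sum>\<^sub>Uk. Y k y *\<^sub>R pd k F y)"

context
  fixes Y :: "4 \<Rightarrow> real^4 \<Rightarrow> real"
  assumes Y: "\<And>k. smooth_on U (Y k)"
begin

lemma smooth_tangent_field: "smooth_on U (tangent_field Y)"
  by (intro smooth_intros Y smooth_F)

text \<open>By linearity the coefficients may be shifted to vanish at the point under consideration. There
  the second derivatives of \<open>Y\<close> multiply tangent vectors and are projected away, so only the first
  derivatives survive.\<close>

context
  fixes x assumes x: "x \<in> U" and Y0: "\<And>k. Y k x = 0"
begin

lemma pd_tangent_field_at_zero: "pd i (tangent_field Y) x = (\<Sum>\<^sub>Uk. pd i (Y k) x *\<^sub>R pd k F x)"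
  by (simp add: pd_simps x smooth_intros Y smooth_F Y0)

lemma nproj_hess_tangent_field_at_zero:
  "nproj F x (hess F (tangent_field Y) i j x)
   = (\<Sum>\<^sub>Uk. pd i (Y k) x *\<^sub>R hl F j k x) + (\<Sum>\<^sub>Uk. pd j (Y k) x *\<^sub>R hl F i k x)"
proof -
  have "pd i (pd j (tangent_field Y)) x
     = pd i (\<lambda>y. \<Sum>\<^sub>Uk. pd j (Y k) y *\<^sub>R pd k F y + Y k y *\<^sub>R pd j (pd k F) y) x"
    by (rule pd_cong[OF _ x]) (simp add: pd_simps smooth_intros Y smooth_F)
  then show ?thesis
    by (simp add: hess_def pd_tangent_field_at_zero pd_simps x smooth_intros Y smooth_F Y0 nproj_linear
        hl_eq sum.distrib)
qed

lemma var_gl_tangent_field_at_zero: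
  "var_gl F (tangent_field Y) i j x = (\<Sum>\<^sub>Uk. pd i (Y k) x * gl F k j x) + (\<Sum>\<^sub>Uk. pd j (Y k) x * gl F i k x)"
  by (simp add: var_gl_def pd_tangent_field_at_zero inner_sum_left inner_sum_right gl_eq)

lemma var_gu_tangent_field_at_zero:
  "var_gu F (tangent_field Y) i j x = - (\<Sum>\<^sub>Uk. gu F i k x * pd k (Y j) x) - (\<Sum>\<^sub>Uk. gu F j k x * pd k (Y i) x)"
proof -
  have inv: "(\<Sum>\<^sub>Uq. gl F k q x * gu F q j x) = (if k = j then 1 else 0)" for k j
    using gu_gl[OF x, of j k] by (simp add: gu_commute[OF x, of j] gl_commute[of F k] mult.commute)
  have 1: "(\<Sum>\<^sub>Up q. gu F i p x * (\<Sum>\<^sub>Uk. pd p (Y k) x * gl F k q x) * gu F q j x)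
     = (\<Sum>\<^sub>Uk. gu F i k x * pd k (Y j) x)" for i j
  proof -
    have "(\<Sum>\<^sub>Uq. gu F i p x * (\<Sum>\<^sub>Uk. pd p (Y k) x * gl F k q x) * gu F q j x) = gu F i p x * pd p (Y j) x" for p
    proof -
      have "(\<Sum>\<^sub>Uq. gu F i p x * (\<Sum>\<^sub>Uk. pd p (Y k) x * gl F k q x) * gu F q j x)
        = (\<Sum>\<^sub>Uq k. gu F i p x * pd p (Y k) x * (gl F k q x * gu F q j x))"
        by (simp add: sum_distrib_left sum_distrib_right ac_simps)
      also have "\<dots> = (\<Sum>\<^sub>Uk. gu F i p x * pd p (Y k) x * (\<Sum>\<^sub>Uq. gl F k q x * gu F q j x))"
        by (subst sum.swap) (simp add: sum_distrib_left)
      finally show ?thesis by (simp add: inv if_distrib cong: if_cong)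
    qed
    then show ?thesis by simp
  qed
  have 2: "(\<Sum>\<^sub>Up q. gu F i p x * (\<Sum>\<^sub>Uk. pd q (Y k) x * gl F p k x) * gu F q j x)
     = (\<Sum>\<^sub>Up q. gu F j p x * (\<Sum>\<^sub>Uk. pd p (Y k) x * gl F k q x) * gu F q i x)"
    by (subst sum.swap) (simp add: gu_commute[OF x, of _ j] gu_commute[OF x, of i] gl_commute[of F _ _ x] ac_simps)
  show ?thesis
    unfolding var_gu_def var_gl_tangent_field_at_zero distrib_left distrib_right sum.distrib 1 2 by simp
qed

lemma var_vol_tangent_field_at_zero:
  "var_vol F (tangent_field Y) x = vol_density F x * (\<Sum>\<^sub>Uk. pd k (Y k) x)"
proof -
  have 1: "(\<Sum>\<^sub>Ui j. gu F i j x * (\<Sum>\<^sub>Uk. pd i (Y k) x * gl F k j x)) = (\<Sum>\<^sub>Uk. pd k (Y k) x)"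
  proof -
    have "(\<Sum>\<^sub>Uj. gu F i j x * (\<Sum>\<^sub>Uk. pd i (Y k) x * gl F k j x))
        = (\<Sum>\<^sub>Uk. pd i (Y k) x * (\<Sum>\<^sub>Uj. gu F i j x * gl F j k x))" for i
      unfolding sum_distrib_left
      by (subst sum.swap) (intro sum.cong refl, simp add: gl_commute[of F _ _ x])
    then show ?thesis by (simp add: gu_gl[OF x] if_distrib cong: if_cong)
  qed
  have "(\<Sum>\<^sub>Ui j. gu F i j x * (\<Sum>\<^sub>Uk. pd j (Y k) x * gl F i k x))
      = (\<Sum>\<^sub>Ui j. gu F i j x * (\<Sum>\<^sub>Uk. pd i (Y k) x * gl F k j x))"
    by (subst sum.swap) (simp add: gu_commute[OF x] gl_commute[of F _ _ x])
  then show ?thesis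
    by (simp add: var_vol_def var_gl_tangent_field_at_zero distrib_left sum.distrib 1)
qed

lemma var_H_tangent_field_at_zero: "var_H F (tangent_field Y) x = 0"
proof -
  let ?G = "\<lambda>i j. \<Sum>\<^sub>Uk. gu F i k x * pd k (Y j) x"
  have g: "gu F i j x = gu F j i x" for i j by (rule gu_commute[OF x])
  have "(\<Sum>\<^sub>Ui j. ?G j i *\<^sub>R hl F i j x) = (\<Sum>\<^sub>Ui j. ?G i j *\<^sub>R hl F i j x)"
    by (subst sum.swap) (simp add: hl_commute[OF x])
  then show ?thesis
    by (simp add: var_H_def var_gu_tangent_field_at_zero nproj_hess_tangent_field_at_zero
        scaleR_left_diff_distrib scaleR_right_distrib sum.distrib sum_subtractf sum_negf contract_right
        contract_left[of "\<lambda>i j. gu F i j x", OF g])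
qed

end

end

text \<open>Unlike the previous lemmas this holds at every point, which is what the derivative of
  \<open>var_H\<close> in \<open>var_pnablaH\<close> requires.\<close>

lemma var_H_tangent_field:
  assumes Y: "\<And>k. smooth_on U (Y k)" and x: "x \<in> U"
  shows "var_H F (tangent_field Y) x = (\<Sum>\<^sub>Uk. Y k x *\<^sub>R pnabla F (H F) k x)"
proof -
  let ?Z = "\<lambda>k y. Y k y - Y k x"
  have Z: "smooth_on U (?Z k)" for k by (intro smooth_intros Y)
  have "tangent_field Y = (\<lambda>y. 1 *\<^sub>R (\<Sum>\<^sub>Uk. Y k x *\<^sub>R pd k F y) + (\<Sum>\<^sub>Uk. ?Z k y *\<^sub>R pd k F y))"
    by (simp add: fun_eq_iff scaleR_left_diff_distrib sum_subtractf)
  then have "var_H F (tangent_field Y) x = var_H F (\<lambda>y. \<Sum>\<^sub>Uk. Y k x *\<^sub>R pd k F y) x"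
    using var_H_lincomb[OF refl _ _ x, of "\<lambda>y. \<Sum>\<^sub>Uk. Y k x *\<^sub>R pd k F y" "\<lambda>y. \<Sum>\<^sub>Uk. ?Z k y *\<^sub>R pd k F y" 1]
      var_H_tangent_field_at_zero[OF Z x]
    by (simp add: smooth_intros Z smooth_F)
  also have "\<dots> = (\<Sum>\<^sub>Uk. Y k x *\<^sub>R pnabla F (H F) k x)"
    by (subst var_H_sum[OF x]) (simp_all add: smooth_F translation_variation[OF x])
  finally show ?thesis .
qed

lemma var_density_tangent_field_at_zero:
  assumes Y: "\<And>k. smooth_on U (Y k)" and x: "x \<in> U" and Y0: "\<And>k. Y k x = 0"
  shows "var_density F (tangent_field Y) x = energy_density F x * vol_density F x * (\<Sum>\<^sub>Uk. pd k (Y k) x)"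
proof -
  let ?P = "\<lambda>i. pnabla F (H F) i x" and ?g = "\<lambda>i j. gu F i j x" and ?a = "\<lambda>i j. H F x \<bullet> hl F i j x"
  let ?\<xi> = "\<lambda>k i. pd i (Y k) x"
  let ?G = "\<lambda>i j. \<Sum>\<^sub>Uk. ?g i k * ?\<xi> j k"
  let ?aa = "\<lambda>i j. \<Sum>\<^sub>Uk l. ?g k l * ?a i k * ?a j l"
  let ?Q = "\<lambda>i j. ?P i \<bullet> ?P j - 2 * ?aa i j"
  have g: "?g i j = ?g j i" for i j by (rule gu_commute[OF x])
  have a: "?a i j = ?a j i" for i j by (simp add: hl_commute[OF x, of i])
  have aa: "?aa i j = ?aa j i" for i j by (subst sum.swap) (simp add: g ac_simps)
  have pdH: "nproj F x (pd i (var_H F (tangent_field Y)) x) = (\<Sum>\<^sub>Uk. ?\<xi> k i *\<^sub>R ?P k)" for i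
  proof -
    have "pd i (var_H F (tangent_field Y)) x = pd i (\<lambda>y. \<Sum>\<^sub>Uk. Y k y *\<^sub>R pnabla F (H F) k y) x"
      by (rule pd_cong[OF var_H_tangent_field[OF Y] x])
    also have "\<dots> = (\<Sum>\<^sub>Uk. ?\<xi> k i *\<^sub>R ?P k)"
      by (simp add: pd_simps x smooth_intros Y smooth_geometry Y0)
    finally show ?thesis by (simp add: nproj_linear nproj_id[OF normal_pnabla[OF x]])
  qed
  have M: "var_pnablaH F (tangent_field Y) i x = (\<Sum>\<^sub>Uk. ?\<xi> k i *\<^sub>R ?P k)" for i
    by (simp add: var_pnablaH_def pdH pd_tangent_field_at_zero[OF Y x Y0] nproj_linear nproj_pd[OF x]
        inner_sum_right normal_at_pd[OF normal_H[OF x]])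
  have b: "H F x \<bullet> hess F (tangent_field Y) i j x = (\<Sum>\<^sub>Uk. ?\<xi> k i * ?a j k) + (\<Sum>\<^sub>Uk. ?\<xi> k j * ?a i k)" for i j
    using nproj_inner_normal(2)[OF normal_H[OF x], of "hess F (tangent_field Y) i j x"]
    by (simp add: nproj_hess_tangent_field_at_zero[OF Y x Y0] inner_sum_right inner_add_right)
  \<comment> \<open>the three groups of terms of the energy variation, all as contractions with \<open>?G\<close>\<close>
  have T1: "(\<Sum>\<^sub>Ui j. var_gu F (tangent_field Y) i j x * ?Q i j) = - 2 * (\<Sum>\<^sub>Ui j. ?G i j * ?Q i j)"
  proof -
    have "(\<Sum>\<^sub>Ui j. ?G j i * ?Q i j) = (\<Sum>\<^sub>Ui j. ?G i j * ?Q i j)"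
      by (subst sum.swap) (simp only: aa inner_commute)
    then show ?thesis
      unfolding var_gu_tangent_field_at_zero[OF Y x Y0] left_diff_distrib sum_subtractf mult_minus_left sum_negf
      by simp
  qed
  have T2: "(\<Sum>\<^sub>Ui j. ?g i j * (?P j \<bullet> var_pnablaH F (tangent_field Y) i x))
      = (\<Sum>\<^sub>Ui j. ?G i j * (?P i \<bullet> ?P j))"
    using contract_left[of ?g ?\<xi> "\<lambda>i j. ?P i \<bullet> ?P j", OF g] by (simp add: M inner_sum_right)
  have T3: "(\<Sum>\<^sub>Ui j. (H F x \<bullet> hu F i j x) * (H F x \<bullet> hess F (tangent_field Y) i j x))
      = 2 * (\<Sum>\<^sub>Ui j. ?G i j * ?aa i j)"
  proof -
    let ?u = "\<lambda>i j. H F x \<bullet> hu F i j x"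
    have u: "?u i j = ?u j i" for i j by (simp add: hu_commute[OF x, of i])
    have ueq: "?u i j = (\<Sum>\<^sub>Um l. ?g i m * ?g j l * ?a m l)" for i j
      by (simp add: hu_eq inner_sum_right)
    have "(\<Sum>\<^sub>Ui j. (\<Sum>\<^sub>Uk. ?u i k * ?\<xi> j k) * ?a i j) = (\<Sum>\<^sub>Ui j. ?G i j * ?aa i j)"
      unfolding ueq by (rule contract_raised[OF g a])
    moreover have "(\<Sum>\<^sub>Ui j. ?u i j * (\<Sum>\<^sub>Uk. ?\<xi> k i * ?a j k)) = (\<Sum>\<^sub>Ui j. (\<Sum>\<^sub>Uk. ?u i k * ?\<xi> j k) * ?a i j)"
      using contract_left[of ?u ?\<xi> ?a, OF u] by simp
    moreover have "(\<Sum>\<^sub>Ui j. ?u i j * (\<Sum>\<^sub>Uk. ?\<xi> k j * ?a i k)) = (\<Sum>\<^sub>Ui j. (\<Sum>\<^sub>Uk. ?u i k * ?\<xi> j k) * ?a i j)"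
      using contract_right[of ?u ?\<xi> ?a] by simp
    ultimately show ?thesis by (simp only: b distrib_left sum.distrib)
  qed
  have "(\<Sum>\<^sub>Ui j. ?G i j * ?Q i j)
      = (\<Sum>\<^sub>Ui j. ?G i j * (?P i \<bullet> ?P j)) - 2 * (\<Sum>\<^sub>Ui j. ?G i j * ?aa i j)"
    by (simp only: right_diff_distrib sum_subtractf sum_distrib_left mult.left_commute[of _ 2])
  then have "var_energy_density F (tangent_field Y) x = 0"
    unfolding var_energy_density_def var_H_tangent_field_at_zero[OF Y x Y0] inner_zero_left inner_zero_right add_0 T1 T2 T3
    by simp
  then show ?thesis by (simp add: var_density_def var_vol_tangent_field_at_zero[OF Y x Y0])
qed

text \<open>Invariance under reparametrisation: the constant part of the coefficients contributes by the
  chain rule, the part vanishing at the point by the preceding lemma, and the product rule joins the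
  two.\<close>

lemma var_density_tangent_field:
  assumes Y: "\<And>k. smooth_on U (Y k)" and x: "x \<in> U"
  shows "var_density F (tangent_field Y) x
       = (\<Sum>\<^sub>Uk. pd k (\<lambda>y. Y k y * (energy_density F y * vol_density F y)) x)"
proof -
  let ?Z = "\<lambda>k y. Y k y - Y k x"
  let ?L = "\<lambda>y. energy_density F y * vol_density F y"
  have Z: "smooth_on U (?Z k)" for k by (intro smooth_intros Y)
  have pdZ: "pd k (?Z j) x = pd k (Y j) x" for k j by (simp add: pd_simps x Y smooth_on_const)
  have L: "smooth_on U ?L" by (intro smooth_intros smooth_geometry)
  have "tangent_field Y = (\<lambda>y. (\<Sum>\<^sub>Uk. Y k x *\<^sub>R pd k F y) + (\<Sum>\<^sub>Uk. ?Z k y *\<^sub>R pd k F y))"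
    by (simp add: fun_eq_iff scaleR_left_diff_distrib sum_subtractf)
  then have "var_density F (tangent_field Y) x
     = var_density F (\<lambda>y. \<Sum>\<^sub>Uk. Y k x *\<^sub>R pd k F y) x + var_density F (\<lambda>y. \<Sum>\<^sub>Uk. ?Z k y *\<^sub>R pd k F y) x"
    using var_density_add[OF x, of "\<lambda>y. \<Sum>\<^sub>Uk. Y k x *\<^sub>R pd k F y" "\<lambda>y. \<Sum>\<^sub>Uk. ?Z k y *\<^sub>R pd k F y"]
    by (simp add: smooth_intros Z smooth_F)
  also have "var_density F (\<lambda>y. \<Sum>\<^sub>Uk. Y k x *\<^sub>R pd k F y) x = (\<Sum>\<^sub>Uk. Y k x * pd k ?L x)"
    by (subst var_density_sum[OF x]) (simp_all add: smooth_F translation_variation[OF x])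
  also have "var_density F (\<lambda>y. \<Sum>\<^sub>Uk. ?Z k y *\<^sub>R pd k F y) x = ?L x * (\<Sum>\<^sub>Uk. pd k (Y k) x)"
    using var_density_tangent_field_at_zero[OF Z x] by (simp add: pdZ)
  finally have "var_density F (tangent_field Y) x
     = (\<Sum>\<^sub>Uk. Y k x * pd k ?L x) + ?L x * (\<Sum>\<^sub>Uk. pd k (Y k) x)" .
  moreover have "pd k (\<lambda>y. Y k y * ?L y) x = pd k (Y k) x * ?L x + Y k x * pd k ?L x" for k
    by (rule pd_mult[OF x Y L])
  ultimately show ?thesis
    by (simp only: sum.distrib sum_distrib_left mult.commute[of "?L x"] add.commute)
qed

end


section \<open>Divergences\<close>

context patch
begin

lemma christoffel_eq_sum:
  "x \<in> U \<Longrightarrow> christoffel F k i j x = (\<Sum>\<^sub>Ul. gu F k l x * (pd i (pd j F) x \<bullet> pd l F x))"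
  by (subst christoffel_eq, assumption) (simp add: dual_frame_def inner_sum_left inner_commute[of "pd _ F x"])

text \<open>The next two formulas are \<open>var_vol\<close> and \<open>var_gu\<close> for the translation along the \<open>k\<close>-th axis.\<close>

lemma pd_vol_density:
  assumes x: "x \<in> U"
  shows "pd k (vol_density F) x = vol_density F x * (\<Sum>\<^sub>Uj. christoffel F j j k x)"
proof -
  have "(\<Sum>\<^sub>Ui j. gu F i j x * (pd i F x \<bullet> pd j (pd k F) x))
      = (\<Sum>\<^sub>Ui j. gu F i j x * (pd i (pd k F) x \<bullet> pd j F x))"
    by (subst sum.swap) (simp add: gu_commute[OF x] inner_commute)
  moreover have "(\<Sum>\<^sub>Ui j. gu F i j x * (pd i (pd k F) x \<bullet> pd j F x)) = (\<Sum>\<^sub>Uj. christoffel F j j k x)"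
    by (simp add: christoffel_eq_sum[OF x])
  ultimately have "var_vol F (pd k F) x = vol_density F x * (\<Sum>\<^sub>Uj. christoffel F j j k x)"
    by (simp add: var_vol_def var_gl_def distrib_left sum.distrib)
  then show ?thesis by (simp add: translation_variation[OF x])
qed

lemma pd_gu:
  assumes x: "x \<in> U"
  shows "pd k (gu F i j) x = - (\<Sum>\<^sub>Up. gu F i p x * christoffel F j k p x) - (\<Sum>\<^sub>Up. gu F j p x * christoffel F i k p x)"
proof -
  have 1: "(\<Sum>\<^sub>Up q. gu F i p x * (pd p (pd k F) x \<bullet> pd q F x) * gu F q j x)
      = (\<Sum>\<^sub>Up. gu F i p x * christoffel F j k p x)" for i j
    by (simp add: christoffel_eq_sum[OF x] sum_distrib_left
        pd_commute[OF x smooth_F, of k] gu_commute[OF x, of _ j] ac_simps)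
  have 2: "(\<Sum>\<^sub>Up q. gu F i p x * (pd p F x \<bullet> pd q (pd k F) x) * gu F q j x)
      = (\<Sum>\<^sub>Up q. gu F j p x * (pd p (pd k F) x \<bullet> pd q F x) * gu F q i x)"
    by (subst sum.swap) (simp add: gu_commute[OF x, of _ j] gu_commute[OF x, of i] inner_commute ac_simps)
  have "var_gu F (pd k F) i j x = - (\<Sum>\<^sub>Up. gu F i p x * christoffel F j k p x) - (\<Sum>\<^sub>Up. gu F j p x * christoffel F i k p x)"
    unfolding var_gu_def var_gl_def distrib_left distrib_right sum.distrib 1 2 by simp
  then show ?thesis by (simp add: translation_variation[OF x])
qed

lemma vol_times_div_vec:
  assumes x: "x \<in> U" and Y: "\<And>j. smooth_on U (Y j)"
  shows "vol_density F x *\<^sub>R div_vec F Y x = (\<Sum>\<^sub>Uj. pd j (\<lambda>y. vol_density F y *\<^sub>R Y j y) x)"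
proof -
  have "(\<Sum>\<^sub>Uj k. christoffel F j j k x *\<^sub>R Y k x) = (\<Sum>\<^sub>Uk. (\<Sum>\<^sub>Uj. christoffel F j j k x) *\<^sub>R Y k x)"
    by (subst sum.swap) (simp add: scaleR_sum_left)
  then show ?thesis
    by (simp add: div_vec_def nabla_vec_def pd_simps x Y smooth_geometry pd_vol_density sum.distrib
        scaleR_sum_right scaleR_add_right add.commute)
qed

lemma vol_times_div_ten:
  assumes x: "x \<in> U" and T: "\<And>i j. smooth_on U (T i j)"
  shows "vol_density F x *\<^sub>R div_ten F T i x = (\<Sum>\<^sub>Uk. pd k (\<lambda>y. vol_density F y *\<^sub>R T i k y) x)
    + vol_density F x *\<^sub>R (\<Sum>\<^sub>Uk l. christoffel F i k l x *\<^sub>R T l k x)"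
proof -
  have "div_ten F T i x = div_vec F (T i) x + (\<Sum>\<^sub>Uk l. christoffel F i k l x *\<^sub>R T l k x)"
    by (simp add: div_ten_def nabla_ten_def div_vec_def nabla_vec_def sum.distrib)
  then show ?thesis by (simp add: vol_times_div_vec[OF x T] scaleR_add_right)
qed

text \<open>The trace of \<open>\<nabla> \<omega>\<close> is the divergence of the raised field; the derivatives of the inverse
  metric account for the change of sign of the Christoffel terms.\<close>

lemma vol_times_trace_nabla_covec:
  assumes x: "x \<in> U" and \<omega>: "\<And>j. smooth_on U (\<omega> j)"
  shows "vol_density F x *\<^sub>R (\<Sum>\<^sub>Uj k. gu F j k x *\<^sub>R nabla_covec F \<omega> k j x)
    = (\<Sum>\<^sub>Uk. pd k (\<lambda>y. vol_density F y *\<^sub>R (\<Sum>\<^sub>Uj. gu F k j y *\<^sub>R \<omega> j y)) x)"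
proof -
  let ?\<Gamma> = "\<lambda>k i j. christoffel F k i j x"
  let ?Y = "\<lambda>k y. \<Sum>\<^sub>Uj. gu F k j y *\<^sub>R \<omega> j y"
  have 1: "pd k (?Y k) x = (\<Sum>\<^sub>Uj. gu F k j x *\<^sub>R pd k (\<omega> j) x)
      - (\<Sum>\<^sub>Uj p. (gu F k p x * ?\<Gamma> j k p) *\<^sub>R \<omega> j x)
      - (\<Sum>\<^sub>Uj p. (gu F j p x * ?\<Gamma> k k p) *\<^sub>R \<omega> j x)" for k
    by (simp add: pd_simps x \<omega> smooth_geometry smooth_intros pd_gu sum.distrib sum_subtractf sum_negf
        scaleR_left_diff_distrib scaleR_sum_left algebra_simps)
  have "(\<Sum>\<^sub>Uk p. ?\<Gamma> k k p *\<^sub>R ?Y p x) = (\<Sum>\<^sub>Uk p j. (gu F j p x * ?\<Gamma> k k p) *\<^sub>R \<omega> j x)"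
    by (simp add: scaleR_sum_right gu_commute[OF x] ac_simps)
  also have "\<dots> = (\<Sum>\<^sub>Uk j p. (gu F j p x * ?\<Gamma> k k p) *\<^sub>R \<omega> j x)"
    by (rule sum.cong[OF refl]) (rule sum.swap)
  finally have 2: "div_vec F ?Y x = (\<Sum>\<^sub>Uk j. gu F k j x *\<^sub>R pd k (\<omega> j) x)
     - (\<Sum>\<^sub>Uk j p. (gu F k p x * ?\<Gamma> j k p) *\<^sub>R \<omega> j x)"
    by (simp add: div_vec_def nabla_vec_def 1 sum.distrib sum_subtractf)
  have "(\<Sum>\<^sub>Uj k. gu F j k x *\<^sub>R nabla_covec F \<omega> k j x)
      = (\<Sum>\<^sub>Uj k. gu F j k x *\<^sub>R pd k (\<omega> j) x)
      - (\<Sum>\<^sub>Uj k p. (gu F j k x * ?\<Gamma> p k j) *\<^sub>R \<omega> p x)"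
    by (simp add: nabla_covec_def scaleR_right_diff_distrib sum_subtractf scaleR_sum_right)
  also have "(\<Sum>\<^sub>Uj k. gu F j k x *\<^sub>R pd k (\<omega> j) x) = (\<Sum>\<^sub>Uk j. gu F k j x *\<^sub>R pd k (\<omega> j) x)"
    by (subst sum.swap) (simp add: gu_commute[OF x])
  also have "(\<Sum>\<^sub>Uj k p. (gu F j k x * ?\<Gamma> p k j) *\<^sub>R \<omega> p x)
     = (\<Sum>\<^sub>Uk p j. (gu F k j x * ?\<Gamma> p k j) *\<^sub>R \<omega> p x)"
    by (subst sum.swap, rule sum.cong[OF refl], subst sum.swap) (simp add: gu_commute[OF x])
  finally have "(\<Sum>\<^sub>Uj k. gu F j k x *\<^sub>R nabla_covec F \<omega> k j x) = div_vec F ?Y x"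
    by (simp add: 2)
  then show ?thesis
    using vol_times_div_vec[OF x, of ?Y] by (simp add: smooth_intros smooth_geometry \<omega>)
qed

lemma vol_times_normal_laplacian_inner:
  assumes x: "x \<in> U" and X: "smooth_on U X" and n: "normal_at F x n"
  shows "vol_density F x * (n \<bullet> normal_laplacian F X x)
    = (\<Sum>\<^sub>Uk. n \<bullet> pd k (\<lambda>y. vol_density F y *\<^sub>R (\<Sum>\<^sub>Uj. gu F k j y *\<^sub>R pnabla F X j y)) x)"
proof -
  have "n \<bullet> normal_laplacian F X x = n \<bullet> (\<Sum>\<^sub>Uj k. gu F j k x *\<^sub>R nabla_covec F (pnabla F X) k j x)"
    by (simp only: normal_laplacian_def inner_sum_right nproj_inner_normal[OF n])
  then show ?thesis
    using arg_cong[OF vol_times_trace_nabla_covec[OF x, of "pnabla F X"], of "\<lambda>v. n \<bullet> v"]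
    by (simp add: smooth_geometry X inner_sum_right)
qed

end

text \<open>Such functions integrate to zero over a compact \<open>K\<close>, so integrating by parts amounts to
  computing modulo them, pointwise and without integrals.\<close>

definition (in chart_domain) divergence_form :: "(real^4) set \<Rightarrow> (real^4 \<Rightarrow> real) \<Rightarrow> bool" where
  "divergence_form K f \<longleftrightarrow> (\<exists>V. (\<forall>i. smooth_on U (V i)) \<and> (\<forall>i. \<forall>x\<in>U - K. V i x = 0)
     \<and> (\<forall>x\<in>U. f x = (\<Sum>\<^sub>Ui. pd i (V i) x)))"

context chart_domain
begin

lemma divergence_formI:
  assumes "\<And>i. smooth_on U (V i)" "\<And>i x. x \<in> U \<Longrightarrow> x \<notin> K \<Longrightarrow> V i x = 0"
    "\<And>x. x \<in> U \<Longrightarrow> f x = (\<Sum>\<^sub>Ui. pd i (V i) x)"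
  shows "divergence_form K f"
  unfolding divergence_form_def using assms by blast

lemma divergence_formE:
  assumes "divergence_form K f"
  obtains V where "\<And>i. smooth_on U (V i)" "\<And>i x. x \<in> U \<Longrightarrow> x \<notin> K \<Longrightarrow> V i x = 0"
    "\<And>x. x \<in> U \<Longrightarrow> f x = (\<Sum>\<^sub>Ui. pd i (V i) x)"
  using assms unfolding divergence_form_def by blast

lemma divergence_form_cong:
  assumes "\<And>x. x \<in> U \<Longrightarrow> f x = g x" "divergence_form K g"
  shows "divergence_form K f"
  using assms(2) by (rule divergence_formE) (rule divergence_formI, auto simp: assms(1))

lemma divergence_form_add:
  assumes "divergence_form K f" "divergence_form K g"
  shows "divergence_form K (\<lambda>x. f x + g x)"
proof -
  obtain V where V: "\<And>i. smooth_on U (V i)" "\<And>i x. x \<in> U \<Longrightarrow> x \<notin> K \<Longrightarrow> V i x = 0"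
      "\<And>x. x \<in> U \<Longrightarrow> f x = (\<Sum>\<^sub>Ui. pd i (V i) x)"
    using assms(1) by (rule divergence_formE) blast
  obtain V' where V': "\<And>i. smooth_on U (V' i)" "\<And>i x. x \<in> U \<Longrightarrow> x \<notin> K \<Longrightarrow> V' i x = 0"
      "\<And>x. x \<in> U \<Longrightarrow> g x = (\<Sum>\<^sub>Ui. pd i (V' i) x)"
    using assms(2) by (rule divergence_formE) blast
  show ?thesis
    by (rule divergence_formI[where V = "\<lambda>i x. V i x + V' i x"])
       (simp_all add: V V' smooth_intros pd_simps sum.distrib)
qed

lemma divergence_form_cmult:
  assumes "divergence_form K f"
  shows "divergence_form K (\<lambda>x. c * f x)"
proof -
  obtain V where V: "\<And>i. smooth_on U (V i)" "\<And>i x. x \<in> U \<Longrightarrow> x \<notin> K \<Longrightarrow> V i x = 0"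
      "\<And>x. x \<in> U \<Longrightarrow> f x = (\<Sum>\<^sub>Ui. pd i (V i) x)"
    using assms by (rule divergence_formE) blast
  show ?thesis
    by (rule divergence_formI[where V = "\<lambda>i x. c * V i x"])
       (simp_all add: V smooth_intros pd_simps sum_distrib_left)
qed

lemma pd_zero_off_closed:
  assumes "closed K" "\<And>x. x \<in> U \<Longrightarrow> x \<notin> K \<Longrightarrow> f x = 0" "x \<in> U" "x \<notin> K"
  shows "pd i f x = 0"
proof -
  interpret off: chart_domain "U - K" by unfold_locales (use assms in \<open>simp add: open_Diff\<close>)
  have "pd i f x = pd i (\<lambda>y. 0) x" by (rule off.pd_cong) (use assms in auto)
  then show ?thesis by simp
qed

end

context patch
begin

context
  fixes K :: "(real^4) set"
  assumes K: "closed K"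
begin

text \<open>Green's formula. The field is \<open>\<mu> (Z \<bullet> \<nabla>\<^sup>k X - X \<bullet> \<nabla>\<^sup>k Z)\<close>; in its divergence the products of
  first derivatives cancel by symmetry of the metric.\<close>

lemma green:
  assumes X: "smooth_on U X" "\<And>x. x \<in> U \<Longrightarrow> normal_at F x (X x)"
    and Z: "smooth_on U Z" "\<And>x. x \<in> U \<Longrightarrow> normal_at F x (Z x)" "\<And>x. x \<in> U \<Longrightarrow> x \<notin> K \<Longrightarrow> Z x = 0"
  shows "divergence_form K (\<lambda>x. vol_density F x * (Z x \<bullet> normal_laplacian F X x - X x \<bullet> normal_laplacian F Z x))"
proof (rule divergence_formI)
  let ?A = "\<lambda>X k y. vol_density F y *\<^sub>R (\<Sum>\<^sub>Uj. gu F k j y *\<^sub>R pnabla F X j y)"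
  let ?V = "\<lambda>k y. Z y \<bullet> ?A X k y - X y \<bullet> ?A Z k y"
  have A: "smooth_on U (?A X k)" if "smooth_on U X" for X k
    by (intro smooth_intros smooth_geometry that)
  show "smooth_on U (?V k)" for k
    by (intro smooth_intros smooth_geometry X Z)
  show "?V k x = 0" if "x \<in> U" "x \<notin> K" for k x
    using pd_zero_off_closed[OF K Z(3) that] Z(3)[OF that] by (simp add: pnabla_def)
  fix x assume x: "x \<in> U"
  have cross: "pd k Z x \<bullet> ?A X k x = vol_density F x * (\<Sum>\<^sub>Uj. gu F k j x * (pnabla F Z k x \<bullet> pnabla F X j x))"
    for X Z :: "real^4 \<Rightarrow> real^'m" and k
  proof -
    have "pd k Z x \<bullet> pnabla F X j x = pnabla F Z k x \<bullet> pnabla F X j x" for j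
      unfolding pnabla_def[of F Z] by (simp add: nproj_inner_normal normal_pnabla[OF x])
    then show ?thesis by (simp add: inner_sum_right)
  qed
  have sym: "(\<Sum>\<^sub>Uk j. gu F k j x * (pnabla F Z k x \<bullet> pnabla F X j x))
     = (\<Sum>\<^sub>Uk j. gu F k j x * (pnabla F X k x \<bullet> pnabla F Z j x))"
    by (subst sum.swap) (simp add: gu_commute[OF x] inner_commute)
  have "(\<Sum>\<^sub>Uk. pd k (?V k) x)
     = (\<Sum>\<^sub>Uk. pd k Z x \<bullet> ?A X k x) + (\<Sum>\<^sub>Uk. Z x \<bullet> pd k (?A X k) x)
     - ((\<Sum>\<^sub>Uk. pd k X x \<bullet> ?A Z k x) + (\<Sum>\<^sub>Uk. X x \<bullet> pd k (?A Z k) x))"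
    by (simp only: pd_diff[OF x smooth_on_inner[OF open_U Z(1) A[OF X(1)]] smooth_on_inner[OF open_U X(1) A[OF Z(1)]]]
        pd_inner[OF x Z(1) A[OF X(1)]] pd_inner[OF x X(1) A[OF Z(1)]] sum.distrib sum_subtractf)
  then show "vol_density F x * (Z x \<bullet> normal_laplacian F X x - X x \<bullet> normal_laplacian F Z x)
     = (\<Sum>\<^sub>Uk. pd k (?V k) x)"
    by (simp only: right_diff_distrib vol_times_normal_laplacian_inner[OF x X(1) Z(2)[OF x]]
        vol_times_normal_laplacian_inner[OF x Z(1) X(2)[OF x]] cross sum_distrib_left[symmetric] sym)
qed

lemma integrate_gradient_by_parts:
  assumes X: "smooth_on U X"
    and Z: "smooth_on U Z" "\<And>x. x \<in> U \<Longrightarrow> normal_at F x (Z x)" "\<And>x. x \<in> U \<Longrightarrow> x \<notin> K \<Longrightarrow> Z x = 0"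
  shows "divergence_form K (\<lambda>x. vol_density F x *
    ((\<Sum>\<^sub>Ui j. gu F i j x * (pnabla F X j x \<bullet> pd i Z x)) + normal_laplacian F X x \<bullet> Z x))"
proof (rule divergence_formI)
  let ?A = "\<lambda>k y. vol_density F y *\<^sub>R (\<Sum>\<^sub>Uj. gu F k j y *\<^sub>R pnabla F X j y)"
  have A: "smooth_on U (?A k)" for k by (intro smooth_intros smooth_geometry X)
  show "smooth_on U (\<lambda>y. Z y \<bullet> ?A k y)" for k by (intro smooth_intros A Z)
  show "Z x \<bullet> ?A k x = 0" if "x \<in> U" "x \<notin> K" for k x using Z(3)[OF that] by simp
  fix x assume x: "x \<in> U"
  have "(\<Sum>\<^sub>Uk. pd k (\<lambda>y. Z y \<bullet> ?A k y) x) = (\<Sum>\<^sub>Uk. pd k Z x \<bullet> ?A k x) + vol_density F x * (Z x \<bullet> normal_laplacian F X x)"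
    by (simp only: pd_inner[OF x Z(1) A] sum.distrib vol_times_normal_laplacian_inner[OF x X Z(2)[OF x]])
  then show "vol_density F x *
    ((\<Sum>\<^sub>Ui j. gu F i j x * (pnabla F X j x \<bullet> pd i Z x)) + normal_laplacian F X x \<bullet> Z x)
    = (\<Sum>\<^sub>Uk. pd k (\<lambda>y. Z y \<bullet> ?A k y) x)"
    by (simp add: inner_sum_right sum_distrib_left distrib_left inner_commute)
qed

context
  fixes w :: "real^4 \<Rightarrow> real^'m"
  assumes w: "smooth_on U w" and w0: "\<And>x. x \<in> U \<Longrightarrow> x \<notin> K \<Longrightarrow> w x = 0"
begin

lemma integrate_div_vec_by_parts:
  assumes Y: "\<And>k. smooth_on U (Y k)"
  shows "divergence_form K (\<lambda>x. vol_density F x * ((\<Sum>\<^sub>Uk. Y k x \<bullet> pd k w x) + w x \<bullet> div_vec F Y x))"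
proof (rule divergence_formI)
  let ?A = "\<lambda>k y. vol_density F y *\<^sub>R Y k y"
  have A: "smooth_on U (?A k)" for k by (intro smooth_intros smooth_geometry Y)
  show "smooth_on U (\<lambda>y. w y \<bullet> ?A k y)" for k by (intro smooth_intros A w)
  show "w x \<bullet> ?A k x = 0" if "x \<in> U" "x \<notin> K" for k x using w0[OF that] by simp
  fix x assume x: "x \<in> U"
  have "vol_density F x * (w x \<bullet> div_vec F Y x) = (\<Sum>\<^sub>Uk. w x \<bullet> pd k (?A k) x)"
    using arg_cong[OF vol_times_div_vec[OF x Y], of "\<lambda>v. w x \<bullet> v"] by (simp add: inner_sum_right)
  then have "(\<Sum>\<^sub>Uk. pd k (\<lambda>y. w y \<bullet> ?A k y) x) = (\<Sum>\<^sub>Uk. pd k w x \<bullet> ?A k x) + vol_density F x * (w x \<bullet> div_vec F Y x)"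
    by (simp only: pd_inner[OF x w A] sum.distrib)
  then show "vol_density F x * ((\<Sum>\<^sub>Uk. Y k x \<bullet> pd k w x) + w x \<bullet> div_vec F Y x) = (\<Sum>\<^sub>Uk. pd k (\<lambda>y. w y \<bullet> ?A k y) x)"
    by (simp add: distrib_left sum_distrib_left inner_commute)
qed

text \<open>The Christoffel term in \<open>\<nabla>\<nabla> w\<close> is absorbed by the one that relates \<^const>\<open>div_ten\<close> to a
  coordinate divergence. The field \<open>?V\<close> below is \<open>\<mu> (T\<^sup>i\<^sup>j \<bullet> \<partial>\<^sub>i w - \<nabla>\<^sub>i T\<^sup>j\<^sup>i \<bullet> w)\<close>.\<close>

lemma integrate_hess_by_parts:
  assumes T: "\<And>i j. smooth_on U (T i j)"
  shows "divergence_form K (\<lambda>x. vol_density F x *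
    ((\<Sum>\<^sub>Ui j. T i j x \<bullet> hess F w i j x) - w x \<bullet> div_vec F (div_ten F T) x))"
proof (rule divergence_formI)
  let ?A = "\<lambda>i j y. vol_density F y *\<^sub>R T i j y"
  let ?E = "\<lambda>i y. vol_density F y *\<^sub>R div_ten F T i y"
  let ?V = "\<lambda>j y. (\<Sum>\<^sub>Ui. ?A i j y \<bullet> pd i w y) - ?E j y \<bullet> w y"
  have A: "smooth_on U (?A i j)" for i j by (intro smooth_intros smooth_geometry T)
  have E: "smooth_on U (?E i)" for i by (intro smooth_intros smooth_geometry T)
  show "smooth_on U (?V j)" for j by (intro smooth_intros A E w)
  show "?V j x = 0" if "x \<in> U" "x \<notin> K" for j x
    using pd_zero_off_closed[OF K w0 that] w0[OF that] by simp
  fix x assume x: "x \<in> U"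
  let ?\<Gamma> = "\<lambda>k i j. christoffel F k i j x"
  have pdV: "pd j (?V j) x = (\<Sum>\<^sub>Ui. pd j (?A i j) x \<bullet> pd i w x + ?A i j x \<bullet> pd j (pd i w) x)
     - (pd j (?E j) x \<bullet> w x + ?E j x \<bullet> pd j w x)" for j
  proof -
    have "smooth_on U (\<lambda>y. ?A i j y \<bullet> pd i w y)" for i by (intro smooth_intros A w)
    then show ?thesis
      by (simp only: pd_diff[OF x smooth_on_sum[OF open_U] smooth_on_inner[OF open_U E w]]
          pd_sum[OF x] pd_inner[OF x A smooth_pd[OF w]] pd_inner[OF x E w])
  qed
  have E1: "w x \<bullet> (vol_density F x *\<^sub>R div_vec F (div_ten F T) x) = (\<Sum>\<^sub>Uj. pd j (?E j) x \<bullet> w x)"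
    by (simp only: vol_times_div_vec[OF x smooth_div_ten[OF T]] inner_sum_right inner_commute)
  have E2: "(\<Sum>\<^sub>Uj. ?E j x \<bullet> pd j w x) = (\<Sum>\<^sub>Uj i. pd j (?A i j) x \<bullet> pd i w x)
    + vol_density F x * (\<Sum>\<^sub>Ui j k. ?\<Gamma> k i j * (T i j x \<bullet> pd k w x))"
  proof -
    have "(\<Sum>\<^sub>Uj. ?E j x \<bullet> pd j w x) = (\<Sum>\<^sub>Ui k. pd k (?A i k) x \<bullet> pd i w x)
       + vol_density F x * (\<Sum>\<^sub>Ui k l. ?\<Gamma> i k l * (T l k x \<bullet> pd i w x))"
      by (simp only: vol_times_div_ten[OF x T] inner_add_left inner_sum_left inner_scaleR_left sum.distrib
          sum_distrib_left)
    also have "(\<Sum>\<^sub>Ui k. pd k (?A i k) x \<bullet> pd i w x) = (\<Sum>\<^sub>Uj i. pd j (?A i j) x \<bullet> pd i w x)"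
      by (rule sum.swap)
    also have "(\<Sum>\<^sub>Ui k l. ?\<Gamma> i k l * (T l k x \<bullet> pd i w x))
       = (\<Sum>(i,k,l)\<in>UNIV. ?\<Gamma> i k l * (T l k x \<bullet> pd i w x))"
      by (simp only: sum.cartesian_product UNIV_Times_UNIV)
    also have "\<dots> = (\<Sum>(i,j,k)\<in>UNIV. ?\<Gamma> k i j * (T i j x \<bullet> pd k w x))"
      by (rule sum.reindex_bij_witness[of _ "\<lambda>(i,j,k). (k,j,i)" "\<lambda>(i,k,l). (l,k,i)"])
         (auto simp: christoffel_commute[OF x])
    also have "\<dots> = (\<Sum>\<^sub>Ui j k. ?\<Gamma> k i j * (T i j x \<bullet> pd k w x))"
      by (simp only: sum.cartesian_product UNIV_Times_UNIV)
    finally show ?thesis .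
  qed
  have E3: "(\<Sum>\<^sub>Uj i. ?A i j x \<bullet> pd j (pd i w) x)
     = vol_density F x * (\<Sum>\<^sub>Ui j. T i j x \<bullet> pd i (pd j w) x)"
    by (subst sum.swap) (simp add: sum_distrib_left pd_commute[OF x w])
  have "(\<Sum>\<^sub>Uj. pd j (?V j) x) = vol_density F x * (\<Sum>\<^sub>Ui j. T i j x \<bullet> pd i (pd j w) x)
     - w x \<bullet> (vol_density F x *\<^sub>R div_vec F (div_ten F T) x)
     - vol_density F x * (\<Sum>\<^sub>Ui j k. ?\<Gamma> k i j * (T i j x \<bullet> pd k w x))"
    by (simp only: pdV sum.distrib sum_subtractf E1 E2 E3)
  then show "vol_density F x * ((\<Sum>\<^sub>Ui j. T i j x \<bullet> hess F w i j x) - w x \<bullet> div_vec F (div_ten F T) x)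
     = (\<Sum>\<^sub>Uj. pd j (?V j) x)"
    by (simp add: hess_def inner_diff_right inner_sum_right sum_subtractf right_diff_distrib)
qed

end

end

end


section \<open>Normal variations\<close>

context patch
begin

lemma normal_W: 
  assumes x: "x \<in> U"
  shows "normal_at F x (W F x)"
  unfolding W_def
  by (intro normal_at_intros normal_normal_laplacian normal_hu normal_H nproj_normal_at x)

text \<open>Up to constant factors, \<open>Hh_h\<close> is the coefficient of the variation of \<open>H\<close> in that of
  \<open>|H \<bullet> h|\<^sup>2\<close>, and the fluxes are the coefficients of \<open>\<nabla> w\<close> and \<open>\<nabla>\<nabla> w\<close> in the first variation; integration by parts turns them
  into the divergence terms of \<open>W\<close>.\<close>

definition Hh_h :: "real^4 \<Rightarrow> real^'m" where
  "Hh_h y = (\<Sum>\<^sub>Ui j. (H F y \<bullet> hu F i j y) *\<^sub>R hl F i j y)"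

definition flux1 :: "4 \<Rightarrow> real^4 \<Rightarrow> real^'m" where
  "flux1 j y = (\<Sum>\<^sub>Ui. hm F j i y \<bullet> nabla_up F (H F) i y) *\<^sub>R H F y"

definition flux2 :: "4 \<Rightarrow> real^4 \<Rightarrow> real^'m" where
  "flux2 j y = (\<Sum>\<^sub>Ui. (H F y \<bullet> hm F j i y) *\<^sub>R pnabla_up F (H F) i y)"

definition flux3 :: "4 \<Rightarrow> 4 \<Rightarrow> real^4 \<Rightarrow> real^'m" where
  "flux3 i k y = (H F y \<bullet> hu F i k y) *\<^sub>R H F y"

lemma smooth_Hh_h: "smooth_on U Hh_h"
  unfolding Hh_h_def[abs_def] by (intro smooth_intros smooth_geometry)
lemma smooth_flux1: "smooth_on U (flux1 j)"
  unfolding flux1_def[abs_def] by (intro smooth_intros smooth_geometry)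
lemma smooth_flux2: "smooth_on U (flux2 j)"
  unfolding flux2_def[abs_def] by (intro smooth_intros smooth_geometry)
lemma smooth_flux3: "smooth_on U (flux3 i j)"
  unfolding flux3_def[abs_def] by (intro smooth_intros smooth_geometry)

lemma normal_Hh_h: "x \<in> U \<Longrightarrow> normal_at F x (Hh_h x)"
  unfolding Hh_h_def by (intro normal_at_intros normal_hl)

context
  fixes x w
  assumes x: "x \<in> U" and nw: "normal_at F x w"
begin

lemma hh_contraction:
  "(\<Sum>\<^sub>Ui j k. (H F x \<bullet> hl F i j x) * (H F x \<bullet> hm F i k x) * (w \<bullet> hu F j k x))
   = (\<Sum>\<^sub>Ui j. (w \<bullet> hu F i j x) * (\<Sum>\<^sub>Uk l. gu F k l x * (H F x \<bullet> hl F i k x) * (H F x \<bullet> hl F j l x)))"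
proof -
  let ?a = "\<lambda>i j. H F x \<bullet> hl F i j x" and ?g = "\<lambda>i j. gu F i j x" and ?u = "\<lambda>i j. w \<bullet> hu F i j x"
  have a: "?a i j = ?a j i" for i j by (simp add: hl_commute[OF x, of i])
  have "(\<Sum>\<^sub>Ui j k. ?a i j * (H F x \<bullet> hm F i k x) * (w \<bullet> hu F j k x))
      = (\<Sum>\<^sub>Ui j k l. ?u j k * (?g i l * ?a i j * ?a l k))"
    by (simp add: hm_eq inner_sum_right sum_distrib_left sum_distrib_right ac_simps)
  also have "\<dots> = (\<Sum>(i,j,k,l)\<in>UNIV. ?u j k * (?g i l * ?a i j * ?a l k))"
    by (simp only: sum.cartesian_product UNIV_Times_UNIV)
  also have "\<dots> = (\<Sum>(i,j,k,l)\<in>UNIV. ?u i j * (?g k l * ?a i k * ?a j l))"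
    by (rule sum.reindex_bij_witness[of _ "\<lambda>(i,j,k,l). (k,i,j,l)" "\<lambda>(i,j,k,l). (j,k,i,l)"]) (auto simp: a)
  also have "\<dots> = (\<Sum>\<^sub>Ui j. ?u i j * (\<Sum>\<^sub>Uk l. ?g k l * ?a i k * ?a j l))"
    unfolding sum_distrib_left by (simp only: sum.cartesian_product UNIV_Times_UNIV)
  finally show ?thesis .
qed

lemma hh_hh_contraction:
  "(\<Sum>\<^sub>Ui j p q. (H F x \<bullet> hu F i j x) * (hl F i j x \<bullet> hl F p q x) * (w \<bullet> hu F p q x))
   = (\<Sum>\<^sub>Up q. (w \<bullet> hu F p q x) * (hl F p q x \<bullet> Hh_h x))"
proof -
  have "(\<Sum>\<^sub>Ui j p q. (H F x \<bullet> hu F i j x) * (hl F i j x \<bullet> hl F p q x) * (w \<bullet> hu F p q x))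
    = (\<Sum>\<^sub>Up q i j. (H F x \<bullet> hu F i j x) * (hl F i j x \<bullet> hl F p q x) * (w \<bullet> hu F p q x))"
    by (rule sum4_swap_pairs)
  also have "\<dots> = (\<Sum>\<^sub>Up q. (w \<bullet> hu F p q x) * (\<Sum>\<^sub>Ui j. (H F x \<bullet> hu F i j x) * (hl F p q x \<bullet> hl F i j x)))"
    unfolding sum_distrib_left by (intro sum.cong refl) (simp add: inner_commute ac_simps)
  finally show ?thesis unfolding Hh_h_def inner_sum_right inner_scaleR_right .
qed

text \<open>Pairing with a normal vector removes all the projections in \<open>W\<close>.\<close>

lemma W_inner_normal:
  "w \<bullet> W F x =
     - (1/2) * (w \<bullet> normal_laplacian F (normal_laplacian F (H F)) x)
     - (1/2) * (\<Sum>\<^sub>Ui j. (w \<bullet> hu F i j x) * (hl F i j x \<bullet> normal_laplacian F (H F) x))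
     - 4 * pnablaH_sq F x * (w \<bullet> H F x)
     + 2 * (w \<bullet> div_vec F flux1 x) - 2 * (w \<bullet> div_vec F flux2 x)
     + 2 * (\<Sum>\<^sub>Ui j. (w \<bullet> hu F i j x) * (pnabla F (H F) i x \<bullet> pnabla F (H F) j x))
     - (1/2) * (w \<bullet> normal_laplacian F Hh_h x)
     - 2 * (w \<bullet> div_vec F (div_ten F flux3) x)
     - 28 * (H F x \<bullet> H F x)^2 * (w \<bullet> H F x)
     - (1/2) * (\<Sum>\<^sub>Ui j. (w \<bullet> hu F i j x) * (hl F i j x \<bullet> Hh_h x))
     - 4 * (\<Sum>\<^sub>Ui j. (w \<bullet> hu F i j x) * (\<Sum>\<^sub>Uk l. gu F k l x * (H F x \<bullet> hl F i k x) * (H F x \<bullet> hl F j l x)))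
     + 4 * Hh_sq F x * (w \<bullet> H F x)
     + 7 * (w \<bullet> normal_laplacian F (\<lambda>y. (H F y \<bullet> H F y) *\<^sub>R H F y) x)
     + 7 * (H F x \<bullet> H F x) * (\<Sum>\<^sub>Ui j. (w \<bullet> hu F i j x) * (hl F i j x \<bullet> H F x))"
proof -
  note A = hh_contraction[symmetric] and B = hh_hh_contraction[symmetric]
  show ?thesis
    unfolding A B
    unfolding W_def flux1_def[abs_def, symmetric] flux2_def[abs_def, symmetric] flux3_def[abs_def, symmetric]
      Hh_h_def[abs_def, symmetric]
    by (simp add: inner_add_right inner_diff_right inner_sum_right nproj_inner_normal(2)[OF nw]
        inner_commute[of "hl F _ _ x" "H F x"] mult.commute[of "w \<bullet> hu F _ _ x"])
qed

end

lemma trace_hl: "(\<Sum>\<^sub>Ui j. gu F i j x *\<^sub>R hl F i j x) = 4 *\<^sub>R H F x"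
  by (simp add: H_def)

context
  fixes w :: "real^4 \<Rightarrow> real^'m"
  assumes w: "smooth_on U w" and nw: "\<And>x. x \<in> U \<Longrightarrow> normal_at F x (w x)"
begin

context
  fixes x assumes x: "x \<in> U"
begin

lemma var_gl_normal: "var_gl F w i j x = - 2 * (w x \<bullet> hl F i j x)"
  using pd_normal_inner_pd[OF x w nw, of i j] pd_normal_inner_pd[OF x w nw, of j i]
  by (simp add: var_gl_def hl_commute[OF x, of j] inner_commute[of "pd i F x"])

lemma var_gu_normal: "var_gu F w i j x = 2 * (w x \<bullet> hu F i j x)"
  by (simp add: var_gu_def var_gl_normal hu_eq inner_sum_right sum_distrib_left gu_commute[OF x, of _ j]
      sum_negf ac_simps)

lemma var_vol_normal: "var_vol F w x = - 4 * vol_density F x * (w x \<bullet> H F x)"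
proof -
  have "(\<Sum>\<^sub>Ui j. gu F i j x * (w x \<bullet> hl F i j x)) = 4 * (w x \<bullet> H F x)"
    using arg_cong[OF trace_hl[of x], of "\<lambda>v. w x \<bullet> v"] by (simp add: inner_sum_right)
  moreover have "(\<Sum>\<^sub>Ui j. gu F i j x * var_gl F w i j x)
      = - 2 * (\<Sum>\<^sub>Ui j. gu F i j x * (w x \<bullet> hl F i j x))"
    by (simp add: var_gl_normal sum_distrib_left ac_simps sum_negf)
  ultimately show ?thesis by (simp add: var_vol_def)
qed

text \<open>The normal Laplacian uses the normal connection twice, \<open>hess\<close> the full one; by Weingarten the
  difference is quadratic in \<open>h\<close>.\<close>

lemma normal_laplacian_normal_field:
  "normal_laplacian F w x = (\<Sum>\<^sub>Ui j. gu F i j x *\<^sub>R nproj F x (hess F w i j x))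
     + (\<Sum>\<^sub>Ui j. (w x \<bullet> hu F i j x) *\<^sub>R hl F i j x)"
proof -
  have 1: "nproj F x (pd k (pnabla F w j) x) = nproj F x (pd k (pd j w) x) + (\<Sum>\<^sub>Ul. (w x \<bullet> hm F l j x) *\<^sub>R hl F k l x)" for j k
  proof -
    have "pd k (pnabla F w j) x = pd k (\<lambda>y. pd j w y + (\<Sum>\<^sub>Ul. (w y \<bullet> hm F l j y) *\<^sub>R pd l F y)) x"
      by (rule pd_cong[OF _ x]) (simp add: pd_normal_field[OF _ w nw])
    then show ?thesis
      by (simp add: pd_simps x w smooth_intros smooth_geometry nproj_linear sum.distrib hl_eq)
  qed
  have 2: "nproj F x (nabla_covec F (pnabla F w) k j x) = nproj F x (hess F w k j x) + (\<Sum>\<^sub>Ul. (w x \<bullet> hm F l j x) *\<^sub>R hl F k l x)" for j k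
    by (simp add: nabla_covec_def hess_def nproj_linear 1 nproj_id[OF normal_pnabla[OF x]] pnabla_def[of F w _ x, symmetric])
  have "(\<Sum>\<^sub>Uj k. gu F j k x *\<^sub>R (\<Sum>\<^sub>Ul. (w x \<bullet> hm F l j x) *\<^sub>R hl F k l x))
     = (\<Sum>\<^sub>Uk l j. (gu F k j x * (w x \<bullet> hm F l j x)) *\<^sub>R hl F k l x)"
    by (subst sum.swap, rule sum.cong[OF refl], subst sum.swap) (simp add: scaleR_sum_right gu_commute[OF x])
  also have "\<dots> = (\<Sum>\<^sub>Uk l. (w x \<bullet> hu F l k x) *\<^sub>R hl F k l x)"
    by (simp add: hu_eq_hm inner_sum_right scaleR_sum_left)
  also have "\<dots> = (\<Sum>\<^sub>Uk l. (w x \<bullet> hu F k l x) *\<^sub>R hl F k l x)"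
    by (simp add: hu_commute[OF x])
  finally have 3: "(\<Sum>\<^sub>Uj k. gu F j k x *\<^sub>R (\<Sum>\<^sub>Ul. (w x \<bullet> hm F l j x) *\<^sub>R hl F k l x))
     = (\<Sum>\<^sub>Uk l. (w x \<bullet> hu F k l x) *\<^sub>R hl F k l x)" .
  have "(\<Sum>\<^sub>Uj k. gu F j k x *\<^sub>R nproj F x (hess F w k j x)) = (\<Sum>\<^sub>Ui j. gu F i j x *\<^sub>R nproj F x (hess F w i j x))"
    by (subst sum.swap) (simp add: gu_commute[OF x])
  then show ?thesis
    by (simp add: normal_laplacian_def nproj_sum nproj_scaleR 2 scaleR_add_right sum.distrib 3)
qed

lemma var_H_normal:
  "var_H F w x = (1/4) *\<^sub>R (normal_laplacian F w x + (\<Sum>\<^sub>Ui j. (w x \<bullet> hu F i j x) *\<^sub>R hl F i j x))"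
proof -
  have "(\<Sum>\<^sub>Ui j. (2 * (w x \<bullet> hu F i j x)) *\<^sub>R hl F i j x)
     = 2 *\<^sub>R (\<Sum>\<^sub>Ui j. (w x \<bullet> hu F i j x) *\<^sub>R hl F i j x)"
    by (simp add: scaleR_sum_right)
  then show ?thesis
    by (simp add: var_H_def var_gu_normal sum.distrib normal_laplacian_normal_field scaleR_2 scaleR_add_right)
qed

lemma normal_var_H: "normal_at F x (var_H F w x)"
  unfolding var_H_normal by (intro normal_at_intros normal_normal_laplacian normal_hl x)

lemma gradient_term:
  "(\<Sum>\<^sub>Ui j. gu F i j x * (pnabla F (H F) j x \<bullet> var_pnablaH F w i x))
   = (\<Sum>\<^sub>Ui j. gu F i j x * (pnabla F (H F) j x \<bullet> pd i (var_H F w) x))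
     - (\<Sum>\<^sub>Uk. flux1 k x \<bullet> pd k w x) + (\<Sum>\<^sub>Uk. flux2 k x \<bullet> pd k w x)"
proof -
  let ?P = "\<lambda>i. pnabla F (H F) i x" and ?Pu = "\<lambda>i. pnabla_up F (H F) i x"
  have Pu: "?Pu i = (\<Sum>\<^sub>Uj. gu F i j x *\<^sub>R ?P j)" for i
    by (simp add: pnabla_up_def nabla_up_def raise1_def pnabla_def nproj_linear)
  have raise: "(\<Sum>\<^sub>Uj. gu F i j x * (?P j \<bullet> v)) = ?Pu i \<bullet> v" for i v
    by (simp add: Pu inner_sum_left)
  have "?Pu i \<bullet> var_pnablaH F w i x = ?Pu i \<bullet> pd i (var_H F w) x
      - (\<Sum>\<^sub>Uk. (H F x \<bullet> pd k w x) * (hm F k i x \<bullet> nabla_up F (H F) i x))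
      + (\<Sum>\<^sub>Uk. (H F x \<bullet> hm F k i x) * (?Pu i \<bullet> pd k w x))" for i
  proof -
    have n: "normal_at F x (?Pu i)" by (simp add: pnabla_up_def nproj_normal_at x)
    have "?Pu i \<bullet> hm F k i x = hm F k i x \<bullet> nabla_up F (H F) i x" for k
      by (simp add: pnabla_up_def nproj_inner_normal[OF normal_hm[OF x]] inner_commute)
    then show ?thesis
      by (simp add: var_pnablaH_def inner_add_right inner_diff_right inner_sum_right nproj_inner_normal[OF n])
  qed
  then have "(\<Sum>\<^sub>Ui. ?Pu i \<bullet> var_pnablaH F w i x) = (\<Sum>\<^sub>Ui. ?Pu i \<bullet> pd i (var_H F w) x)
      - (\<Sum>\<^sub>Ui k. (H F x \<bullet> pd k w x) * (hm F k i x \<bullet> nabla_up F (H F) i x))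
      + (\<Sum>\<^sub>Ui k. (H F x \<bullet> hm F k i x) * (?Pu i \<bullet> pd k w x))"
    by (simp add: sum.distrib sum_subtractf)
  also have "(\<Sum>\<^sub>Ui k. (H F x \<bullet> pd k w x) * (hm F k i x \<bullet> nabla_up F (H F) i x))
      = (\<Sum>\<^sub>Uk. flux1 k x \<bullet> pd k w x)"
    by (subst sum.swap) (simp add: flux1_def sum_distrib_left mult.commute)
  also have "(\<Sum>\<^sub>Ui k. (H F x \<bullet> hm F k i x) * (?Pu i \<bullet> pd k w x))
      = (\<Sum>\<^sub>Uk. flux2 k x \<bullet> pd k w x)"
    by (subst sum.swap) (simp add: flux2_def inner_sum_left)
  finally show ?thesis by (simp add: raise)
qed

lemma var_energy_density_normal:
  "var_energy_density F w x =
     2 * (\<Sum>\<^sub>Ui j. (w x \<bullet> hu F i j x) * (pnabla F (H F) i x \<bullet> pnabla F (H F) j x))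
     - 4 * (\<Sum>\<^sub>Ui j. (w x \<bullet> hu F i j x) * (\<Sum>\<^sub>Uk l. gu F k l x * (H F x \<bullet> hl F i k x) * (H F x \<bullet> hl F j l x)))
     + 2 * (\<Sum>\<^sub>Ui j. gu F i j x * (pnabla F (H F) j x \<bullet> pd i (var_H F w) x))
     - 2 * (\<Sum>\<^sub>Uk. flux1 k x \<bullet> pd k w x) + 2 * (\<Sum>\<^sub>Uk. flux2 k x \<bullet> pd k w x)
     - 2 * (Hh_h x \<bullet> var_H F w x)
     - 2 * (\<Sum>\<^sub>Ui j. flux3 i j x \<bullet> hess F w i j x)
     + 28 * (H F x \<bullet> H F x) * (H F x \<bullet> var_H F w x)"
proof -
  let ?u = "\<lambda>i j. w x \<bullet> hu F i j x" and ?\<beta> = "\<lambda>i j. pnabla F (H F) i x \<bullet> pnabla F (H F) j x"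
  let ?aa = "\<lambda>i j. \<Sum>\<^sub>Uk l. gu F k l x * (H F x \<bullet> hl F i k x) * (H F x \<bullet> hl F j l x)"
  have 1: "(\<Sum>\<^sub>Ui j. 2 * ?u i j * (?\<beta> i j - 2 * ?aa i j))
     = 2 * (\<Sum>\<^sub>Ui j. ?u i j * ?\<beta> i j) - 4 * (\<Sum>\<^sub>Ui j. ?u i j * ?aa i j)"
  proof -
    have "(\<Sum>\<^sub>Ui j. 2 * u i j * (b i j - 2 * a i j))
       = 2 * (\<Sum>\<^sub>Ui j. u i j * b i j) - 4 * (\<Sum>\<^sub>Ui j. u i j * a i j)"
      for u a b :: "4 \<Rightarrow> 4 \<Rightarrow> real"
      by (simp add: right_diff_distrib sum_subtractf sum_distrib_left ac_simps)
    then show ?thesis .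
  qed
  have 2: "(\<Sum>\<^sub>Ui j. (H F x \<bullet> hu F i j x) * (var_H F w x \<bullet> hl F i j x + H F x \<bullet> hess F w i j x))
     = Hh_h x \<bullet> var_H F w x + (\<Sum>\<^sub>Ui j. flux3 i j x \<bullet> hess F w i j x)"
    by (simp add: Hh_h_def flux3_def inner_sum_left distrib_left sum.distrib inner_commute[of "var_H F w x"])
  show ?thesis
    unfolding var_energy_density_def var_gu_normal 1 2 gradient_term by (simp add: algebra_simps)
qed

lemma var_H_normal_inner:
  "n \<bullet> var_H F w x = 1/4 * (n \<bullet> normal_laplacian F w x) + 1/4 * (\<Sum>\<^sub>Ui j. (w x \<bullet> hu F i j x) * (hl F i j x \<bullet> n))"
  by (simp add: var_H_normal inner_add_right inner_sum_right inner_commute[of n])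

end

text \<open>The Euler--Lagrange operator. Each derivative of \<open>w\<close> in the first variation is removed by one of
  the seven integrations by parts below, and what is left is \<open>W\<close>. The derivatives of \<open>H\<close>, that is, the
  terms with \<open>var_H\<close>, go in two steps: first \<open>\<nabla>\<close> is moved off \<open>var_H\<close>, then \<open>\<Delta>\<^sub>\<bottom>\<close> off the \<open>w\<close>
  inside \<open>var_H\<close>.\<close>

lemma var_density_normal:
  assumes K: "closed K" and w0: "\<And>x. x \<in> U \<Longrightarrow> x \<notin> K \<Longrightarrow> w x = 0"
  shows "divergence_form K (\<lambda>x. var_density F w x - vol_density F x * (w x \<bullet> W F x))"
proof -
  let ?\<mu> = "vol_density F" and ?\<Delta> = "normal_laplacian F" and ?N = "var_H F w"
  let ?H2H = "\<lambda>y. (H F y \<bullet> H F y) *\<^sub>R H F y"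
  have N0: "?N x = 0" if "x \<in> U" "x \<notin> K" for x
  proof -
    interpret off: chart_domain "U - K" by unfold_locales (use K in \<open>simp add: open_Diff\<close>)
    have "?N x = var_H F (\<lambda>y. 0) x" by (rule off.var_H_cong) (use w0 that in auto)
    then show ?thesis using that by (simp add: var_H_zero)
  qed
  have gr: "divergence_form K (\<lambda>x. ?\<mu> x * (w x \<bullet> ?\<Delta> X x - X x \<bullet> ?\<Delta> w x))"
    if "smooth_on U X" "\<And>x. x \<in> U \<Longrightarrow> normal_at F x (X x)" for X
    by (rule green[OF K that w nw w0])
  have d1: "divergence_form K (\<lambda>x. ?\<mu> x * (w x \<bullet> ?\<Delta> (?\<Delta> (H F)) x - ?\<Delta> (H F) x \<bullet> ?\<Delta> w x))"
    by (intro gr smooth_geometry normal_normal_laplacian)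
  have d2: "divergence_form K (\<lambda>x. ?\<mu> x * (w x \<bullet> ?\<Delta> Hh_h x - Hh_h x \<bullet> ?\<Delta> w x))"
    by (intro gr smooth_Hh_h normal_Hh_h)
  have d3: "divergence_form K (\<lambda>x. ?\<mu> x * (w x \<bullet> ?\<Delta> ?H2H x - ?H2H x \<bullet> ?\<Delta> w x))"
    by (intro gr smooth_intros smooth_geometry normal_at_intros normal_H)
  have d4: "divergence_form K (\<lambda>x. ?\<mu> x *
    ((\<Sum>\<^sub>Ui j. gu F i j x * (pnabla F (H F) j x \<bullet> pd i ?N x)) + ?\<Delta> (H F) x \<bullet> ?N x))"
    by (rule integrate_gradient_by_parts[OF K smooth_H smooth_var_H[OF w] normal_var_H N0])
  have d5: "divergence_form K (\<lambda>x. ?\<mu> x * ((\<Sum>\<^sub>Uk. flux1 k x \<bullet> pd k w x) + w x \<bullet> div_vec F flux1 x))"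
    by (rule integrate_div_vec_by_parts[OF K w w0 smooth_flux1])
  have d6: "divergence_form K (\<lambda>x. ?\<mu> x * ((\<Sum>\<^sub>Uk. flux2 k x \<bullet> pd k w x) + w x \<bullet> div_vec F flux2 x))"
    by (rule integrate_div_vec_by_parts[OF K w w0 smooth_flux2])
  have d7: "divergence_form K (\<lambda>x. ?\<mu> x *
    ((\<Sum>\<^sub>Ui j. flux3 i j x \<bullet> hess F w i j x) - w x \<bullet> div_vec F (div_ten F flux3) x))"
    by (rule integrate_hess_by_parts[OF K w w0 smooth_flux3])
  note total = divergence_form_add[OF divergence_form_cmult[OF d1, of "1/2"]
      divergence_form_add[OF divergence_form_cmult[OF d2, of "1/2"]
      divergence_form_add[OF divergence_form_cmult[OF d3, of "-7"]
      divergence_form_add[OF divergence_form_cmult[OF d4, of 2]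
      divergence_form_add[OF divergence_form_cmult[OF d5, of "-2"]
      divergence_form_add[OF divergence_form_cmult[OF d6, of 2] divergence_form_cmult[OF d7, of "-2"]]]]]]]
  show ?thesis
  proof (rule divergence_form_cong[OF _ total])
    fix x assume x: "x \<in> U"
    show "var_density F w x - ?\<mu> x * (w x \<bullet> W F x) =
      1/2 * (?\<mu> x * (w x \<bullet> ?\<Delta> (?\<Delta> (H F)) x - ?\<Delta> (H F) x \<bullet> ?\<Delta> w x))
      + (1/2 * (?\<mu> x * (w x \<bullet> ?\<Delta> Hh_h x - Hh_h x \<bullet> ?\<Delta> w x))
      + (-7 * (?\<mu> x * (w x \<bullet> ?\<Delta> ?H2H x - ?H2H x \<bullet> ?\<Delta> w x))
      + (2 * (?\<mu> x * ((\<Sum>\<^sub>Ui j. gu F i j x * (pnabla F (H F) j x \<bullet> pd i ?N x)) + ?\<Delta> (H F) x \<bullet> ?N x))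
      + (-2 * (?\<mu> x * ((\<Sum>\<^sub>Uk. flux1 k x \<bullet> pd k w x) + w x \<bullet> div_vec F flux1 x))
      + (2 * (?\<mu> x * ((\<Sum>\<^sub>Uk. flux2 k x \<bullet> pd k w x) + w x \<bullet> div_vec F flux2 x))
      + -2 * (?\<mu> x * ((\<Sum>\<^sub>Ui j. flux3 i j x \<bullet> hess F w i j x) - w x \<bullet> div_vec F (div_ten F flux3) x)))))))"
      unfolding var_density_def var_energy_density_normal[OF x] var_vol_normal[OF x] energy_density_def
        W_inner_normal[OF x nw[OF x]]
      unfolding var_H_normal_inner[OF x, of "?\<Delta> (H F) x"] var_H_normal_inner[OF x, of "Hh_h x"]
        var_H_normal_inner[OF x, of "H F x"] inner_scaleR_left
      by (simp add: algebra_simps power2_eq_square)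
  qed
qed

end

end


section \<open>Integration\<close>

context time_domain
begin

text \<open>Differentiation under the integral sign over a compact set, by dominated convergence of the
  difference quotients.\<close>

lemma has_derivative_integral_compact:
  assumes f: "jsmooth f" and C: "compact C" "C \<subseteq> U"
  shows "((\<lambda>t. LINT x:C|lborel. f t x) has_real_derivative (LINT x:C|lborel. dt f x)) (at 0)"
proof -
  let ?D = "\<lambda>p. frechet_derivative (\<lambda>p. f (fst p) (snd p)) (at p) (1, 0) :: real"
  \<comment> \<open>a closed time interval makes the cylinder over \<open>C\<close> compact, hence the time derivative bounded\<close>
  define \<delta> where "\<delta> = \<epsilon> / 2"
  have \<delta>: "\<delta> > 0" "\<delta> < \<epsilon>" using eps_pos unfolding \<delta>_def by linarith+
  have sub: "{-\<delta>..\<delta>} \<times> C \<subseteq> {-\<epsilon><..<\<epsilon>} \<times> U" using \<delta> C by auto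
  have "continuous_on ({-\<delta>..\<delta>} \<times> C) ?D"
    by (rule continuous_on_subset[OF smooth_on_continuous_on[OF smooth_on_frechet_derivative[OF f[unfolded jsmooth_def]]] sub])
  then have "compact (?D ` ({-\<delta>..\<delta>} \<times> C))"
    by (rule compact_continuous_image) (simp add: compact_Times C)
  then have "bounded (?D ` ({-\<delta>..\<delta>} \<times> C))" by (rule compact_imp_bounded)
  then obtain B where "\<forall>y\<in>?D ` ({-\<delta>..\<delta>} \<times> C). norm y \<le> B" unfolding bounded_iff by blast
  then have B: "\<bar>?D p\<bar> \<le> B" if "p \<in> {-\<delta>..\<delta>} \<times> C" for p
    using imageI[OF that, of ?D] unfolding real_norm_def by blast
  have lip: "\<bar>f t x - f 0 x\<bar> \<le> B * \<bar>t\<bar>" if "t \<in> {-\<delta>..\<delta>}" "x \<in> C" for t x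
  proof -
    have "norm (f t x - f 0 x) \<le> B * norm (t - 0)"
    proof (rule field_differentiable_bound[where S = "{-\<delta>..\<delta>}"])
      fix s assume s: "s \<in> {-\<delta>..\<delta>}"
      have "s \<in> {-\<epsilon><..<\<epsilon>}" "x \<in> U" using s \<delta> that C by auto
      from dt_at[OF f this] show "((\<lambda>s. f s x) has_field_derivative ?D (s, x)) (at s within {-\<delta>..\<delta>})"
        by (simp add: has_real_derivative_iff_has_vector_derivative has_vector_derivative_at_within)
      show "norm (?D (s, x)) \<le> B" using B[of "(s, x)"] s that by simp
    qed (use that \<delta> in auto)
    then show ?thesis by simp
  qed
  have cont: "continuous_on C (\<lambda>x. f t x)" if "t \<in> {-\<epsilon><..<\<epsilon>}" for t
    by (rule continuous_on_subset[OF smooth_on_continuous_on[OF smooth_slice[OF f that]] C(2)])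
  have int: "integrable lborel (\<lambda>x. indicator C x *\<^sub>R f t x)" if "t \<in> {-\<epsilon><..<\<epsilon>}" for t
    by (rule borel_integrable_compact[OF C(1) cont[OF that]])
  have intd: "integrable lborel (\<lambda>x. indicator C x *\<^sub>R dt f x)"
    by (rule borel_integrable_compact[OF C(1) continuous_on_subset[OF smooth_on_continuous_on[OF smooth_dt[OF f]] C(2)]])
  have "((\<lambda>t. ((LINT x:C|lborel. f t x) - (LINT x:C|lborel. f 0 x)) / t) \<longlongrightarrow> (LINT x:C|lborel. dt f x)) (at 0 within {-\<delta>..\<delta>})"
    unfolding tendsto_at_iff_sequentially comp_def
  proof (intro allI impI)
    fix X :: "nat \<Rightarrow> real"
    assume X: "\<forall>i. X i \<in> {-\<delta>..\<delta>} - {0}" and lim: "X \<longlonglongrightarrow> 0"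
    have Xe: "X n \<in> {-\<epsilon><..<\<epsilon>}" "X n \<noteq> 0" "X n \<in> {-\<delta>..\<delta>}" for n using X[rule_format, of n] \<delta> by auto
    let ?s = "\<lambda>n x. indicator C x *\<^sub>R ((f (X n) x - f 0 x) / X n)"
    have seq: "?s n = (\<lambda>x. (indicator C x *\<^sub>R f (X n) x - indicator C x *\<^sub>R f 0 x) / X n)" for n
      by (simp add: fun_eq_iff diff_divide_distrib right_diff_distrib)
    have quot: "((LINT x:C|lborel. f (X n) x) - (LINT x:C|lborel. f 0 x)) / X n = (LINT x|lborel. ?s n x)" for n
      using int[OF Xe(1), of n] int[OF zero_mem]
      by (simp only: seq set_lebesgue_integral_def integral_divide_zero Bochner_Integration.integral_diff)
    have "(\<lambda>n. LINT x|lborel. ?s n x) \<longlonglongrightarrow> (LINT x|lborel. indicator C x *\<^sub>R dt f x)"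
    proof (rule integral_dominated_convergence[where w = "\<lambda>x. indicator C x *\<^sub>R B"])
      show "(\<lambda>x. indicator C x *\<^sub>R dt f x) \<in> borel_measurable lborel"
        using intd by (rule borel_measurable_integrable)
      show "?s n \<in> borel_measurable lborel" for n
        unfolding seq
        by (intro borel_measurable_integrable integrable_divide Bochner_Integration.integrable_diff int zero_mem Xe)
      show "integrable lborel (\<lambda>x. indicator C x *\<^sub>R B)"
        by (rule borel_integrable_compact[OF C(1)]) simp
      show "AE x in lborel. (\<lambda>n. ?s n x) \<longlonglongrightarrow> indicator C x *\<^sub>R dt f x"
      proof (rule AE_I2)
        fix x
        show "(\<lambda>n. ?s n x) \<longlonglongrightarrow> indicator C x *\<^sub>R dt f x"
        proof (cases "x \<in> C")
          case True
          have "((\<lambda>t. f t x) has_real_derivative dt f x) (at 0)"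
            using dt_has_vector_derivative[OF _ f, of x] True C
            by (auto simp: has_real_derivative_iff_has_vector_derivative)
          then have "((\<lambda>t. (f t x - f 0 x) / t) \<longlongrightarrow> dt f x) (at 0)"
            by (simp add: has_field_derivative_iff)
          from this[unfolded tendsto_at_iff_sequentially comp_def, rule_format, of X]
          show ?thesis using True Xe(2) lim by simp
        qed simp
      qed
      show "AE x in lborel. norm (?s n x) \<le> indicator C x *\<^sub>R B" for n
      proof (rule AE_I2)
        fix x
        show "norm (?s n x) \<le> indicator C x *\<^sub>R B"
          using lip[OF Xe(3), of x n] Xe(2)[of n] by (cases "x \<in> C") (simp_all add: divide_le_eq)
      qed
    qed
    then show "(\<lambda>n. ((LINT x:C|lborel. f (X n) x) - (LINT x:C|lborel. f 0 x)) / X n) \<longlonglongrightarrow> (LINT x:C|lborel. dt f x)"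
      unfolding quot unfolding set_lebesgue_integral_def .
  qed
  moreover have "at 0 within {-\<delta>..\<delta>} = at (0::real)"
    by (rule at_within_interior) (use \<delta> in \<open>simp add: interior_atLeastAtMost_real\<close>)
  ultimately show ?thesis by (simp add: has_field_derivative_iff)
qed

end

lemma lborel_integral_translate:
  fixes f :: "'a::euclidean_space \<Rightarrow> real"
  shows "f \<in> borel_measurable borel \<Longrightarrow> (LINT x|lborel. f (c + x)) = (LINT x|lborel. f x)"
  using integral_distr[of "(+) c" lborel borel f] by (simp add: lborel_distr_plus)

context chart_domain
begin

text \<open>The integral of a compactly supported function is invariant under translations; its
  derivative along an axis therefore integrates to zero.\<close>

lemma integral_pd_eq_zero:
  fixes V :: "real^4 \<Rightarrow> real"
  assumes K: "compact K" "K \<subseteq> U" and V: "smooth_on U V" and V0: "\<And>x. x \<in> U \<Longrightarrow> x \<notin> K \<Longrightarrow> V x = 0"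
  shows "(LINT x:K|lborel. pd i V x) = 0"
proof -
  define Z where "Z = (\<lambda>x. if x \<in> U then V x else 0)"
  let ?e = "axis i 1 :: real^4"
  interpret T: time_domain UNIV 1 by unfold_locales auto
  have Z0: "Z x = 0" if "x \<notin> K" for x using that V0 by (simp add: Z_def)
  have smZ: "smooth_on UNIV Z"
  proof (rule smooth_on_local)
    fix x :: "real^4"
    show "\<exists>T. open T \<and> x \<in> T \<and> smooth_on T Z"
    proof (cases "x \<in> U")
      case True
      have "smooth_on U Z" by (subst smooth_on_cong[OF open_U, of Z V]) (simp_all add: Z_def V)
      then show ?thesis using True open_U by blast
    next
      case False
      have o: "open (- K)" using compact_imp_closed[OF K(1)] by (simp add: open_Compl)
      have "smooth_on (- K) Z" by (subst smooth_on_cong[OF o, of Z "\<lambda>x. 0"]) (simp_all add: Z0 smooth_on_const)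
      then show ?thesis using False K o by blast
    qed
  qed
  obtain R where R: "\<And>x. x \<in> K \<Longrightarrow> norm x \<le> R" using compact_imp_bounded[OF K(1)] by (auto simp: bounded_iff)
  \<comment> \<open>large enough to contain all translates of \<open>K\<close> by less than a unit\<close>
  let ?C = "cball 0 (R + 1) :: (real^4) set"
  have "T.jsmooth (\<lambda>t y. Z (y + t *\<^sub>R ?e))"
    by (rule T.jsmooth_translate[OF smZ]) auto
  from T.has_derivative_integral_compact[OF this, of ?C]
  have "((\<lambda>t. LINT x:?C|lborel. Z (x + t *\<^sub>R ?e)) has_real_derivative
      (LINT x:?C|lborel. dt (\<lambda>t y. Z (y + t *\<^sub>R ?e)) x)) (at 0)" by simp
  moreover have "dt (\<lambda>t y. Z (y + t *\<^sub>R ?e)) x = pd i Z x" for x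
  proof -
    have "((\<lambda>p. snd p + fst p *\<^sub>R ?e) has_derivative (\<lambda>p. snd p + fst p *\<^sub>R ?e)) (at (0, x))"
      by (auto intro!: derivative_eq_intros)
    moreover have "(Z has_derivative frechet_derivative Z (at x)) (at (snd (0, x) + fst (0, x) *\<^sub>R ?e))"
      using smooth_on_has_derivative[OF smZ] by simp
    ultimately have "((\<lambda>p. Z (snd p + fst p *\<^sub>R ?e)) has_derivative
      (\<lambda>p. frechet_derivative Z (at x) (snd p + fst p *\<^sub>R ?e))) (at (0, x))"
      by (rule has_derivative_compose)
    from T.dt_eqI[OF _ this] show ?thesis by (simp add: pd_def)
  qed
  moreover have "(LINT x:?C|lborel. Z (x + t *\<^sub>R ?e)) = (LINT x|lborel. Z x)" if "t \<in> {-1<..<1}" for t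
  proof -
    have "x \<in> ?C" if "x + t *\<^sub>R ?e \<in> K" for x
    proof -
      have "norm x \<le> norm (x + t *\<^sub>R ?e) + norm (t *\<^sub>R ?e)"
        using norm_triangle_ineq4[of "x + t *\<^sub>R ?e" "t *\<^sub>R ?e"] by simp
      also have "\<dots> \<le> R + 1" using R[OF that] \<open>t \<in> {-1<..<1}\<close> by (intro add_mono) (auto simp: norm_axis_1)
      finally show ?thesis by simp
    qed
    then have "indicator ?C x *\<^sub>R Z (x + t *\<^sub>R ?e) = Z (t *\<^sub>R ?e + x)" for x
      using Z0[of "x + t *\<^sub>R ?e"] by (cases "x \<in> ?C") (auto simp: add.commute)
    then have "(LINT x:?C|lborel. Z (x + t *\<^sub>R ?e)) = (LINT x|lborel. Z (t *\<^sub>R ?e + x))"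
      by (simp add: set_lebesgue_integral_def)
    also have "\<dots> = (LINT x|lborel. Z x)"
      by (rule lborel_integral_translate)
         (rule borel_measurable_continuous_onI[OF smooth_on_continuous_on[OF smZ]])
    finally show ?thesis .
  qed
  ultimately have "((\<lambda>t. LINT x|lborel. Z x) has_real_derivative (LINT x:?C|lborel. pd i Z x)) (at (0::real))"
    by (subst DERIV_cong_ev[OF refl _ refl, of _ "\<lambda>t. LINT x:?C|lborel. Z (x + t *\<^sub>R ?e)"])
       (use eventually_nhds_in_open[of "{-1<..<1}" "0::real"] in \<open>auto elim!: eventually_mono\<close>)
  then have "(LINT x:?C|lborel. pd i Z x) = 0" using DERIV_const DERIV_unique by blast
  moreover have "indicator ?C x *\<^sub>R pd i Z x = indicator K x *\<^sub>R pd i V x" for x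
  proof (cases "x \<in> K")
    case True
    have "pd i Z x = pd i V x" by (rule pd_cong) (use True K in \<open>auto simp: Z_def\<close>)
    then show ?thesis using True R[OF True] by (simp add: indicator_def)
  next
    case False
    have "pd i Z x = 0"
      by (rule T.pd_zero_off_closed[OF compact_imp_closed[OF K(1)] _ _ False]) (auto intro: Z0)
    then show ?thesis using False by simp
  qed
  ultimately show ?thesis by (simp add: set_lebesgue_integral_def)
qed

lemma integral_divergence_form:
  assumes K: "compact K" "K \<subseteq> U" and f: "divergence_form K f"
  shows "(LINT x:K|lborel. f x) = 0"
proof -
  obtain V where V: "\<And>i. smooth_on U (V i)" "\<And>i x. x \<in> U \<Longrightarrow> x \<notin> K \<Longrightarrow> V i x = 0"
      "\<And>x. x \<in> U \<Longrightarrow> f x = (\<Sum>\<^sub>Ui. pd i (V i) x)"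
    using f by (rule divergence_formE) blast
  have int: "integrable lborel (\<lambda>x. indicator K x *\<^sub>R pd i (V i) x)" for i
    by (rule borel_integrable_compact[OF K(1) continuous_on_subset[OF smooth_on_continuous_on[OF smooth_pd[OF V(1)]] K(2)]])
  have "(LINT x:K|lborel. f x) = (LINT x|lborel. (\<Sum>\<^sub>Ui. indicator K x *\<^sub>R pd i (V i) x))"
    unfolding set_lebesgue_integral_def
  proof (rule Bochner_Integration.integral_cong[OF refl])
    fix x
    show "indicator K x *\<^sub>R f x = (\<Sum>\<^sub>Ui. indicator K x *\<^sub>R pd i (V i) x)"
      using K V(3) by (cases "x \<in> K") auto
  qed
  also have "\<dots> = (\<Sum>\<^sub>Ui. (LINT x:K|lborel. pd i (V i) x))"
    unfolding set_lebesgue_integral_def by (rule Bochner_Integration.integral_sum) (rule int)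
  also have "\<dots> = 0" using integral_pd_eq_zero[OF K V(1,2)] by simp
  finally show ?thesis .
qed

end

section \<open>The first variation formula\<close>

context immersion_family
begin

interpretation initial: patch U "\<Phi> 0" by (rule patch_at_zero)

text \<open>The velocity is split into its normal part \<open>n\<close> and tangential part with coefficients \<open>Y\<close>; the
  latter contributes a divergence, the former \<open>W\<close>, which is normal and therefore does not notice that
  \<open>w\<close> has been replaced by \<open>n\<close>.\<close>

lemma first_variation:
  assumes K: "compact K" "K \<subseteq> U"
    and off: "\<And>t x. t \<in> {-\<epsilon><..<\<epsilon>} \<Longrightarrow> x \<in> U \<Longrightarrow> x \<notin> K \<Longrightarrow> \<Phi> t x = F x"
  shows "((\<lambda>t. LINT x:K|lborel. energy_density (\<Phi> t) x * vol_density (\<Phi> t) x) has_real_derivative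
     (LINT x:K|lborel. vol_density F x * (w x \<bullet> W F x))) (at 0)"
proof -
  have closed: "closed K" by (rule compact_imp_closed[OF K(1)])
  have w0: "w x = 0" if "x \<in> U" "x \<notin> K" for x
  proof -
    interpret o: time_domain "U - K" \<epsilon> by unfold_locales (use closed in \<open>simp_all add: open_Diff\<close>)
    have "x \<in> U - K" using that by simp
    then have "w x = dt (\<lambda>t. F) x" by (rule o.dt_cong) (rule off, simp_all)
    then show ?thesis using dt_const[OF that(1) initial.smooth_F] by simp
  qed
  define n where "n = (\<lambda>x. nproj F x (w x))"
  define Y where "Y = (\<lambda>k x. w x \<bullet> dual_frame F k x)"
  have smn: "smooth_on U n" unfolding n_def by (intro initial.smooth_nproj smooth_w)
  have smY: "smooth_on U (Y k)" for k unfolding Y_def by (intro smooth_intros initial.smooth_geometry smooth_w)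
  have n: "normal_at F x (n x)" if "x \<in> U" for x by (simp add: n_def initial.nproj_normal_at that)
  have off0: "n x = 0" "Y k x = 0" if "x \<in> U" "x \<notin> K" for x k by (simp_all add: n_def Y_def w0[OF that])
  let ?L = "\<lambda>y. energy_density F y * vol_density F y"
  have split: "var_density F w x = var_density F n x + (\<Sum>\<^sub>Uk. pd k (\<lambda>y. Y k y * ?L y) x)" if x: "x \<in> U" for x
  proof -
    have "var_density F w x = var_density F (\<lambda>y. n y + initial.tangent_field Y y) x"
      by (rule var_density_cong[OF _ x]) (simp add: n_def Y_def initial.nproj_eq)
    then show ?thesis
      by (simp only: initial.var_density_add[OF x smn initial.smooth_tangent_field[OF smY]]
          initial.var_density_tangent_field[OF smY x])
  qed
  have "divergence_form K (\<lambda>x. \<Sum>\<^sub>Uk. pd k (\<lambda>y. Y k y * ?L y) x)"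
    by (rule divergence_formI[where V = "\<lambda>k y. Y k y * ?L y"])
       (simp_all add: off0 smooth_intros initial.smooth_geometry smY)
  from divergence_form_add[OF initial.var_density_normal[OF smn n closed off0(1)] this]
  have "divergence_form K (\<lambda>x. var_density F w x - vol_density F x * (n x \<bullet> W F x))"
    by (rule divergence_form_cong[rotated]) (simp_all add: split)
  from integral_divergence_form[OF K this]
  have zero: "(LINT x:K|lborel. var_density F w x - vol_density F x * (n x \<bullet> W F x)) = 0" .
  have nW: "n x \<bullet> W F x = w x \<bullet> W F x" if "x \<in> U" for x
    unfolding n_def by (rule initial.nproj_inner_normal[OF initial.normal_W[OF that]])
  have js: "jsmooth (\<lambda>t x. energy_density (\<Phi> t) x * vol_density (\<Phi> t) x)"
    by (intro jsmooth_mult jsmooth_energy_density jsmooth_vol_density)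
  let ?d = "dt (\<lambda>t x. energy_density (\<Phi> t) x * vol_density (\<Phi> t) x)"
  have smW: "smooth_on U (\<lambda>x. vol_density F x * (w x \<bullet> W F x))"
    by (intro smooth_intros initial.smooth_geometry initial.smooth_W smooth_w)
  have int: "set_integrable lborel K f" if "smooth_on U f" for f :: "real^4 \<Rightarrow> real"
    unfolding set_integrable_def
    by (rule borel_integrable_compact[OF K(1) continuous_on_subset[OF smooth_on_continuous_on[OF that] K(2)]])
  have sub: "x \<in> U" if "x \<in> K" for x using that K by blast
  have "(LINT x:K|lborel. ?d x - vol_density F x * (w x \<bullet> W F x))
      = (LINT x:K|lborel. var_density F w x - vol_density F x * (n x \<bullet> W F x))"
    by (rule set_lebesgue_integral_cong) (use K in \<open>auto simp: dt_density[OF sub] nW[OF sub] compact_imp_closed\<close>)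
  then have "(LINT x:K|lborel. ?d x) = (LINT x:K|lborel. vol_density F x * (w x \<bullet> W F x))"
    using zero set_integral_diff(2)[OF int[OF smooth_dt[OF js]] int[OF smW]] by simp
  then show ?thesis
    using has_derivative_integral_compact[OF js K] by simp
qed

end


section \<open>Locality\<close>

text \<open>On a chart domain the initial map of a variation agrees with the given immersion, but nothing is
  known outside it. Since the geometric quantities are local, \<open>W\<close> cannot tell the difference.\<close>

context chart_domain
begin

context
  fixes F G :: "real^4 \<Rightarrow> real^'m"
  assumes FG: "\<And>y. y \<in> U \<Longrightarrow> F y = G y"
begin

lemma metric_cong: "x \<in> U \<Longrightarrow> metric F x = metric G x"
  using pd_cong[OF FG] by (simp add: metric_def)

lemma gl_cong: "x \<in> U \<Longrightarrow> gl F i j x = gl G i j x"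
  by (simp add: gl_def metric_cong)

lemma gu_cong: "x \<in> U \<Longrightarrow> gu F i j x = gu G i j x"
  by (simp add: gu_def metric_cong)

lemma christoffel_cong: "x \<in> U \<Longrightarrow> christoffel F k i j x = christoffel G k i j x"
  using pd_cong[OF gl_cong] by (simp add: christoffel_def gu_cong)

lemma nproj_cong: "x \<in> U \<Longrightarrow> nproj F x v = nproj G x v"
  using pd_cong[OF FG] by (simp add: nproj_def gu_cong)

lemma nabla_covec_cong:
  assumes "\<And>j y. y \<in> U \<Longrightarrow> \<omega> j y = \<eta> j y" "x \<in> U"
  shows "nabla_covec F \<omega> i j x = nabla_covec G \<eta> i j x"
  using pd_cong[OF assms(1) assms(2)] assms by (simp add: nabla_covec_def christoffel_cong)

lemma div_vec_cong:
  assumes "\<And>j y. y \<in> U \<Longrightarrow> Y j y = Z j y" "x \<in> U"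
  shows "div_vec F Y x = div_vec G Z x"
  using pd_cong[OF assms(1) assms(2)] assms by (simp add: div_vec_def nabla_vec_def christoffel_cong)

lemma div_ten_cong:
  assumes "\<And>i j y. y \<in> U \<Longrightarrow> T i j y = T' i j y" "x \<in> U"
  shows "div_ten F T i x = div_ten G T' i x"
  using pd_cong[OF assms(1) assms(2)] assms by (simp add: div_ten_def nabla_ten_def christoffel_cong)

lemma hl_cong: "x \<in> U \<Longrightarrow> hl F i j x = hl G i j x"
  unfolding hl_def by (rule nabla_covec_cong[OF pd_cong[OF FG]])

lemma hm_cong: "x \<in> U \<Longrightarrow> hm F i j x = hm G i j x"
  by (simp add: hm_def raise1_def gu_cong hl_cong)

lemma hu_cong: "x \<in> U \<Longrightarrow> hu F i j x = hu G i j x"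
  by (simp add: hu_def raise1_def gu_cong hm_cong)

lemma H_cong: "x \<in> U \<Longrightarrow> H F x = H G x"
  by (simp add: H_def gu_cong hl_cong)

lemma nabla_up_H_cong: "x \<in> U \<Longrightarrow> nabla_up F (H F) i x = nabla_up G (H G) i x"
  using pd_cong[OF H_cong] by (simp add: nabla_up_def raise1_def gu_cong)

lemma pnabla_cong:
  assumes "\<And>y. y \<in> U \<Longrightarrow> X y = Y y" "x \<in> U"
  shows "pnabla F X i x = pnabla G Y i x"
  using pd_cong[OF assms] assms(2) by (simp add: pnabla_def nproj_cong)

lemma pnabla_up_H_cong: "x \<in> U \<Longrightarrow> pnabla_up F (H F) i x = pnabla_up G (H G) i x"
  by (simp add: pnabla_up_def nabla_up_H_cong nproj_cong)

lemma normal_laplacian_cong: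
  assumes "\<And>y. y \<in> U \<Longrightarrow> X y = Y y" "x \<in> U"
  shows "normal_laplacian F X x = normal_laplacian G Y x"
  using nabla_covec_cong[OF pnabla_cong[OF assms(1)] assms(2)] assms(2)
  by (simp add: normal_laplacian_def nproj_cong gu_cong)

lemma W_cong:
  assumes x: "x \<in> U"
  shows "W F x = W G x"
proof -
  note c = hl_cong hm_cong hu_cong H_cong nabla_up_H_cong pnabla_up_H_cong pnabla_cong[OF H_cong]
    nproj_cong normal_laplacian_cong[OF H_cong] gu_cong
  have 1: "normal_laplacian F (normal_laplacian F (H F)) x = normal_laplacian G (normal_laplacian G (H G)) x"
    by (rule normal_laplacian_cong[OF normal_laplacian_cong[OF H_cong] x])
  have 2: "normal_laplacian F (\<lambda>y. \<Sum>\<^sub>Ui j. (H F y \<bullet> hu F i j y) *\<^sub>R hl F i j y) x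
         = normal_laplacian G (\<lambda>y. \<Sum>\<^sub>Ui j. (H G y \<bullet> hu G i j y) *\<^sub>R hl G i j y) x"
    by (rule normal_laplacian_cong[OF _ x]) (simp add: c)
  have 3: "normal_laplacian F (\<lambda>y. (H F y \<bullet> H F y) *\<^sub>R H F y) x
         = normal_laplacian G (\<lambda>y. (H G y \<bullet> H G y) *\<^sub>R H G y) x"
    by (rule normal_laplacian_cong[OF _ x]) (simp add: c)
  have 4: "div_vec F (\<lambda>j y. (\<Sum>\<^sub>Ui. hm F j i y \<bullet> nabla_up F (H F) i y) *\<^sub>R H F y) x
         = div_vec G (\<lambda>j y. (\<Sum>\<^sub>Ui. hm G j i y \<bullet> nabla_up G (H G) i y) *\<^sub>R H G y) x"
    by (rule div_vec_cong[OF _ x]) (simp add: c)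
  have 5: "div_vec F (\<lambda>j y. \<Sum>\<^sub>Ui. (H F y \<bullet> hm F j i y) *\<^sub>R pnabla_up F (H F) i y) x
         = div_vec G (\<lambda>j y. \<Sum>\<^sub>Ui. (H G y \<bullet> hm G j i y) *\<^sub>R pnabla_up G (H G) i y) x"
    by (rule div_vec_cong[OF _ x]) (simp add: c)
  have 6: "div_vec F (div_ten F (\<lambda>i k y. (H F y \<bullet> hu F i k y) *\<^sub>R H F y)) x
         = div_vec G (div_ten G (\<lambda>i k y. (H G y \<bullet> hu G i k y) *\<^sub>R H G y)) x"
    by (rule div_vec_cong[OF div_ten_cong x]) (simp_all add: c)
  have 7: "pnablaH_sq F x = pnablaH_sq G x" "Hh_sq F x = Hh_sq G x"
    using x by (simp_all add: pnablaH_sq_def Hh_sq_def c)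
  show ?thesis
    unfolding W_def 1 2 3 4 5 6 7 using x by (simp only: c)
qed

end

end

section \<open>Charts\<close>

lemma inj_frechet_derivative_if_det:
  assumes d: "F differentiable at x" and "det (metric F x) \<noteq> 0"
  shows "inj (frechet_derivative F (at x))"
proof -
  let ?D = "frechet_derivative F (at x)"
  have lin: "linear ?D" using d by (rule linear_frechet_derivative)
  have "v = 0" if "?D v = 0" for v
  proof -
    have "(\<Sum>\<^sub>Uj. v $ j *\<^sub>R pd j F x) = 0"
      using that by (simp add: frechet_derivative_eq_sum_pd[OF d])
    then have "pd i F x \<bullet> (\<Sum>\<^sub>Uj. v $ j *\<^sub>R pd j F x) = 0" for i by simp
    then have "metric F x *v v = 0"
      by (simp add: vec_eq_iff matrix_vector_mult_def metric_def inner_sum_right mult.commute)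
    moreover have "invertible (metric F x)" using assms(2) by (simp add: invertible_det_nz)
    ultimately show ?thesis
      unfolding invertible_left_inverse matrix_left_invertible_ker by blast
  qed
  then show ?thesis using linear_injective_0[OF lin] by blast
qed

locale manifold =
  fixes \<Sigma> :: "'a topology" and \<A> :: "'a chart set"
  assumes manifold: "smooth_manifold4 \<Sigma> \<A>"
begin

lemma open_cimg: "c \<in> \<A> \<Longrightarrow> open (cimg c)"
  and openin_cdom: "c \<in> \<A> \<Longrightarrow> openin \<Sigma> (cdom c)"
  and homeo: "c \<in> \<A> \<Longrightarrow> homeomorphic_map (subtopology \<Sigma> (cdom c)) (top_of_set (cimg c)) (snd c)"
  and hausdorff: "Hausdorff_space \<Sigma>"
  and transition: "c \<in> \<A> \<Longrightarrow> d \<in> \<A> \<Longrightarrow> smooth_on (snd c ` (cdom c \<inter> cdom d)) (snd d \<circ> cpar c)"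
  using manifold by (auto simp: smooth_manifold4_def)

lemma cdom_subset: "c \<in> \<A> \<Longrightarrow> cdom c \<subseteq> topspace \<Sigma>"
  by (rule openin_subset[OF openin_cdom])

lemma inj_on_chart: "c \<in> \<A> \<Longrightarrow> inj_on (snd c) (cdom c)"
  using homeomorphic_imp_injective_map[OF homeo, of c] cdom_subset[of c]
  by (simp add: Int_absorb1)

lemma cpar_chart: "c \<in> \<A> \<Longrightarrow> p \<in> cdom c \<Longrightarrow> cpar c (snd c p) = p"
  using inj_on_chart[of c] by (simp add: cpar_def cdom_def)

lemma cpar_mem: "x \<in> cimg c \<Longrightarrow> cpar c x \<in> cdom c"
  by (simp add: cpar_def cdom_def cimg_def inv_into_into)

lemma chart_cpar: "x \<in> cimg c \<Longrightarrow> snd c (cpar c x) = x"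
  by (simp add: cpar_def cimg_def f_inv_into_f)

lemma chart_mem: "p \<in> cdom c \<Longrightarrow> snd c p \<in> cimg c"
  by (simp add: cdom_def cimg_def)

lemma open_chart_image:
  assumes c: "c \<in> \<A>" and V: "openin \<Sigma> V" "V \<subseteq> cdom c"
  shows "open (snd c ` V)"
proof -
  have "openin (subtopology \<Sigma> (cdom c)) V"
    using V openin_cdom[OF c] by (simp add: openin_open_subtopology)
  then have "openin (top_of_set (cimg c)) (snd c ` V)"
    using homeomorphic_imp_open_map[OF homeo[OF c]] by (simp add: open_map_def)
  then show ?thesis using open_cimg[OF c] openin_open_trans by blast
qed

lemma compactin_chart_image_iff:
  assumes c: "c \<in> \<A>" and K: "K \<subseteq> cdom c"
  shows "compact (snd c ` K) \<longleftrightarrow> compactin \<Sigma> K"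
proof -
  have "compactin (top_of_set (cimg c)) (snd c ` K) \<longleftrightarrow> compactin (subtopology \<Sigma> (cdom c)) K"
    by (rule homeomorphic_map_compactness[OF homeo[OF c]]) (use K cdom_subset[OF c] in auto)
  moreover have "snd c ` K \<subseteq> cimg c" using K by (auto intro: chart_mem)
  ultimately show ?thesis using K by (simp add: compactin_subtopology)
qed

text \<open>Open sets of the two kinds from which a locally supported variation is glued.\<close>

lemma open_overlap: "c \<in> \<A> \<Longrightarrow> d \<in> \<A> \<Longrightarrow> open (snd c ` (cdom c \<inter> cdom d))"
  by (rule open_chart_image) (auto intro: openin_Int openin_cdom)

lemma open_off_compact:
  assumes "c \<in> \<A>" "compactin \<Sigma> K"
  shows "open (snd c ` (cdom c - K))"
  by (rule open_chart_image[OF assms(1)])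
     (auto intro: openin_diff openin_cdom assms compactin_imp_closedin[OF hausdorff])

lemma overlap_iff: "c \<in> \<A> \<Longrightarrow> x \<in> snd c ` (cdom c \<inter> S) \<longleftrightarrow> x \<in> cimg c \<and> cpar c x \<in> S"
  by (metis (no_types, lifting) IntD1 IntD2 IntI chart_cpar chart_mem cpar_chart cpar_mem image_iff)

lemma variation_immersion_family:
  assumes c: "c \<in> \<A>" and "\<epsilon> > 0" and v: "smooth_variation \<Sigma> \<A> f \<epsilon> K \<Psi>"
  shows "immersion_family (cimg c) \<epsilon> (\<lambda>t. \<Psi> t \<circ> cpar c)"
proof -
  interpret T: time_domain "cimg c" \<epsilon> by unfold_locales (use open_cimg[OF c] \<open>\<epsilon> > 0\<close> in auto)
  have "smooth_on ({-\<epsilon><..<\<epsilon>} \<times> cimg c) (\<lambda>(t, x). \<Psi> t (cpar c x))"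
    using v c by (auto simp: smooth_variation_def)
  moreover have "(\<lambda>(t, x). \<Psi> t (cpar c x)) = (\<lambda>p. (\<Psi> (fst p) \<circ> cpar c) (snd p))" by auto
  ultimately have "T.jsmooth (\<lambda>t. \<Psi> t \<circ> cpar c)" by (simp add: T.jsmooth_def)
  moreover have "inj (frechet_derivative (\<Psi> t \<circ> cpar c) (at x))" if "t \<in> {-\<epsilon><..<\<epsilon>}" "x \<in> cimg c" for t x
    using v c that by (auto simp: smooth_variation_def immersion_def)
  ultimately show ?thesis by unfold_locales
qed

lemma first_variation_in_chart:
  assumes c: "c \<in> \<A>" and "\<epsilon> > 0" and v: "smooth_variation \<Sigma> \<A> f \<epsilon> K \<Psi>"
    and K: "compactin \<Sigma> K" "K \<subseteq> cdom c"
  shows "((\<lambda>t. energy c K (\<Psi> t)) has_real_derivative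
    (LINT x:snd c ` K|lborel. vol_density (\<Psi> 0 \<circ> cpar c) x * (dt (\<lambda>t. \<Psi> t \<circ> cpar c) x \<bullet> W (f \<circ> cpar c) x))) (at 0)"
proof -
  interpret family: immersion_family "cimg c" \<epsilon> "\<lambda>t. \<Psi> t \<circ> cpar c"
    by (rule variation_immersion_family[OF c \<open>\<epsilon> > 0\<close> v])
  have fixed: "\<Psi> t (cpar c x) = f (cpar c x)" if "t \<in> {-\<epsilon><..<\<epsilon>}" "x \<in> cimg c" "t = 0 \<or> x \<notin> snd c ` K" for t x
  proof -
    have "cpar c x \<in> topspace \<Sigma>" using cpar_mem[OF that(2)] cdom_subset[OF c] by blast
    moreover have "cpar c x \<in> K \<Longrightarrow> x \<in> snd c ` K" using chart_cpar[OF that(2)] by force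
    moreover have "\<forall>p\<in>topspace \<Sigma>. \<Psi> 0 p = f p" "\<forall>t\<in>{-\<epsilon><..<\<epsilon>}. \<forall>p\<in>topspace \<Sigma> - K. \<Psi> t p = f p"
      using v unfolding smooth_variation_def by blast+
    ultimately show ?thesis using that(1,3) by blast
  qed
  have compact: "compact (snd c ` K)" using compactin_chart_image_iff[OF c K(2)] K(1) by simp
  have sub: "snd c ` K \<subseteq> cimg c" using K(2) by (auto intro: chart_mem)
  have "((\<lambda>t. energy c K (\<Psi> t)) has_real_derivative
    (LINT x:snd c ` K|lborel. vol_density (\<Psi> 0 \<circ> cpar c) x * (dt (\<lambda>t. \<Psi> t \<circ> cpar c) x \<bullet> W (\<Psi> 0 \<circ> cpar c) x))) (at 0)"
    unfolding energy_def
  proof (rule family.first_variation[OF compact sub])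
    fix t x assume tx: "t \<in> {-\<epsilon><..<\<epsilon>}" "x \<in> cimg c" "x \<notin> snd c ` K"
    show "(\<Psi> t \<circ> cpar c) x = (\<Psi> 0 \<circ> cpar c) x"
      unfolding o_apply using fixed[OF tx(1,2)] fixed[OF family.zero_mem tx(2)] tx(3) by simp
  qed
  moreover have "W (\<Psi> 0 \<circ> cpar c) x = W (f \<circ> cpar c) x" if "x \<in> snd c ` K" for x
  proof (rule family.W_cong)
    show "x \<in> cimg c" using that sub by blast
    show "(\<Psi> 0 \<circ> cpar c) y = (f \<circ> cpar c) y" if "y \<in> cimg c" for y
      using fixed[OF family.zero_mem that] by simp
  qed
  then have "(LINT x:snd c ` K|lborel. vol_density (\<Psi> 0 \<circ> cpar c) x * (dt (\<lambda>t. \<Psi> t \<circ> cpar c) x \<bullet> W (\<Psi> 0 \<circ> cpar c) x))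
    = (LINT x:snd c ` K|lborel. vol_density (\<Psi> 0 \<circ> cpar c) x * (dt (\<lambda>t. \<Psi> t \<circ> cpar c) x \<bullet> W (f \<circ> cpar c) x))"
    by (intro set_lebesgue_integral_cong) (auto simp: compact compact_imp_closed)
  ultimately show ?thesis by (simp only:)
qed


text \<open>A bump in one chart, pushed along a constant vector, is an admissible variation for short
  times: the immersion condition is open and needs to be checked only over a compact set.\<close>

lemma bump_variation:
  fixes f :: "'a \<Rightarrow> real^'m" and e :: "real^'m"
  assumes f: "immersion \<A> f" and c: "c \<in> \<A>" and r: "r > 0" "cball a r \<subseteq> cimg c"
  defines "\<Psi> \<equiv> (\<lambda>t p. if p \<in> cdom c then f p + (t * bump a r (snd c p)) *\<^sub>R e else f p)"
    and "K \<equiv> cpar c ` cball a r"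
  shows "compactin \<Sigma> K" "K \<subseteq> cdom c" "snd c ` K = cball a r"
    and "\<exists>\<epsilon>>0. smooth_variation \<Sigma> \<A> f \<epsilon> K \<Psi>"
proof -
  let ?b = "bump a r" and ?F = "f \<circ> cpar c"
  show Kc: "K \<subseteq> cdom c" using r(2) by (auto simp: K_def intro: cpar_mem)
  show img: "snd c ` K = cball a r"
    using r(2) chart_cpar[of _ c] by (force simp: K_def image_image)
  show K: "compactin \<Sigma> K"
    using compactin_chart_image_iff[OF c Kc] by (simp add: img)
  have b0: "?b x = 0" if "x \<notin> ball a r" for x
    using that bump_pos_iff[OF r(1), of a x] bump_nonneg[of a r x] by simp
  have smF: "smooth_on (cimg d) (f \<circ> cpar d)" if "d \<in> \<A>" for d
    using f that by (simp add: immersion_def smooth_map_def)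
  have injF: "inj (frechet_derivative (f \<circ> cpar d) (at x))" if "d \<in> \<A>" "x \<in> cimg d" for d x
    using f that by (simp add: immersion_def)
  define G where "G = (\<lambda>t y. ?F y + (t * ?b y) *\<^sub>R e)"
  interpret T: time_domain "cimg c" 1 by unfold_locales (simp_all add: open_cimg[OF c])
  have jb: "T.jsmooth (\<lambda>t. ?b)"
    by (rule T.jsmooth_slice_const[OF smooth_on_subset[OF smooth_on_bump]]) simp
  have jt: "T.jsmooth (\<lambda>t x. t)"
    unfolding T.jsmooth_def by (intro smooth_on_bounded_linear T.open_cylinder bounded_linear_fst)
  have jG: "T.jsmooth G"
    unfolding G_def by (intro T.jsmooth_intros T.jsmooth_slice_const smF c jb jt)

  \<comment> \<open>the times at which the metric degenerates somewhere on the ball form a compact set without 0\<close>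
  have "\<exists>\<epsilon>>0. \<epsilon> \<le> 1 \<and> (\<forall>t\<in>{-\<epsilon><..<\<epsilon>}. \<forall>y\<in>cball a r. det (metric (G t) y) \<noteq> 0)"
  proof -
    let ?h = "\<lambda>p. det (metric (G (fst p)) (snd p))"
    let ?C = "{-1/2..1/2::real} \<times> cball a r"
    have "T.jsmooth (\<lambda>t. gl (G t) i j)" for i j
      unfolding gl_eq[abs_def] by (intro T.jsmooth_intros jG)
    then have "smooth_on ({-1<..<1} \<times> cimg c) ?h"
      by (intro smooth_on_det T.open_cylinder) (simp add: T.jsmooth_def gl_def)
    then have cont: "continuous_on ?C ?h"
      by (rule continuous_on_subset[OF smooth_on_continuous_on]) (use r in auto)
    have C: "compact ?C" by (intro compact_Times compact_Icc compact_cball)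
    have "closed (?C \<inter> ?h -` {0})"
      by (rule continuous_closed_preimage[OF cont compact_imp_closed[OF C] closed_singleton])
    from compact_Int_closed[OF C this] have "compact (?C \<inter> ?h -` {0})"
      by (simp add: Int_assoc[symmetric])
    moreover define bad where "bad = fst ` (?C \<inter> ?h -` {0})"
    ultimately have "compact bad"
      unfolding bad_def by (intro compact_continuous_image continuous_intros)
    then have good: "open (- bad)" by (intro open_Compl compact_imp_closed)
    have "0 \<in> - bad"
    proof -
      interpret patch "cimg c" ?F
        by unfold_locales (simp_all add: open_cimg c smF injF)
      have "det (metric ?F y) > 0" if "y \<in> cball a r" for y
        using det_metric_pos that r(2) by blast
      moreover have "G 0 = ?F" by (simp add: G_def fun_eq_iff)
      ultimately show ?thesis unfolding bad_def by force
    qed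
    then obtain \<delta> where \<delta>: "\<delta> > 0" "ball 0 \<delta> \<subseteq> - bad"
      by (rule openE[OF good])
    have "det (metric (G t) y) \<noteq> 0" if "t \<in> {- min \<delta> (1/2)<..<min \<delta> (1/2)}" "y \<in> cball a r" for t y
    proof
      assume "det (metric (G t) y) = 0"
      moreover have "t \<in> {-1/2..1/2}" "t \<in> ball 0 \<delta>" using that by (auto simp: dist_real_def)
      ultimately have "t \<in> bad"
        unfolding bad_def using that(2) by (intro image_eqI[of _ _ "(t, y)"]) auto
      then show False using \<delta>(2) \<open>t \<in> ball 0 \<delta>\<close> by blast
    qed
    then show ?thesis using \<delta>(1) by (intro exI[of _ "min \<delta> (1/2)"]) auto
  qed
  then obtain \<epsilon> where \<epsilon>: "\<epsilon> > 0" "\<epsilon> \<le> 1"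
    and det: "\<And>t y. t \<in> {-\<epsilon><..<\<epsilon>} \<Longrightarrow> y \<in> cball a r \<Longrightarrow> det (metric (G t) y) \<noteq> 0" by blast

  have smG: "smooth_on (cimg c) (G t)" if "t \<in> {-\<epsilon><..<\<epsilon>}" for t
    by (rule T.smooth_slice[OF jG]) (use that \<epsilon> in auto)
  have off_ball: "open (cimg c - cball a r)" using open_cimg[OF c] by (simp add: open_Diff)
  have injG: "inj (frechet_derivative (G t) (at y))" if t: "t \<in> {-\<epsilon><..<\<epsilon>}" and y: "y \<in> cimg c" for t y
  proof (cases "y \<in> cball a r")
    case True
    show ?thesis
      by (rule inj_frechet_derivative_if_det[OF smooth_on_differentiable[OF smG[OF t] y] det[OF t True]])
  next
    case False
    have "frechet_derivative (G t) (at y) = frechet_derivative ?F (at y)"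
      by (rule frechet_derivative_transform_within_open[OF smooth_on_differentiable[OF smG[OF t] y] off_ball])
         (use False y in \<open>auto simp: G_def b0\<close>)
    then show ?thesis using injF[OF c y] by simp
  qed

  have \<Psi>_on: "\<Psi> t p = G t (snd c p)" if "p \<in> cdom c" for t p
    using that by (simp add: \<Psi>_def G_def cpar_chart[OF c])
  have \<Psi>_off: "\<Psi> t p = f p" if "p \<notin> K" for t p
  proof (cases "p \<in> cdom c")
    case True
    have "snd c p \<notin> cball a r"
    proof
      assume "snd c p \<in> cball a r"
      then have "cpar c (snd c p) \<in> K" by (auto simp: K_def)
      then show False using that cpar_chart[OF c True] by simp
    qed
    then show ?thesis by (simp add: \<Psi>_def b0)
  qed (simp add: \<Psi>_def)

  \<comment> \<open>each chart domain is covered by two open sets: the overlap with the domain of \<open>c\<close>, where the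
    variation is \<open>G\<close> after a transition map, and the complement of \<open>K\<close>, where it is constant in time\<close>
  have joint: "smooth_on ({-\<epsilon><..<\<epsilon>} \<times> cimg d) (\<lambda>(t, x). \<Psi> t (cpar d x))" if d: "d \<in> \<A>" for d
  proof (rule smooth_on_local)
    fix q assume q: "q \<in> {-\<epsilon><..<\<epsilon>} \<times> cimg d"
    obtain t x where tx: "q = (t, x)" by (cases q)
    show "\<exists>S. open S \<and> q \<in> S \<and> smooth_on S (\<lambda>(t, x). \<Psi> t (cpar d x))"
    proof (cases "cpar d x \<in> cdom c")
      case True
      let ?O = "snd d ` (cdom d \<inter> cdom c)"
      let ?S = "{-\<epsilon><..<\<epsilon>} \<times> ?O"
      have oS: "open ?S" by (intro open_Times open_overlap[OF d c]) simp
      have "smooth_on ?S (\<lambda>p. (snd c \<circ> cpar d) (snd p))"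
        by (rule smooth_on_compose[OF oS open_overlap[OF d c] transition[OF d c]])
           (auto intro!: smooth_on_bounded_linear oS bounded_linear_snd)
      then have "smooth_on ?S (\<lambda>p. (fst p, 0) + (0, (snd c \<circ> cpar d) (snd p)))"
        by (intro smooth_on_add[OF oS] smooth_on_bounded_linear_compose[OF oS bounded_linear_Pair[OF bounded_linear_zero bounded_linear_ident]]
            smooth_on_bounded_linear[OF oS bounded_linear_Pair[OF bounded_linear_fst bounded_linear_zero]])
      then have "smooth_on ?S (\<lambda>p. (fst p, (snd c \<circ> cpar d) (snd p)))" by simp
      moreover have "(fst p, (snd c \<circ> cpar d) (snd p)) \<in> {-1<..<1} \<times> cimg c" if p: "p \<in> ?S" for p
      proof -
        have "snd p \<in> ?O" using p by (simp only: mem_Times_iff)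
        then have "cpar d (snd p) \<in> cdom c" by (simp only: overlap_iff[OF d])
        moreover have "fst p \<in> {-1<..<1}" using p \<epsilon>(2) by (auto simp: mem_Times_iff)
        ultimately show ?thesis by (simp add: chart_mem)
      qed
      ultimately have "smooth_on ?S (\<lambda>p. G (fst (fst p, (snd c \<circ> cpar d) (snd p))) (snd (fst p, (snd c \<circ> cpar d) (snd p))))"
        by (rule smooth_on_compose[OF oS T.open_cylinder jG[unfolded T.jsmooth_def]])
      then have "smooth_on ?S (\<lambda>p. G (fst p) ((snd c \<circ> cpar d) (snd p)))"
        by (simp only: fst_conv snd_conv)
      then have "smooth_on ?S (\<lambda>(t, x). \<Psi> t (cpar d x))"
        by (subst smooth_on_cong[OF oS]) (auto simp: \<Psi>_on cpar_chart[OF d])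
      moreover have "q \<in> ?S" using q True by (simp add: tx overlap_iff[OF d])
      ultimately show ?thesis using oS by blast
    next
      case False
      let ?O = "snd d ` (cdom d - K)"
      let ?S = "{-\<epsilon><..<\<epsilon>} \<times> ?O"
      have O: "y \<in> ?O \<longleftrightarrow> y \<in> cimg d \<and> cpar d y \<notin> K" for y
        using overlap_iff[OF d, of y "- K"] by (simp add: Diff_eq)
      have oO: "open ?O" by (rule open_off_compact[OF d K])
      have oS: "open ?S" by (intro open_Times oO) simp
      have "smooth_on ?S (\<lambda>p. (f \<circ> cpar d) (snd p))"
        by (rule smooth_on_compose[OF oS open_cimg[OF d] smF[OF d]])
           (auto intro!: smooth_on_bounded_linear oS bounded_linear_snd simp: chart_mem)
      then have "smooth_on ?S (\<lambda>(t, x). \<Psi> t (cpar d x))"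
        by (subst smooth_on_cong[OF oS]) (auto simp: \<Psi>_off cpar_chart[OF d])
      moreover have "q \<in> ?S" using q False Kc by (auto simp: tx O)
      ultimately show ?thesis using oS by blast
    qed
  qed

  have "immersion \<A> (\<Psi> t)" if t: "t \<in> {-\<epsilon><..<\<epsilon>}" for t
    unfolding immersion_def smooth_map_def
  proof (intro conjI ballI)
    fix d assume d: "d \<in> \<A>"
    interpret Td: time_domain "cimg d" \<epsilon> by unfold_locales (simp_all add: open_cimg[OF d] \<epsilon>)
    have "(\<lambda>(t, x). \<Psi> t (cpar d x)) = (\<lambda>p. (\<Psi> (fst p) \<circ> cpar d) (snd p))" by auto
    then have "Td.jsmooth (\<lambda>t. \<Psi> t \<circ> cpar d)" using joint[OF d] by (simp add: Td.jsmooth_def)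
    then show sm: "smooth_on (cimg d) (\<Psi> t \<circ> cpar d)" by (rule Td.smooth_slice) (rule t)
    fix x assume x: "x \<in> cimg d"
    show "inj (frechet_derivative (\<Psi> t \<circ> cpar d) (at x))"
    proof (cases "cpar d x \<in> cdom c")
      case True
      let ?\<tau> = "snd c \<circ> cpar d" and ?\<sigma> = "snd d \<circ> cpar c"
      let ?O = "snd d ` (cdom d \<inter> cdom c)" and ?P = "snd c ` (cdom c \<inter> cdom d)"
      have xO: "x \<in> ?O" using x True by (simp add: overlap_iff[OF d])
      have \<tau>x: "?\<tau> x \<in> cimg c" "?\<tau> x \<in> ?P"
        using True cpar_mem[OF x] by (auto intro: chart_mem)
      have d\<tau>: "(?\<tau> has_derivative frechet_derivative ?\<tau> (at x)) (at x)"
        by (rule smooth_on_has_derivative[OF transition[OF d c] xO])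
      have d\<sigma>: "(?\<sigma> has_derivative frechet_derivative ?\<sigma> (at (?\<tau> x))) (at (?\<tau> x))"
        by (rule smooth_on_has_derivative[OF transition[OF c d] \<tau>x(2)])
      have "((\<lambda>y. ?\<sigma> (?\<tau> y)) has_derivative (\<lambda>v. frechet_derivative ?\<sigma> (at (?\<tau> x)) (frechet_derivative ?\<tau> (at x) v))) (at x)"
        by (rule has_derivative_compose[OF d\<tau> d\<sigma>])
      then have "((\<lambda>y. y) has_derivative (\<lambda>v. frechet_derivative ?\<sigma> (at (?\<tau> x)) (frechet_derivative ?\<tau> (at x) v))) (at x)"
        by (rule has_derivative_transform_within_open[OF _ open_overlap[OF d c] xO])
           (simp add: overlap_iff[OF d] cpar_chart[OF c] chart_cpar)
      from has_derivative_unique[OF this has_derivative_ident]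
      have left_inverse: "frechet_derivative ?\<sigma> (at (?\<tau> x)) (frechet_derivative ?\<tau> (at x) v) = v" for v
        by (rule fun_cong)
      have inj\<tau>: "inj (frechet_derivative ?\<tau> (at x))"
        by (rule inj_on_inverseI) (rule left_inverse)
      have "((\<lambda>y. G t (?\<tau> y)) has_derivative (\<lambda>v. frechet_derivative (G t) (at (?\<tau> x)) (frechet_derivative ?\<tau> (at x) v))) (at x)"
        by (rule has_derivative_compose[OF d\<tau> smooth_on_has_derivative[OF smG[OF t] \<tau>x(1)]])
      then have "(\<Psi> t \<circ> cpar d has_derivative (\<lambda>v. frechet_derivative (G t) (at (?\<tau> x)) (frechet_derivative ?\<tau> (at x) v))) (at x)"
        by (rule has_derivative_transform_within_open[OF _ open_overlap[OF d c] xO])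
           (simp add: overlap_iff[OF d] \<Psi>_on)
      then have "frechet_derivative (\<Psi> t \<circ> cpar d) (at x) = frechet_derivative (G t) (at (?\<tau> x)) \<circ> frechet_derivative ?\<tau> (at x)"
        unfolding o_def by (rule frechet_derivative_at[symmetric])
      then show ?thesis using inj_compose[OF injG[OF t \<tau>x(1)] inj\<tau>] by simp
    next
      case False
      let ?O = "snd d ` (cdom d - K)"
      have O: "y \<in> ?O \<longleftrightarrow> y \<in> cimg d \<and> cpar d y \<notin> K" for y
        using overlap_iff[OF d, of y "- K"] by (simp add: Diff_eq)
      have "frechet_derivative (\<Psi> t \<circ> cpar d) (at x) = frechet_derivative (f \<circ> cpar d) (at x)"
        by (rule frechet_derivative_transform_within_open[OF smooth_on_differentiable[OF sm x] open_off_compact[OF d K]])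
           (use False Kc x in \<open>auto simp: O \<Psi>_off\<close>)
      then show ?thesis using injF[OF d x] by simp
    qed
  qed
  then have "smooth_variation \<Sigma> \<A> f \<epsilon> K \<Psi>"
    using joint by (auto simp: smooth_variation_def \<Psi>_off) (simp add: \<Psi>_def)
  then show "\<exists>\<epsilon>>0. smooth_variation \<Sigma> \<A> f \<epsilon> K \<Psi>" using \<epsilon>(1) by blast
qed

end

lemma integral_pos_if_continuous:
  fixes g :: "'a::euclidean_space \<Rightarrow> real"
  assumes r: "r > 0" and g: "continuous_on (cball a r) g"
    and nonneg: "\<And>x. x \<in> cball a r \<Longrightarrow> g x \<ge> 0" and pos: "\<And>x. x \<in> ball a r \<Longrightarrow> g x > 0"
  shows "(LINT x:cball a r|lborel. g x) > 0"
proof -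
  let ?g = "\<lambda>x. indicator (cball a r) x *\<^sub>R g x"
  have int: "integrable lborel ?g" by (rule borel_integrable_compact[OF compact_cball g])
  have nn: "AE x in lborel. 0 \<le> ?g x" using nonneg by (intro AE_I2) (simp add: indicator_def)
  have "(LINT x|lborel. ?g x) \<noteq> 0"
  proof
    assume "(LINT x|lborel. ?g x) = 0"
    then have "AE x in lborel. ?g x = 0" using integral_nonneg_eq_0_iff_AE[OF int nn] by simp
    then have "AE x in lborel. x \<notin> ball a r"
      by (rule AE_mp) (intro AE_I2, use pos in \<open>force simp: indicator_def\<close>)
    then have "ball a r \<in> null_sets lborel" by (subst AE_iff_null_sets) simp_all
    then have "negligible (ball a r)" by (simp add: negligible_iff_null_sets null_sets_completionI)
    then show False using open_not_negligible[of "ball a r"] r by auto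
  qed
  moreover have "(LINT x|lborel. ?g x) \<ge> 0" by (rule integral_nonneg_AE[OF nn])
  ultimately show ?thesis by (simp add: set_lebesgue_integral_def)
qed

section \<open>Critical points\<close>

theorem theorem2p2p2:
  fixes \<Sigma> :: "'a topology" and \<A> :: "'a chart set" and \<Phi> :: "'a \<Rightarrow> real^'m"
  assumes "smooth_manifold4 \<Sigma> \<A>" and "immersion \<A> \<Phi>"
  shows "critical_point \<Sigma> \<A> \<Phi> \<longleftrightarrow> (\<forall>c\<in>\<A>. \<forall>x\<in>cimg c. W (\<Phi> \<circ> cpar c) x = 0)"
proof
  interpret manifold \<Sigma> \<A> by unfold_locales (rule assms(1))
  assume W0: "\<forall>c\<in>\<A>. \<forall>x\<in>cimg c. W (\<Phi> \<circ> cpar c) x = 0"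
  show "critical_point \<Sigma> \<A> \<Phi>"
    unfolding critical_point_def
  proof (intro ballI allI impI, elim conjE)
    fix c K and \<epsilon> :: real and \<Psi> :: "real \<Rightarrow> 'a \<Rightarrow> real^'m"
    assume *: "c \<in> \<A>" "compactin \<Sigma> K" "K \<subseteq> cdom c" "\<epsilon> > 0" "smooth_variation \<Sigma> \<A> \<Phi> \<epsilon> K \<Psi>"
    have "(LINT x:snd c ` K|lborel. vol_density (\<Psi> 0 \<circ> cpar c) x * (dt (\<lambda>t. \<Psi> t \<circ> cpar c) x \<bullet> W (\<Phi> \<circ> cpar c) x))
      = (LINT x|(lborel :: (real^4) measure). 0)"
      unfolding set_lebesgue_integral_def
    proof (rule Bochner_Integration.integral_cong[OF refl])
      fix x
      have "x \<in> cimg c" if "x \<in> snd c ` K" using that *(3) by (auto intro: chart_mem)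
      then show "indicator (snd c ` K) x *\<^sub>R (vol_density (\<Psi> 0 \<circ> cpar c) x * (dt (\<lambda>t. \<Psi> t \<circ> cpar c) x \<bullet> W (\<Phi> \<circ> cpar c) x)) = 0"
        using W0 *(1) by (simp add: indicator_def)
    qed
    then show "((\<lambda>t. energy c K (\<Psi> t)) has_real_derivative 0) (at 0)"
      using first_variation_in_chart[OF *(1,4,5,2,3)] by simp
  qed
next
  interpret manifold \<Sigma> \<A> by unfold_locales (rule assms(1))
  assume crit: "critical_point \<Sigma> \<A> \<Phi>"
  show "\<forall>c\<in>\<A>. \<forall>x\<in>cimg c. W (\<Phi> \<circ> cpar c) x = 0"
  proof (intro ballI, rule ccontr)
    fix c a assume c: "c \<in> \<A>" and a: "a \<in> cimg c" and ne: "W (\<Phi> \<circ> cpar c) a \<noteq> 0"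
    let ?F = "\<Phi> \<circ> cpar c"
    let ?e = "W ?F a"
    interpret patch "cimg c" ?F
      using assms(2) c by unfold_locales (auto simp: open_cimg immersion_def smooth_map_def)
    let ?g = "\<lambda>x. ?e \<bullet> W ?F x"
    have cont: "continuous_on (cimg c) ?g"
      by (intro smooth_on_continuous_on smooth_intros smooth_W)
    have "open (cimg c \<inter> ?g -` {0<..})"
      by (rule continuous_open_preimage[OF cont open_U open_greaterThan])
    moreover have "a \<in> cimg c \<inter> ?g -` {0<..}" using a ne by simp
    ultimately obtain r where r: "r > 0" "cball a r \<subseteq> cimg c \<inter> ?g -` {0<..}"
      using open_contains_cball by blast
    have sub: "cball a r \<subseteq> cimg c" using r by blast
    define \<Psi> where "\<Psi> = (\<lambda>t p. if p \<in> cdom c then \<Phi> p + (t * bump a r (snd c p)) *\<^sub>R ?e else \<Phi> p)"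
    define K where "K = cpar c ` cball a r"
    note b = bump_variation(1-3)[OF assms(2) c r(1) sub, folded K_def]
      bump_variation(4)[OF assms(2) c r(1) sub, of ?e, folded \<Psi>_def K_def]
    obtain \<epsilon> where \<epsilon>: "\<epsilon> > 0" "smooth_variation \<Sigma> \<A> \<Phi> \<epsilon> K \<Psi>" using b(4) by blast
    have D: "((\<lambda>t. energy c K (\<Psi> t)) has_real_derivative 0) (at 0)"
      using crit c b(1,2) \<epsilon> unfolding critical_point_def by blast
    have \<Psi>: "(\<Psi> t \<circ> cpar c) x = ?F x + (t * bump a r x) *\<^sub>R ?e" if "x \<in> cimg c" for t x
      using that cpar_mem[OF that] by (simp add: \<Psi>_def chart_cpar)
    interpret family: immersion_family "cimg c" \<epsilon> "\<lambda>t. \<Psi> t \<circ> cpar c"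
      by (rule variation_immersion_family[OF c \<epsilon>])
    have vel: "dt (\<lambda>t. \<Psi> t \<circ> cpar c) x = bump a r x *\<^sub>R ?e" if x: "x \<in> cimg c" for x
    proof (rule family.dt_eqI_vector[OF x family.jsmooth_\<Phi>])
      have "((\<lambda>t. ?F x + (t * bump a r x) *\<^sub>R ?e) has_vector_derivative bump a r x *\<^sub>R ?e) (at 0)"
        by (auto intro!: derivative_eq_intros simp: has_vector_derivative_def)
      then show "((\<lambda>t. (\<Psi> t \<circ> cpar c) x) has_vector_derivative bump a r x *\<^sub>R ?e) (at 0)"
        by (simp only: \<Psi>[OF x])
    qed
    let ?\<mu> = "vol_density (\<Psi> 0 \<circ> cpar c)"
    let ?d = "\<lambda>x. ?\<mu> x * (dt (\<lambda>t. \<Psi> t \<circ> cpar c) x \<bullet> W ?F x)"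
    have \<mu>: "?\<mu> x > 0" if "x \<in> cimg c" for x
      by (rule patch.vol_density_pos[OF family.patch_at_zero that])
    have d: "?d x = ?\<mu> x * (bump a r x * ?g x)" if "x \<in> cimg c" for x
      by (simp add: vel[OF that])
    have gpos: "?g x > 0" if "x \<in> cball a r" for x using that r(2) by blast
    have "(LINT x:cball a r|lborel. ?d x) > 0"
    proof (rule integral_pos_if_continuous[OF r(1)])
      have "smooth_on (cimg c) ?d"
        by (intro smooth_intros patch.smooth_vol_density[OF family.patch_at_zero] family.smooth_w smooth_W)
      then show "continuous_on (cball a r) ?d"
        using sub smooth_on_continuous_on continuous_on_subset by blast
      show "?d x \<ge> 0" if "x \<in> cball a r" for x
        using \<mu>[of x] gpos[OF that] bump_nonneg[of a r x] that sub d[of x] by (simp add: subset_eq)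
      show "?d x > 0" if "x \<in> ball a r" for x
      proof -
        have x: "x \<in> cball a r" "x \<in> cimg c" using that sub by auto
        have "bump a r x > 0" using that bump_pos_iff[OF r(1), of a x] by simp
        then show ?thesis using \<mu>[OF x(2)] gpos[OF x(1)] d[OF x(2)] by simp
      qed
    qed
    moreover have "(LINT x:cball a r|lborel. ?d x) = 0"
      using DERIV_unique[OF first_variation_in_chart[OF c \<epsilon> b(1,2)] D] by (simp add: b(3))
    ultimately show False by simp
  qed
qed

end
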